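(* Let $p$ be a prime and $\mathbf{F}_p$ the field with $p$ elements. The group $A_4(\mathbf{F}_p[t,t^{-1},(t-1)^{-1}])$ is finitely presented and has a quadratic Dehn function, i.e. its Dehn function $\delta$ satisfies $\delta(n)=O(n^2)$.
   Context: For a commutative ring $R$, $A_4(R)$ denotes the group of upper triangular $4\times 4$ matrices over $R$ with diagonal $(1,t_{22},t_{33},1)$, where $t_{22},t_{33}\in R^\times$, and with arbitrary entries $x_{ij}\in R$ for $i<j$. Dehn function of a finitely presented group $\Gamma=\langle S\mid\mathcal{R}\rangle$ ($S$ finite symmetric, $\mathcal{R}$ the finite set of all relations of length at most some large enough $r$): the area $\alpha(w)$ of a relation $w\in\ker(F_S\to\Gamma)$ is its word length with respect to the union of $F_S$-conjugates of $\mathcal{R}$, and $\delta(n)=\sup\{\alpha(w): w\in\ker(F_S\to\Gamma),\ |w|_S\le n\}$. Its asymptotic behavior does not depend on the choices. *)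

theory Defs
  imports
    Jordan_Normal_Form.VS_Connect
    "HOL-Algebra.Generated_Groups"
    "HOL-Algebra.Generated_Rings"
    "HOL-Computational_Algebra.Normalized_Fraction"
    "HOL-Library.Landau_Symbols"
    "HOL-Library.Extended_Nat"
begin

text \<open>The letter \<open>(s, False)\<close> stands for the generator \<open>s\<close> and \<open>(s, True)\<close> for its formal inverse.
  The free group on \<open>S\<close> is realised on the freely reduced words, so that the word length of
  an element with respect to \<open>S\<close> is the length of the list. If \<open>S\<close> is a subset of a group
  with \<open>s\<close> and \<open>inv s\<close> both in \<open>S\<close>, these are still two unrelated free generators.\<close>

type_synonym 's word = "('s \<times> bool) list"

definition flip :: "'s \<times> bool \<Rightarrow> 's \<times> bool" where
  "flip x = (fst x, \<not> snd x)"

definition reduced :: "'s word \<Rightarrow> bool" where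
  "reduced w \<longleftrightarrow> successively (\<lambda>x y. y \<noteq> flip x) w"

definition cons_red :: "'s \<times> bool \<Rightarrow> 's word \<Rightarrow> 's word" where
  "cons_red x w = (if w \<noteq> [] \<and> hd w = flip x then tl w else x # w)"

definition free_group :: "'s set \<Rightarrow> 's word monoid" where
  "free_group S = \<lparr>carrier = {w. set w \<subseteq> S \<times> UNIV \<and> reduced w},
                   mult = (\<lambda>u v. foldr cons_red u v),
                   one = []\<rparr>"

definition word_val :: "('a, 'b) monoid_scheme \<Rightarrow> 'a word \<Rightarrow> 'a" where
  "word_val G w =
     foldr (\<lambda>(s, i) g. (if i then inv\<^bsub>G\<^esub> s else s) \<otimes>\<^bsub>G\<^esub> g) w \<one>\<^bsub>G\<^esub>"

text \<open>The kernel of the homomorphism from the free group on \<open>S\<close> to \<open>G\<close>.\<close>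

definition relations :: "('a, 'b) monoid_scheme \<Rightarrow> 'a set \<Rightarrow> 'a word set" where
  "relations G S = {w \<in> carrier (free_group S). word_val G w = \<one>\<^bsub>G\<^esub>}"

definition conjugates :: "('a, 'b) monoid_scheme \<Rightarrow> 'a set \<Rightarrow> 'a set" where
  "conjugates G R = {g \<otimes>\<^bsub>G\<^esub> x \<otimes>\<^bsub>G\<^esub> inv\<^bsub>G\<^esub> g | g x. g \<in> carrier G \<and> x \<in> R}"

definition normal_closure :: "('a, 'b) monoid_scheme \<Rightarrow> 'a set \<Rightarrow> 'a set" where
  "normal_closure G R = generate G (conjugates G R)"

text \<open>\<open>G = \<langle>S | R\<rangle>\<close>, with \<open>S\<close> a generating subset of \<open>G\<close>.\<close>

definition presents :: "('a, 'b) monoid_scheme \<Rightarrow> 'a set \<Rightarrow> 'a word set \<Rightarrow> bool" where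
  "presents G S R \<longleftrightarrow>
     S \<subseteq> carrier G \<and> generate G S = carrier G \<and>
     R \<subseteq> relations G S \<and> normal_closure (free_group S) R = relations G S"

definition symmetric_in :: "('a, 'b) monoid_scheme \<Rightarrow> 'a set \<Rightarrow> bool" where
  "symmetric_in G S \<longleftrightarrow> (\<forall>s\<in>S. inv\<^bsub>G\<^esub> s \<in> S)"

definition finitely_presented :: "('a, 'b) monoid_scheme \<Rightarrow> bool" where
  "finitely_presented G \<longleftrightarrow>
     (\<exists>S R. finite S \<and> symmetric_in G S \<and> finite R \<and> presents G S R)"

definition short_relations :: "('a, 'b) monoid_scheme \<Rightarrow> 'a set \<Rightarrow> nat \<Rightarrow> 'a word set" where
  "short_relations G S r = {w \<in> relations G S. length w \<le> r}"

text \<open>The word length is infinite outside the subgroup generated by \<open>X\<close>.\<close>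

definition word_length :: "('a, 'b) monoid_scheme \<Rightarrow> 'a set \<Rightarrow> 'a \<Rightarrow> enat" where
  "word_length G X g =
     Inf {enat (length xs) | xs. set xs \<subseteq> X \<union> (\<lambda>x. inv\<^bsub>G\<^esub> x) ` X \<and>
                                 foldr (\<otimes>\<^bsub>G\<^esub>) xs \<one>\<^bsub>G\<^esub> = g}"

definition area :: "('a, 'b) monoid_scheme \<Rightarrow> 'a set \<Rightarrow> nat \<Rightarrow> 'a word \<Rightarrow> enat" where
  "area G S r w =
     word_length (free_group S) (conjugates (free_group S) (short_relations G S r)) w"

definition Dehn_function :: "('a, 'b) monoid_scheme \<Rightarrow> 'a set \<Rightarrow> nat \<Rightarrow> nat \<Rightarrow> enat" where
  "Dehn_function G S r n = (SUP w \<in> {w \<in> relations G S. length w \<le> n}. area G S r w)"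

text \<open>The growth of the Dehn function does not depend on \<open>S\<close> and \<open>r\<close>, so all admissible choices are
  covered; \<open>r\<close> is large enough when the relations of length at most \<open>r\<close> define \<open>G\<close>.
  For a finitely presented group there are such \<open>S\<close> and \<open>r\<close>,
  see \<open>finitely_presented_imp_short\<close> below.\<close>

definition quadratic_Dehn_function :: "('a, 'b) monoid_scheme \<Rightarrow> bool" where
  "quadratic_Dehn_function G \<longleftrightarrow>
     (\<forall>S r. finite S \<and> symmetric_in G S \<and> presents G S (short_relations G S r) \<longrightarrow>
        (\<forall>n. Dehn_function G S r n \<noteq> \<infinity>) \<and>
        (\<lambda>n. real (the_enat (Dehn_function G S r n))) \<in> O(\<lambda>n. real n ^ 2))"

text \<open>A commutative ring is given as a subring \<open>R\<close> of a ring type (possibly \<open>UNIV\<close>). Matrix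
  indices start at 0.\<close>

definition A4 :: "'a::comm_ring_1 set \<Rightarrow> 'a mat monoid" where
  "A4 R = \<lparr>carrier = {M \<in> carrier_mat 4 4. upper_triangular M \<and>
                        (\<forall>i<4. \<forall>j<4. M $$ (i,j) \<in> R) \<and>
                        M $$ (0,0) = 1 \<and> M $$ (3,3) = 1 \<and>
                        M $$ (1,1) \<in> Units (class_ring\<lparr>carrier := R\<rparr>) \<and>
                        M $$ (2,2) \<in> Units (class_ring\<lparr>carrier := R\<rparr>)},
           mult = (*),
           one = 1\<^sub>m 4\<rparr>"

text \<open>The ring \<open>k[t, 1/t, 1/(t-1)]\<close>, inside the field of rational functions \<open>k(t)\<close>.\<close>

definition const_fract :: "'k::field \<Rightarrow> 'k poly fract" where
  "const_fract c = to_fract [:c:]"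

definition t_fract :: "'k::field poly fract" where
  "t_fract = to_fract [:0, 1:]"

definition ring_t_inv :: "'k::field poly fract set" where
  "ring_t_inv = generate_ring class_ring
     (range const_fract \<union> {t_fract, inverse t_fract, inverse (t_fract - 1)})"

lemma flip_flip [simp]: "flip (flip x) = x"
  by (simp add: flip_def)

lemma reduced_Cons: "reduced (x # w) \<longleftrightarrow> reduced w \<and> (w = [] \<or> hd w \<noteq> flip x)"
  by (auto simp: reduced_def successively_Cons)

lemma reduced_tl: "reduced w \<Longrightarrow> reduced (tl w)"
  by (cases w) (auto simp: reduced_Cons)

lemma reduced_cons_red: "reduced w \<Longrightarrow> reduced (cons_red x w)"
  by (auto simp: cons_red_def reduced_Cons reduced_tl)

lemma reduced_foldr: "reduced v \<Longrightarrow> reduced (foldr cons_red u v)"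
  by (induction u) (auto simp: reduced_cons_red)

lemma set_cons_red: "set (cons_red x w) \<subseteq> insert x (set w)"
  by (auto simp: cons_red_def dest: list.set_sel(2))

lemma set_foldr_cons_red: "set (foldr cons_red u v) \<subseteq> set u \<union> set v"
proof (induction u)
  case (Cons x u)
  then show ?case using set_cons_red[of x "foldr cons_red u v"] by auto
qed simp

lemma cons_red_reduced: "reduced (x # w) \<Longrightarrow> cons_red x w = x # w"
  by (auto simp: reduced_Cons cons_red_def)

lemma cons_red_flip: "reduced w \<Longrightarrow> cons_red x (cons_red (flip x) w) = w"
  by (cases w) (auto simp: cons_red_def reduced_Cons neq_Nil_conv)

lemma foldr_cons_red_Nil: "reduced w \<Longrightarrow> foldr cons_red w [] = w"
  by (induction w) (auto simp: reduced_Cons cons_red_def)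

lemma foldr_cons_red_cons_red:
  assumes "reduced u" "reduced w"
  shows "foldr cons_red (cons_red x u) w = cons_red x (foldr cons_red u w)"
proof (cases "u \<noteq> [] \<and> hd u = flip x")
  case True
  then obtain v where u: "u = flip x # v" by (cases u) auto
  then show ?thesis
    using cons_red_flip[OF reduced_foldr[OF assms(2)], of x v] by (simp add: cons_red_def)
next
  case False
  then have "cons_red x u = x # u" unfolding cons_red_def by auto
  then show ?thesis by simp
qed

lemma foldr_cons_red_assoc:
  assumes "reduced v" "reduced w"
  shows "foldr cons_red (foldr cons_red u v) w = foldr cons_red u (foldr cons_red v w)"
  by (induction u) (auto simp: foldr_cons_red_cons_red reduced_foldr assms)

lemma reduced_inverse:
  assumes "reduced w" shows "reduced (rev (map flip w))"
proof -
  have "successively (\<lambda>x y. x \<noteq> flip y) w"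
    using assms unfolding reduced_def
    by (rule successively_mono) (auto simp: flip_def)
  then show ?thesis
    unfolding reduced_def
    by (simp add: successively_map) (erule successively_mono, auto simp: flip_def prod_eq_iff)
qed

lemma foldr_cons_red_inverse:
  "reduced v \<Longrightarrow> foldr cons_red (rev (map flip w)) (foldr cons_red w v) = v"
proof (induction w arbitrary: v)
  case (Cons x w)
  then show ?case
    using cons_red_flip[OF reduced_foldr[OF Cons.prems], of "flip x" w] by simp
qed simp

lemma group_free_group: "group (free_group S)"
proof (rule groupI)
  fix u v assume "u \<in> carrier (free_group S)" "v \<in> carrier (free_group S)"
  then show "u \<otimes>\<^bsub>free_group S\<^esub> v \<in> carrier (free_group S)"
    using set_foldr_cons_red[of u v] by (auto simp: free_group_def reduced_foldr)
next
  fix u assume u: "u \<in> carrier (free_group S)"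
  have "rev (map flip u) \<in> carrier (free_group S)"
    using u by (auto simp: free_group_def reduced_inverse flip_def)
  moreover have "rev (map flip u) \<otimes>\<^bsub>free_group S\<^esub> u = \<one>\<^bsub>free_group S\<^esub>"
    using u foldr_cons_red_inverse[of "[]" u] foldr_cons_red_Nil[of u]
    by (simp add: free_group_def reduced_def)
  ultimately show "\<exists>y\<in>carrier (free_group S). y \<otimes>\<^bsub>free_group S\<^esub> u = \<one>\<^bsub>free_group S\<^esub>" by blast
qed (auto simp: free_group_def foldr_cons_red_assoc reduced_def)

context group
begin

lemma word_val_Nil: "word_val G [] = \<one>"
  by (simp add: word_val_def)

lemma word_val_Cons:
  "word_val G (x # w) = (if snd x then inv (fst x) else fst x) \<otimes> word_val G w"
  by (simp add: word_val_def split_beta)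

lemma word_val_closed: "S \<subseteq> carrier G \<Longrightarrow> set w \<subseteq> S \<times> UNIV \<Longrightarrow> word_val G w \<in> carrier G"
  by (induction w) (auto simp: word_val_Nil word_val_Cons)

lemma word_val_cons_red:
  assumes "S \<subseteq> carrier G" "set (x # w) \<subseteq> S \<times> UNIV"
  shows "word_val G (cons_red x w) = word_val G (x # w)"
proof (cases "w \<noteq> [] \<and> hd w = flip x")
  case True
  then obtain v where w: "w = flip x # v" by (cases w) auto
  have "fst x \<in> carrier G" "word_val G v \<in> carrier G"
    using assms w by (auto intro!: word_val_closed[OF assms(1)])
  then show ?thesis
    by (simp add: w cons_red_def word_val_Cons flip_def m_assoc[symmetric])
next
  case False
  then have "cons_red x w = x # w" unfolding cons_red_def by auto
  then show ?thesis by simp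
qed

lemma word_val_foldr:
  assumes "S \<subseteq> carrier G" "set u \<subseteq> S \<times> UNIV" "set v \<subseteq> S \<times> UNIV"
  shows "word_val G (foldr cons_red u v) = word_val G u \<otimes> word_val G v"
  using assms(2)
proof (induction u)
  case Nil
  then show ?case using word_val_closed[OF assms(1,3)] by (simp add: word_val_Nil)
next
  case (Cons x u)
  have "set (foldr cons_red u v) \<subseteq> S \<times> UNIV"
    using set_foldr_cons_red[of u v] Cons.prems assms(3) by auto
  then have "word_val G (foldr cons_red (x # u) v)
      = (if snd x then inv (fst x) else fst x) \<otimes> word_val G (foldr cons_red u v)"
    using Cons.prems by (simp add: word_val_cons_red[OF assms(1)] word_val_Cons)
  then show ?case
    using Cons assms word_val_closed[OF assms(1), of u] word_val_closed[OF assms(1,3)]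
    by (auto simp: word_val_Cons m_assoc)
qed

lemma word_val_hom: "S \<subseteq> carrier G \<Longrightarrow> group_hom (free_group S) G (word_val G)"
  by (intro group_hom.intro group_hom_axioms.intro group_free_group homI is_group)
     (auto simp: free_group_def word_val_foldr word_val_closed)

lemma finitely_presented_imp_short:
  assumes "finitely_presented G"
  shows "\<exists>S r. finite S \<and> symmetric_in G S \<and> presents G S (short_relations G S r)"
proof -
  obtain S R where S: "finite S" "symmetric_in G S" and R: "finite R" and pr: "presents G S R"
    using assms by (auto simp: finitely_presented_def)
  define r where "r = Max (insert 0 (length ` R))"
  have SG: "S \<subseteq> carrier G" and RS: "R \<subseteq> relations G S"
    using pr by (auto simp: presents_def)
  interpret F: group "free_group S" by (rule group_free_group)
  interpret h: group_hom "free_group S" G "word_val G" by (rule word_val_hom[OF SG])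
  have ker: "relations G S = kernel (free_group S) G (word_val G)"
    by (auto simp: relations_def kernel_def)
  have sub: "subgroup (relations G S) (free_group S)" and nor: "relations G S \<lhd> free_group S"
    unfolding ker by (rule h.subgroup_kernel, rule h.normal_kernel)
  have short: "R \<subseteq> short_relations G S r" "short_relations G S r \<subseteq> relations G S"
    using R RS by (auto simp: short_relations_def r_def)
  have "conjugates (free_group S) (short_relations G S r) \<subseteq> relations G S"
    using short(2) nor by (auto simp: conjugates_def F.normal_inv_iff)
  then have "normal_closure (free_group S) (short_relations G S r) \<subseteq> relations G S"
    unfolding normal_closure_def by (rule F.generate_subgroup_incl[OF _ sub])
  moreover have "normal_closure (free_group S) R
      \<subseteq> normal_closure (free_group S) (short_relations G S r)"
    unfolding normal_closure_def
    by (rule F.mono_generate) (use short(1) in \<open>auto simp: conjugates_def\<close>)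
  ultimately have "presents G S (short_relations G S r)"
    using pr short(2) by (auto simp: presents_def)
  then show ?thesis using S by blast
qed

end

lemma ring_class_ring: "ring (class_ring :: 'a::ring_1 ring)"
  by unfold_locales

lemma mult_mat_4_index:
  assumes "A \<in> carrier_mat 4 4" "B \<in> carrier_mat 4 4" "i < 4" "j < 4"
  shows "(A * B) $$ (i,j) = A $$ (i,0) * B $$ (0,j) + A $$ (i,1) * B $$ (1,j)
                            + A $$ (i,2) * B $$ (2,j) + A $$ (i,3) * B $$ (3,j)"
  using assms by (simp add: scalar_prod_def eval_nat_numeral)

lemma less_4_iff:
  "i < (4::nat) \<longleftrightarrow> i = 0 \<or> i = 1 \<or> i = 2 \<or> i = 3"
  "i < (3::nat) \<longleftrightarrow> i = 0 \<or> i = 1 \<or> i = 2"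
  "i < (2::nat) \<longleftrightarrow> i = 0 \<or> i = 1"
  by auto

lemma group_A4:
  fixes R :: "'a::comm_ring_1 set"
  assumes "subring R (class_ring :: 'a ring)"
  shows "group (A4 R)"
proof -
  have minus: "\<And>x. x \<in> R \<Longrightarrow> - x \<in> R"
  proof -
    fix x :: 'a assume "x \<in> R"
    moreover have "\<ominus>\<^bsub>class_ring\<^esub> x = - x"
      by (rule abelian_group.minus_equality[OF ring.is_abelian_group[OF ring_class_ring]]) auto
    ultimately show "- x \<in> R" using subringE(5)[OF assms, of x] by simp
  qed
  have R: "0 \<in> R" "1 \<in> R" "\<And>x y. x \<in> R \<Longrightarrow> y \<in> R \<Longrightarrow> x + y \<in> R"
    "\<And>x y. x \<in> R \<Longrightarrow> y \<in> R \<Longrightarrow> x * y \<in> R"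
    using subringE(2,3,6,7)[OF assms] by auto
  have U: "x \<in> Units (class_ring\<lparr>carrier := R\<rparr>) \<longleftrightarrow> x \<in> R \<and> (\<exists>y\<in>R. y * x = 1)" for x
    by (auto simp: Units_def mult.commute)
  have mem: "M \<in> carrier (A4 R) \<longleftrightarrow> M \<in> carrier_mat 4 4 \<and>
      (\<forall>i\<in>{0,1,2,3}. \<forall>j\<in>{0,1,2,3}. (j < i \<longrightarrow> M $$ (i,j) = 0) \<and> M $$ (i,j) \<in> R) \<and>
      M $$ (0,0) = 1 \<and> M $$ (3,3) = 1 \<and>
      (\<exists>y\<in>R. y * M $$ (1,1) = 1) \<and> (\<exists>y\<in>R. y * M $$ (2,2) = 1)" for M
    unfolding A4_def upper_triangular_def U
    by (rule iffI) (auto simp: less_4_iff)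
  show ?thesis
  proof (rule groupI)
    fix A B assume AB: "A \<in> carrier (A4 R)" "B \<in> carrier (A4 R)"
    have d: "A \<in> carrier_mat 4 4" "B \<in> carrier_mat 4 4"
      using AB by (auto simp: mem)
    have ab: "A * B \<in> carrier_mat 4 4" using d by simp
    note [simp] = mult_mat_4_index[OF d]
    obtain a b a' b' where ex: "a \<in> R" "a * A $$ (1,1) = 1" "b \<in> R" "b * B $$ (1,1) = 1"
        "a' \<in> R" "a' * A $$ (2,2) = 1" "b' \<in> R" "b' * B $$ (2,2) = 1"
      using AB unfolding mem by blast
    have "(a * b) * (A $$ (1,1) * B $$ (1,1)) = (a * A $$ (1,1)) * (b * B $$ (1,1))"
      "(a' * b') * (A $$ (2,2) * B $$ (2,2)) = (a' * A $$ (2,2)) * (b' * B $$ (2,2))"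
      by (simp_all only: ac_simps)
    then have "\<exists>y\<in>R. y * (A $$ (1,1) * B $$ (1,1)) = 1" "\<exists>y\<in>R. y * (A $$ (2,2) * B $$ (2,2)) = 1"
      using ex R(4) by (metis mult_1)+
    then show "A \<otimes>\<^bsub>A4 R\<^esub> B \<in> carrier (A4 R)"
      using AB ab unfolding mem by (simp add: A4_def R)
  next
    fix A assume A: "A \<in> carrier (A4 R)"
    have d: "A \<in> carrier_mat 4 4" using A by (auto simp: mem)
    obtain s u where su: "s \<in> R" "s * A $$ (1,1) = 1" "u \<in> R" "u * A $$ (2,2) = 1"
      using A unfolding mem by blast
    define b where "b = - (s * A $$ (1,2) * u)"
    define c where "c = - (s * A $$ (1,3) + b * A $$ (2,3))"
    define x where "x = - (A $$ (0,1) * s)"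
    define y where "y = - ((A $$ (0,2) + x * A $$ (1,2)) * u)"
    define z where "z = - (A $$ (0,3) + x * A $$ (1,3) + y * A $$ (2,3))"
    define w where "w = - (u * A $$ (2,3))"
    define N where "N = mat 4 4 (\<lambda>(i,j). [[1,x,y,z],[0,s,b,c],[0,0,u,w],[0,0,0,1]] ! i ! j)"
    have N: "N \<in> carrier_mat 4 4" by (simp add: N_def)
    have inR: "A $$ (0,1) \<in> R" "A $$ (0,2) \<in> R" "A $$ (0,3) \<in> R" "A $$ (1,1) \<in> R"
        "A $$ (1,2) \<in> R" "A $$ (1,3) \<in> R" "A $$ (2,2) \<in> R" "A $$ (2,3) \<in> R"
      using A unfolding mem by auto
    have "x \<in> R" "b \<in> R" "w \<in> R"
      by (simp_all only: x_def b_def w_def R minus inR su)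
    then have "y \<in> R" "c \<in> R"
      by (simp_all only: y_def c_def R minus inR su)
    then have "z \<in> R"
      using \<open>x \<in> R\<close> by (simp only: z_def R minus inR su)
    have "N \<in> carrier (A4 R)"
      unfolding mem using N \<open>x \<in> R\<close> \<open>b \<in> R\<close> \<open>w \<in> R\<close> \<open>y \<in> R\<close> \<open>c \<in> R\<close> \<open>z \<in> R\<close> su inR
      by (auto simp: N_def R numeral_2_eq_2 numeral_3_eq_3 mult.commute)
    moreover have "N * A = 1\<^sub>m 4"
    proof (rule eq_matI)
      fix i j assume ij: "i < dim_row (1\<^sub>m 4 :: 'a mat)" "j < dim_col (1\<^sub>m 4 :: 'a mat)"
      have e: "A $$ (0,0) = 1" "A $$ (3,3) = 1" "A $$ (1,0) = 0" "A $$ (2,0) = 0" "A $$ (3,0) = 0"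
        "A $$ (2,1) = 0" "A $$ (3,1) = 0" "A $$ (3,2) = 0"
        using A unfolding mem by auto
      have Ne: "N $$ (0,0) = 1" "N $$ (0,1) = x" "N $$ (0,2) = y" "N $$ (0,3) = z"
        "N $$ (1,0) = 0" "N $$ (1,1) = s" "N $$ (1,2) = b" "N $$ (1,3) = c"
        "N $$ (2,0) = 0" "N $$ (2,1) = 0" "N $$ (2,2) = u" "N $$ (2,3) = w"
        "N $$ (3,0) = 0" "N $$ (3,1) = 0" "N $$ (3,2) = 0" "N $$ (3,3) = 1"
        by (simp_all add: N_def numeral_2_eq_2 numeral_3_eq_3)
      have "x * A $$ (1,1) = - (A $$ (0,1) * (s * A $$ (1,1)))"
        "y * A $$ (2,2) = - ((A $$ (0,2) + x * A $$ (1,2)) * (u * A $$ (2,2)))"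
        "b * A $$ (2,2) = - (s * A $$ (1,2) * (u * A $$ (2,2)))"
        by (simp_all add: x_def y_def b_def mult.assoc)
      then have m: "x * A $$ (1,1) = - A $$ (0,1)"
        "y * A $$ (2,2) = - (A $$ (0,2) + x * A $$ (1,2))"
        "b * A $$ (2,2) = - (s * A $$ (1,2))"
        by (simp_all only: su mult_1_right)
      have q: "A $$ (0,1) + x * A $$ (1,1) = 0"
        "A $$ (0,2) + x * A $$ (1,2) + y * A $$ (2,2) = 0"
        "s * A $$ (1,2) + b * A $$ (2,2) = 0"
        unfolding m by simp_all
      have q': "A $$ (0,3) + x * A $$ (1,3) + y * A $$ (2,3) + z = 0"
        "s * A $$ (1,3) + b * A $$ (2,3) + c = 0" "u * A $$ (2,3) + w = 0"
        unfolding z_def c_def w_def by simp_all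
      from ij have "i \<in> {0,1,2,3}" "j \<in> {0,1,2,3}" by auto
      then show "(N * A) $$ (i,j) = 1\<^sub>m 4 $$ (i,j)"
        by (auto simp: mult_mat_4_index[OF N d] e Ne q q' su simp del: One_nat_def)
    qed (use N d in auto)
    ultimately show "\<exists>y\<in>carrier (A4 R). y \<otimes>\<^bsub>A4 R\<^esub> A = \<one>\<^bsub>A4 R\<^esub>"
      by (auto simp: A4_def)
  next
    show "\<one>\<^bsub>A4 R\<^esub> \<in> carrier (A4 R)"
      unfolding mem using R by (auto simp: A4_def intro!: bexI[of _ 1])
  qed (auto simp: A4_def intro: assoc_mult_mat)
qed

lemma subring_ring_t_inv: "subring ring_t_inv class_ring"
  unfolding ring_t_inv_def by (rule ring.generate_ring_is_subring[OF ring_class_ring]) simp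

end

theory Submission
  imports Defs "HOL-Library.Function_Algebras"
begin

text \<open>Write \<open>R\<close> for the ring and \<open>\<Gamma>\<close> for the group. The elements of \<open>R\<close> are the rational functions
  with poles at most at the three places \<open>0\<close>, \<open>1\<close> and \<open>\<infinity>\<close>, and \<open>R\<close> is discrete and cocompact in the
  product \<open>K\<close> of three copies of the field of rational functions, one for each place and each with
  its own valuation. The units of \<open>R\<close> are the \<open>c t\<^sup>i (t - 1)\<^sup>j\<close> with \<open>c\<close> constant. Hence \<open>\<Gamma>\<close> is a lattice
  in the group \<open>G\<close> of upper triangular matrices over \<open>K\<close> whose diagonal is \<open>(1, a, b, 1)\<close> with \<open>a\<close>, \<open>b\<close>
  such units: every element of \<open>G\<close> is \<open>\<gamma> k\<close> with \<open>\<gamma>\<close> in \<open>\<Gamma>\<close> and \<open>k\<close> without poles, and a bounded step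
  in \<open>G\<close> moves \<open>\<gamma>\<close> by one of finitely many elements. So it is enough to fill loops in \<open>G\<close> with
  quadratic area, where letters are the elements of bounded size and relators are the triangles
  of letters.

  The gain is that over \<open>K\<close>, unlike over \<open>R\<close>, the root subgroups split into one factor for each place,
  and each noncentral factor is contracted by some diagonal matrix. An element of size \<open>e\<^sup>n\<close> of such a
  factor is therefore the value of a word of length \<open>O(n)\<close>: a torus word, one letter, and the inverse
  torus word. If one torus element contracts two factors, then their commutator relation is the
  conjugate of a relation between letters and costs \<open>O(n\<^sup>2)\<close>; the square comes from commuting torus
  letters. This covers all pairs at distinct places, because the valuations of \<open>t\<^sup>i (t - 1)\<^sup>j\<close> at two
  places are independent, and at one place all pairs except those with opposite characters,
  12 with 24 and 13 with 34. The central factor 14 is not contracted at all. Abels observed that the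
  remaining relations follow formally: since 24 is the commutator of 23 and 34, and 12 commutes
  with 34, the commutators of 12 with 24 and of 13 with 34 agree, are central, and depend only on
  the product of the two entries (\<open>comm_shift\<close>, \<open>Z_central\<close>, \<open>Psi_mult\<close>). Each use of this argument
  needs a bounded number of the tame relations, so the cost stays quadratic.

  To keep constants out of the argument, it is carried out for sequences of words, modulo the
  sequences of quadratic cost (\<open>asymptotic\<close>). There the relations are equalities, and Abels'
  presentation gives a homomorphism on the sequences of elements of linearly growing size
  (\<open>nf_cl_mult\<close>). Read for all pairs of elements at once, it says that the normal words satisfy
  \<open>nf_word g \<cdot> nf_word h = nf_word (g h)\<close> at quadratic cost (\<open>nf_word_mult\<close>). Gromov's trick of cutting
  a loop in halves then fills every loop (\<open>loop_quadratic\<close>). Finally the filling is pushed along the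
  nearest-point map from \<open>G\<close> to \<open>\<Gamma>\<close> (\<open>lattice_loop_quadratic\<close>) and rewritten in an arbitrary finite
  generating set, which gives the finite presentation and the bound for the Dehn function
  (\<open>relations_quadratic\<close>).\<close>

section \<open>Groups with a conjugation-invariant cost\<close>

lemma (in group) inv_cancel_left:
  assumes "x \<in> carrier G" "y \<in> carrier G"
  shows "inv x \<otimes> (x \<otimes> y) = y" "x \<otimes> (inv x \<otimes> y) = y"
  using assms by (simp_all flip: m_assoc)

text \<open>In the application \<open>N m\<close> consists of the products of at most \<open>m\<close> conjugates of relators, so that
  \<open>near m\<close> bounds the number of relators needed to pass from one word to another. Invariance under
  conjugation makes the relation compatible with multiplication on both sides.\<close>

locale conj_norm = group W for W (structure) +
  fixes N :: "nat \<Rightarrow> 'a set"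
  assumes N_carrier: "N m \<subseteq> carrier W"
    and N_one: "\<one> \<in> N 0"
    and N_mult: "x \<in> N m \<Longrightarrow> y \<in> N n \<Longrightarrow> x \<otimes> y \<in> N (m + n)"
    and N_inv: "x \<in> N m \<Longrightarrow> inv x \<in> N m"
    and N_conj: "x \<in> N m \<Longrightarrow> g \<in> carrier W \<Longrightarrow> g \<otimes> x \<otimes> inv g \<in> N m"
    and N_mono: "m \<le> n \<Longrightarrow> N m \<subseteq> N n"
begin

definition near :: "nat \<Rightarrow> 'a \<Rightarrow> 'a \<Rightarrow> bool" where
  "near m x y \<longleftrightarrow> x \<in> carrier W \<and> y \<in> carrier W \<and> x \<otimes> inv y \<in> N m"

lemma near_closed: "near m x y \<Longrightarrow> x \<in> carrier W" "near m x y \<Longrightarrow> y \<in> carrier W"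
  by (auto simp: near_def)

lemma near_refl: "x \<in> carrier W \<Longrightarrow> near m x x"
  using N_mono[of 0 m] N_one by (auto simp: near_def)

lemma near_mono: "near m x y \<Longrightarrow> m \<le> n \<Longrightarrow> near n x y"
  using N_mono[of m n] by (auto simp: near_def)

lemma near_sym: "near m x y \<Longrightarrow> near m y x"
  using N_inv[of "x \<otimes> inv y" m] by (auto simp: near_def inv_mult_group)

lemma near_trans:
  assumes "near m x y" "near n y z"
  shows "near (m + n) x z"
proof -
  have c: "x \<in> carrier W" "y \<in> carrier W" "z \<in> carrier W"
    using assms by (auto simp: near_def)
  have "(x \<otimes> inv y) \<otimes> (y \<otimes> inv z) \<in> N (m + n)"
    using assms by (intro N_mult) (auto simp: near_def)
  then have "x \<otimes> (inv y \<otimes> y) \<otimes> inv z \<in> N (m + n)"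
    using c by (simp only: m_assoc inv_closed m_closed)
  then show ?thesis using c by (simp add: near_def)
qed

lemma near_mult:
  assumes "near m x x'" "near n y y'"
  shows "near (m + n) (x \<otimes> y) (x' \<otimes> y')"
proof -
  have c: "x \<in> carrier W" "y \<in> carrier W" "x' \<in> carrier W" "y' \<in> carrier W"
    using assms by (auto simp: near_def)
  have "(x \<otimes> (y \<otimes> inv y') \<otimes> inv x) \<otimes> (x \<otimes> inv x') \<in> N (n + m)"
    using assms c by (intro N_mult N_conj) (auto simp: near_def)
  also have "(x \<otimes> (y \<otimes> inv y') \<otimes> inv x) \<otimes> (x \<otimes> inv x')
      = x \<otimes> (y \<otimes> inv y') \<otimes> (inv x \<otimes> x) \<otimes> inv x'"
    using c by (simp only: m_assoc inv_closed m_closed)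
  also have "\<dots> = x \<otimes> y \<otimes> (inv y' \<otimes> inv x')"
    using c by (simp add: m_assoc)
  also have "\<dots> = (x \<otimes> y) \<otimes> inv (x' \<otimes> y')"
    using c by (simp add: inv_mult_group)
  finally show ?thesis using c by (simp add: near_def add.commute)
qed

lemma near_multL: "near m x y \<Longrightarrow> g \<in> carrier W \<Longrightarrow> near m (g \<otimes> x) (g \<otimes> y)"
  using near_mult[OF near_refl[of g 0], of m x y] by simp

lemma near_multR: "near m x y \<Longrightarrow> g \<in> carrier W \<Longrightarrow> near m (x \<otimes> g) (y \<otimes> g)"
  using near_mult[OF _ near_refl[of g 0], of m x y] by simp

lemma near_inv_swap:
  assumes "near c (x \<otimes> y) (z \<otimes> x)" "x \<in> carrier W" "y \<in> carrier W" "z \<in> carrier W"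
  shows "near c (inv x \<otimes> z) (y \<otimes> inv x)"
proof -
  have "near c (inv x \<otimes> (x \<otimes> y) \<otimes> inv x) (inv x \<otimes> (z \<otimes> x) \<otimes> inv x)"
    using assms by (intro near_multL near_multR) auto
  moreover have "inv x \<otimes> (x \<otimes> y) \<otimes> inv x = y \<otimes> inv x" "inv x \<otimes> (z \<otimes> x) \<otimes> inv x = inv x \<otimes> z"
    using assms by (simp_all add: m_assoc inv_cancel_left)
  ultimately show ?thesis by (simp add: near_sym)
qed

lemma push_nat:
  assumes "x \<in> carrier W" "\<And>k. k \<le> m \<Longrightarrow> z k \<in> carrier W"
    and "\<And>k. k < m \<Longrightarrow> near c (x \<otimes> z k) (z (Suc k) \<otimes> x)"
  shows "near (m * c) (x [^] m \<otimes> z 0) (z m \<otimes> x [^] m)"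
  using assms
proof (induction m)
  case 0
  then show ?case by (simp add: near_refl)
next
  case (Suc m)
  have cl: "z k \<in> carrier W" if "k \<le> Suc m" for k using Suc.prems(2) that .
  have ih: "near (m * c) (x [^] m \<otimes> z 0) (z m \<otimes> x [^] m)"
    using Suc by simp
  have "near (m * c) (x \<otimes> (x [^] m \<otimes> z 0)) (x \<otimes> (z m \<otimes> x [^] m))"
    by (rule near_multL[OF ih Suc.prems(1)])
  moreover have "near c (x \<otimes> z m \<otimes> x [^] m) (z (Suc m) \<otimes> x \<otimes> x [^] m)"
    using Suc.prems by (intro near_multR) auto
  moreover have "x \<otimes> (z m \<otimes> x [^] m) = x \<otimes> z m \<otimes> x [^] m"
    using Suc.prems(1) cl by (simp add: m_assoc)
  ultimately have "near (m * c + c) (x \<otimes> (x [^] m \<otimes> z 0)) (z (Suc m) \<otimes> x \<otimes> x [^] m)"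
    using near_trans by simp
  moreover have "x [^] Suc m = x \<otimes> x [^] m"
    using Suc.prems(1) nat_pow_Suc2 by blast
  ultimately show ?case
    using Suc.prems(1) cl by (simp add: m_assoc add.commute del: nat_pow_Suc)
qed

text \<open>The letter \<open>x\<close> moves \<open>z k\<close> to \<open>z (k + 1)\<close> as long as both indices lie between 0 and \<open>m\<close>.\<close>

lemma push_int:
  fixes m :: int
  assumes x: "x \<in> carrier W" and z: "\<And>k. z k \<in> carrier W"
    and step: "\<And>k. (0 \<le> k \<and> k < m) \<or> (m \<le> k \<and> k < 0) \<Longrightarrow> near c (x \<otimes> z k) (z (k + 1) \<otimes> x)"
  shows "near (nat \<bar>m\<bar> * c) (x [^] m \<otimes> z 0) (z m \<otimes> x [^] m)"
proof (cases "m \<ge> 0")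
  case True
  have "near (nat m * c) (x [^] nat m \<otimes> z (int 0)) (z (int (nat m)) \<otimes> x [^] nat m)"
    by (rule push_nat[where z = "\<lambda>k. z (int k)"])
       (use True x z step[of "int _"] in \<open>auto simp: zless_nat_eq_int_zless algebra_simps\<close>)
  then show ?thesis using True int_pow_int[of W x "nat m"] by simp
next
  case False
  define n where "n = nat (- m)"
  have m: "m = - int n" and n: "n > 0" using False by (auto simp: n_def)
  have "near (n * c) (inv x [^] n \<otimes> z (- int 0)) (z (- int n) \<otimes> inv x [^] n)"
  proof (rule push_nat[where z = "\<lambda>k. z (- int k)"])
    fix k assume k: "k < n"
    have "near c (x \<otimes> z (- int (Suc k))) (z (- int (Suc k) + 1) \<otimes> x)"
      using k by (intro step) (auto simp: m)
    then have "near c (inv x \<otimes> z (- int (Suc k) + 1)) (z (- int (Suc k)) \<otimes> inv x)"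
      using x z by (intro near_inv_swap) auto
    then show "near c (inv x \<otimes> z (- int k)) (z (- int (Suc k)) \<otimes> inv x)"
      by simp
  qed (use x z in auto)
  moreover have "x [^] m = inv x [^] n"
    using x by (simp add: m int_pow_neg_int nat_pow_inv)
  ultimately show ?thesis by (simp add: m)
qed

text \<open>Each of the \<open>i j\<close> transpositions of letters costs one relation; this is where quadratic area
  arises.\<close>

lemma near_commute_pow:
  fixes i j :: int
  assumes "near c (x \<otimes> y) (y \<otimes> x)" "x \<in> carrier W" "y \<in> carrier W"
  shows "near (nat \<bar>i\<bar> * (nat \<bar>j\<bar> * c)) (x [^] i \<otimes> y [^] j) (y [^] j \<otimes> x [^] i)"
proof -
  have "near (nat \<bar>j\<bar> * c) (y [^] j \<otimes> x) (x \<otimes> y [^] j)"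
    by (rule push_int[where z = "\<lambda>_. x"]) (use assms near_sym in auto)
  then have "near (nat \<bar>j\<bar> * c) (x \<otimes> y [^] j) (y [^] j \<otimes> x)" by (rule near_sym)
  then show ?thesis
    by (intro push_int[where z = "\<lambda>_. y [^] j"]) (use assms in auto)
qed

end

section \<open>Sequences modulo quadratic cost\<close>

text \<open>The index \<open>i\<close> of a sequence stands for a problem whose input has length \<open>nn i\<close>. In the quotient
  \<open>Q\<close> two sequences of words are equal if one can be rewritten into the other at a cost bounded by a
  constant multiple of \<open>(nn i)\<^sup>2\<close>, so that a bounded number of rewriting steps is an equality.\<close>

locale asymptotic = conj_norm W N for W (structure) and N :: "nat \<Rightarrow> 'a set" +
  fixes nn :: "'i \<Rightarrow> nat"
  assumes nn_pos: "nn i \<ge> 1"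
begin

definition Seq :: "('i \<Rightarrow> 'a) monoid" where
  "Seq = \<lparr>carrier = {\<phi>. \<forall>i. \<phi> i \<in> carrier W}, mult = (\<lambda>\<phi> \<psi> i. \<phi> i \<otimes> \<psi> i), one = (\<lambda>i. \<one>)\<rparr>"

definition Small :: "('i \<Rightarrow> 'a) set" where
  "Small = {\<phi>. \<exists>C. \<forall>i. \<phi> i \<in> N (C * (nn i)\<^sup>2)}"

definition Q :: "('i \<Rightarrow> 'a) set monoid" where "Q = Seq Mod Small"

definition cl :: "('i \<Rightarrow> 'a) \<Rightarrow> ('i \<Rightarrow> 'a) set" where "cl \<phi> = Small #>\<^bsub>Seq\<^esub> \<phi>"

lemma Seq_simps [simp]:
  "\<phi> \<in> carrier Seq \<longleftrightarrow> (\<forall>i. \<phi> i \<in> carrier W)"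
  "\<phi> \<otimes>\<^bsub>Seq\<^esub> \<psi> = (\<lambda>i. \<phi> i \<otimes> \<psi> i)" "\<one>\<^bsub>Seq\<^esub> = (\<lambda>i. \<one>)"
  by (auto simp: Seq_def)

lemma group_Seq: "group Seq"
proof (rule groupI)
  fix \<phi> assume "\<phi> \<in> carrier Seq"
  then show "\<exists>\<psi>\<in>carrier Seq. \<psi> \<otimes>\<^bsub>Seq\<^esub> \<phi> = \<one>\<^bsub>Seq\<^esub>"
    by (intro bexI[of _ "\<lambda>i. inv (\<phi> i)"]) auto
qed (auto simp: m_assoc)

interpretation Seq: group Seq by (rule group_Seq)

lemma inv_Seq: "\<phi> \<in> carrier Seq \<Longrightarrow> inv\<^bsub>Seq\<^esub> \<phi> = (\<lambda>i. inv (\<phi> i))"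
  by (rule Seq.inv_equality) auto

lemma normal_Small: "Small \<lhd> Seq"
  unfolding Seq.normal_inv_iff
proof (intro conjI ballI)
  have c: "\<phi> \<in> carrier Seq" if "\<phi> \<in> Small" for \<phi>
    using that N_carrier by (fastforce simp: Small_def)
  show "subgroup Small Seq"
  proof (rule Seq.subgroupI)
    show "Small \<subseteq> carrier Seq" using c by auto
    show "Small \<noteq> {}" using N_one by (auto simp: Small_def intro!: exI[of _ "\<lambda>_. \<one>"] exI[of _ 0])
  next
    fix \<phi> assume "\<phi> \<in> Small"
    then show "inv\<^bsub>Seq\<^esub> \<phi> \<in> Small"
      using inv_Seq[OF c, of \<phi>] N_inv by (auto simp: Small_def)
  next
    fix \<phi> \<psi> assume "\<phi> \<in> Small" "\<psi> \<in> Small"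
    then obtain C D where CD: "\<phi> i \<in> N (C * (nn i)\<^sup>2)" "\<psi> i \<in> N (D * (nn i)\<^sup>2)" for i
      by (auto simp: Small_def)
    have "\<phi> i \<otimes> \<psi> i \<in> N ((C + D) * (nn i)\<^sup>2)" for i
      using N_mult[OF CD] by (simp add: add_mult_distrib)
    then show "\<phi> \<otimes>\<^bsub>Seq\<^esub> \<psi> \<in> Small" unfolding Small_def by auto
  qed
  fix g \<phi> assume "g \<in> carrier Seq" "\<phi> \<in> Small"
  then show "g \<otimes>\<^bsub>Seq\<^esub> \<phi> \<otimes>\<^bsub>Seq\<^esub> inv\<^bsub>Seq\<^esub> g \<in> Small"
    unfolding Small_def using N_conj by (simp add: inv_Seq) blast
qed

lemma group_Q: "group Q"
  unfolding Q_def by (rule normal.factorgroup_is_group[OF normal_Small])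

lemma cl_closed [simp]: "(\<And>i. \<phi> i \<in> carrier W) \<Longrightarrow> cl \<phi> \<in> carrier Q"
  by (auto simp: Q_def cl_def carrier_FactGroup)

lemma cl_mult:
  "(\<And>i. \<phi> i \<in> carrier W) \<Longrightarrow> (\<And>i. \<psi> i \<in> carrier W) \<Longrightarrow> cl \<phi> \<otimes>\<^bsub>Q\<^esub> cl \<psi> = cl (\<lambda>i. \<phi> i \<otimes> \<psi> i)"
  using normal.rcos_sum[OF normal_Small, of \<phi> \<psi>] by (simp add: Q_def cl_def)

lemma cl_eq_iff:
  assumes "\<And>i. \<phi> i \<in> carrier W" "\<And>i. \<psi> i \<in> carrier W"
  shows "cl \<phi> = cl \<psi> \<longleftrightarrow> (\<exists>C. \<forall>i. near (C * (nn i)\<^sup>2) (\<phi> i) (\<psi> i))"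
proof -
  have sg: "subgroup Small Seq" using normal_Small by (rule normal_imp_subgroup)
  have c: "\<phi> \<in> carrier Seq" "\<psi> \<in> carrier Seq" using assms by auto
  have "cl \<phi> = cl \<psi> \<longleftrightarrow> \<phi> \<in> Small #>\<^bsub>Seq\<^esub> \<psi>"
    using Seq.repr_independence[OF _ c(2) sg, of \<phi>] Seq.rcos_self[OF c(1) sg] by (auto simp: cl_def)
  also have "\<dots> \<longleftrightarrow> \<phi> \<otimes>\<^bsub>Seq\<^esub> inv\<^bsub>Seq\<^esub> \<psi> \<in> Small"
    using subgroup.rcos_module[OF sg group_Seq c(2) c(1)] .
  also have "\<dots> \<longleftrightarrow> (\<exists>C. \<forall>i. near (C * (nn i)\<^sup>2) (\<phi> i) (\<psi> i))"
    unfolding near_def Small_def using assms c by (simp add: inv_Seq)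
  finally show ?thesis .
qed

lemma cl_eqI_linear:
  assumes "\<And>i. near (C * nn i) (\<phi> i) (\<psi> i)"
  shows "cl \<phi> = cl \<psi>"
proof -
  have "C * nn i \<le> C * (nn i)\<^sup>2" for i
    using nn_pos[of i] by (simp add: power2_eq_square)
  then have "near (C * (nn i)\<^sup>2) (\<phi> i) (\<psi> i)" for i
    using near_mono[OF assms] by blast
  then show ?thesis using near_closed[OF assms] by (subst cl_eq_iff) auto
qed

lemma cl_eqI_const:
  assumes "\<And>i. near C (\<phi> i) (\<psi> i)"
  shows "cl \<phi> = cl \<psi>"
proof (rule cl_eqI_linear)
  fix i show "near (C * nn i) (\<phi> i) (\<psi> i)"
    using near_mono[OF assms, of "C * nn i" i] nn_pos[of i] by simp
qed

lemma cl_one: "cl (\<lambda>i. \<one>) = \<one>\<^bsub>Q\<^esub>"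
  using group.l_cancel_one[OF group_Q, of "cl (\<lambda>i. \<one>)" "cl (\<lambda>i. \<one>)"]
    cl_mult[of "\<lambda>i. \<one>" "\<lambda>i. \<one>"] by simp

lemma cl_inv:
  assumes "\<And>i. \<phi> i \<in> carrier W"
  shows "inv\<^bsub>Q\<^esub> (cl \<phi>) = cl (\<lambda>i. inv (\<phi> i))"
  by (rule group.inv_equality[OF group_Q]) (use assms in \<open>auto simp: cl_mult cl_one\<close>)

end

section \<open>Upper triangular matrices with corner entries 1\<close>

text \<open>\<open>UT a a' b b' x12 x13 x14 x23 x24 x34\<close> is the matrix with diagonal \<open>(1, a, b, 1)\<close>; carrying
  the inverses \<open>a'\<close> and \<open>b'\<close> along makes inversion polynomial and lets a single size condition on
  the fields bound a matrix together with the inverses of its diagonal entries.\<close>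

datatype 'r ut = UT (dA: 'r) (dA': 'r) (dB: 'r) (dB': 'r)
  (m12: 'r) (m13: 'r) (m14: 'r) (m23: 'r) (m24: 'r) (m34: 'r)

instantiation ut :: (comm_ring_1) monoid_mult
begin

definition one_ut :: "'a ut" where "one_ut = UT 1 1 1 1 0 0 0 0 0 0"

definition times_ut :: "'a ut \<Rightarrow> 'a ut \<Rightarrow> 'a ut" where
  "times_ut M N = UT (dA M * dA N) (dA' M * dA' N) (dB M * dB N) (dB' M * dB' N)
     (m12 N + m12 M * dA N) (m13 N + m12 M * m23 N + m13 M * dB N)
     (m14 N + m12 M * m24 N + m13 M * m34 N + m14 M)
     (dA M * m23 N + m23 M * dB N) (dA M * m24 N + m23 M * m34 N + m24 M)
     (dB M * m34 N + m34 M)"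

instance
  by standard (simp_all add: one_ut_def times_ut_def algebra_simps ut.expand)

end

lemma ut_mult_sel [simp]:
  "dA (M * N) = dA M * dA N" "dA' (M * N) = dA' M * dA' N"
  "dB (M * N) = dB M * dB N" "dB' (M * N) = dB' M * dB' N"
  "m12 (M * N) = m12 N + m12 M * dA N"
  "m13 (M * N) = m13 N + m12 M * m23 N + m13 M * dB N"
  "m14 (M * N) = m14 N + m12 M * m24 N + m13 M * m34 N + m14 M"
  "m23 (M * N) = dA M * m23 N + m23 M * dB N"
  "m24 (M * N) = dA M * m24 N + m23 M * m34 N + m24 M"
  "m34 (M * N) = dB M * m34 N + m34 M"
  by (simp_all add: times_ut_def)

lemma ut_one_sel [simp]:
  "dA 1 = 1" "dA' 1 = 1" "dB 1 = 1" "dB' 1 = 1"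
  "m12 1 = 0" "m13 1 = 0" "m14 1 = 0" "m23 1 = 0" "m24 1 = 0" "m34 1 = 0"
  by (simp_all add: one_ut_def)

lemma ut_eqI:
  "dA M = dA N \<Longrightarrow> dA' M = dA' N \<Longrightarrow> dB M = dB N \<Longrightarrow> dB' M = dB' N \<Longrightarrow>
   m12 M = m12 N \<Longrightarrow> m13 M = m13 N \<Longrightarrow> m14 M = m14 N \<Longrightarrow> m23 M = m23 N \<Longrightarrow>
   m24 M = m24 N \<Longrightarrow> m34 M = m34 N \<Longrightarrow> M = N"
  by (rule ut.expand) simp

definition unip :: "'r::comm_ring_1 set \<Rightarrow> 'r ut set" where
  "unip K = {u. dA u = 1 \<and> dA' u = 1 \<and> dB u = 1 \<and> dB' u = 1 \<and>
     m12 u \<in> K \<and> m13 u \<in> K \<and> m14 u \<in> K \<and> m23 u \<in> K \<and> m24 u \<in> K \<and> m34 u \<in> K}"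

section \<open>Abels' presentation of the unipotent group\<close>

context group
begin

lemma lift2:
  "a \<otimes> b = c \<otimes> d \<Longrightarrow> a \<in> carrier G \<Longrightarrow> b \<in> carrier G \<Longrightarrow> c \<in> carrier G \<Longrightarrow> d \<in> carrier G \<Longrightarrow>
   w \<in> carrier G \<Longrightarrow> a \<otimes> (b \<otimes> w) = c \<otimes> (d \<otimes> w)"
  by (simp flip: m_assoc)

lemma lift3:
  "a \<otimes> b = c \<otimes> (d \<otimes> f) \<Longrightarrow> a \<in> carrier G \<Longrightarrow> b \<in> carrier G \<Longrightarrow> c \<in> carrier G \<Longrightarrow> d \<in> carrier G \<Longrightarrow>
   f \<in> carrier G \<Longrightarrow> w \<in> carrier G \<Longrightarrow> a \<otimes> (b \<otimes> w) = c \<otimes> (d \<otimes> (f \<otimes> w))"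
  by (simp flip: m_assoc)

definition comm :: "'a \<Rightarrow> 'a \<Rightarrow> 'a" where
  "comm a b = a \<otimes> b \<otimes> inv a \<otimes> inv b"

lemma comm_closed: "a \<in> carrier G \<Longrightarrow> b \<in> carrier G \<Longrightarrow> comm a b \<in> carrier G"
  by (simp add: comm_def)

lemma comm_eq: "a \<in> carrier G \<Longrightarrow> b \<in> carrier G \<Longrightarrow> comm a b \<otimes> (b \<otimes> a) = a \<otimes> b"
  by (simp add: comm_def m_assoc inv_cancel_left)

lemma comm_unique:
  assumes "a \<in> carrier G" "b \<in> carrier G" "z \<in> carrier G" "a \<otimes> b = z \<otimes> (b \<otimes> a)"
  shows "z = comm a b"
  using assms comm_eq[OF assms(1,2)] comm_closed[OF assms(1,2)] by (metis m_closed right_cancel)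

lemma commutes_comm:
  assumes "g \<in> carrier G" "a \<in> carrier G" "b \<in> carrier G" "a \<otimes> g = g \<otimes> a" "b \<otimes> g = g \<otimes> b"
  shows "comm a b \<otimes> g = g \<otimes> comm a b"
proof -
  have i: "inv x \<otimes> g = g \<otimes> inv x" if "x \<in> carrier G" "x \<otimes> g = g \<otimes> x" for x
    using that assms(1) by (metis inv_closed inv_solve_left inv_solve_right m_assoc m_closed)
  note r = lift2[OF assms(4)] lift2[OF assms(5)] i[OF assms(2,4)] i[OF assms(3,5)]
    lift2[OF i[OF assms(2,4)]] assms(4,5)
  show ?thesis unfolding comm_def using assms(1-3) by (simp add: m_assoc r)
qed

text \<open>The three-subgroup argument: conjugating \<open>q = [b, c]\<close> by \<open>a\<close> gives \<open>[p b, c]\<close>, because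
  \<open>[a, b] = p\<close> and \<open>a\<close> commutes with \<open>c\<close>.\<close>

lemma comm_shift:
  assumes cl: "a \<in> carrier G" "b \<in> carrier G" "c \<in> carrier G" "p \<in> carrier G" "q \<in> carrier G"
    and ab: "a \<otimes> b = p \<otimes> (b \<otimes> a)" and bc: "b \<otimes> c = q \<otimes> (c \<otimes> b)"
    and ac: "a \<otimes> c = c \<otimes> a" and pq: "p \<otimes> q = q \<otimes> p" and qc: "q \<otimes> c = c \<otimes> q"
    and qb: "q \<otimes> b = b \<otimes> q"
  shows "comm a q = comm p c"
proof -
  define z where "z = comm p c"
  have z: "z \<in> carrier G" "p \<otimes> c = z \<otimes> (c \<otimes> p)"
    using cl by (simp_all add: z_def comm_closed comm_eq)
  have zq: "z \<otimes> q = q \<otimes> z"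
    unfolding z_def by (rule commutes_comm) (use cl pq qc in auto)
  have "(a \<otimes> q) \<otimes> (c \<otimes> b) = a \<otimes> (b \<otimes> c)"
    using cl bc by (simp add: m_assoc)
  also have "\<dots> = p \<otimes> (b \<otimes> (a \<otimes> c))" using cl by (simp add: lift3[OF ab])
  also have "\<dots> = p \<otimes> (b \<otimes> (c \<otimes> a))" by (simp only: ac)
  also have "\<dots> = p \<otimes> (q \<otimes> (c \<otimes> (b \<otimes> a)))" using cl by (simp add: lift3[OF bc])
  also have "\<dots> = q \<otimes> (p \<otimes> (c \<otimes> (b \<otimes> a)))" using cl by (simp add: lift2[OF pq])
  also have "\<dots> = q \<otimes> (z \<otimes> (c \<otimes> (p \<otimes> (b \<otimes> a))))" using cl z by (simp add: lift3[OF z(2)])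
  also have "\<dots> = q \<otimes> (z \<otimes> (c \<otimes> (a \<otimes> b)))" by (simp only: ab)
  also have "\<dots> = q \<otimes> (z \<otimes> (a \<otimes> (c \<otimes> b)))" using cl by (simp add: lift2[OF ac])
  also have "\<dots> = (z \<otimes> (q \<otimes> a)) \<otimes> (c \<otimes> b)" using cl z by (simp add: m_assoc lift2[OF zq])
  finally have "a \<otimes> q = z \<otimes> (q \<otimes> a)" using cl z by (metis m_closed right_cancel)
  then show ?thesis using comm_unique[of a q z] cl z by (simp add: z_def)
qed

end

text \<open>The root subgroup 14 is missing: the torus acts trivially on it, and its elements are
  represented by commutators.\<close>

datatype root = R12 | R13 | R23 | R24 | R34

text \<open>The commutators of 12 with 24 and of 13 with 34 are not assumed to be known. The unit \<open>e\<close> of \<open>K\<close> need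
  not be the unit of the ring, because \<open>K\<close> will be the part of a product ring at one place.\<close>

locale abels = group Q for Q (structure) +
  fixes K :: "'r::comm_ring_1 set" and e :: 'r and E :: "root \<Rightarrow> 'r \<Rightarrow> 'a"
  assumes K_add: "x \<in> K \<Longrightarrow> y \<in> K \<Longrightarrow> x + y \<in> K"
    and K_mult: "x \<in> K \<Longrightarrow> y \<in> K \<Longrightarrow> x * y \<in> K"
    and K_unit: "e \<in> K" "x \<in> K \<Longrightarrow> x * e = x"
    and E_closed: "x \<in> K \<Longrightarrow> E \<alpha> x \<in> carrier Q"
    and E_add: "x \<in> K \<Longrightarrow> y \<in> K \<Longrightarrow> E \<alpha> x \<otimes> E \<alpha> y = E \<alpha> (x + y)"
    and E_commute: "x \<in> K \<Longrightarrow> y \<in> K \<Longrightarrow>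
      (\<alpha>, \<beta>) \<in> {(R13, R12), (R12, R34), (R13, R23), (R13, R24), (R24, R23), (R24, R34)} \<Longrightarrow>
      E \<alpha> x \<otimes> E \<beta> y = E \<beta> y \<otimes> E \<alpha> x"
    and E_12_23: "x \<in> K \<Longrightarrow> y \<in> K \<Longrightarrow>
      E R12 x \<otimes> E R23 y = E R13 (x * y) \<otimes> (E R23 y \<otimes> E R12 x)"
    and E_23_34: "x \<in> K \<Longrightarrow> y \<in> K \<Longrightarrow>
      E R23 x \<otimes> E R34 y = E R24 (x * y) \<otimes> (E R34 y \<otimes> E R23 x)"
begin

text \<open>Instances oriented towards the order 34, 23, 24, 12, 13.\<close>

lemma E_collect:
  assumes "x \<in> K" "y \<in> K"
  shows "E R13 x \<otimes> E R12 y = E R12 y \<otimes> E R13 x" "E R12 x \<otimes> E R34 y = E R34 y \<otimes> E R12 x"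
    "E R13 x \<otimes> E R23 y = E R23 y \<otimes> E R13 x" "E R13 x \<otimes> E R24 y = E R24 y \<otimes> E R13 x"
    "E R24 x \<otimes> E R23 y = E R23 y \<otimes> E R24 x" "E R24 x \<otimes> E R34 y = E R34 y \<otimes> E R24 x"
  using assms by (auto intro!: E_commute)

definition Z :: "'r \<Rightarrow> 'a" where "Z x = comm (E R12 x) (E R24 e)"

lemma Z_closed: "x \<in> K \<Longrightarrow> Z x \<in> carrier Q"
  by (simp add: Z_def comm_closed E_closed K_unit)

text \<open>With \<open>y\<close> or \<open>z\<close> equal to the unit, this shows that both commutators depend only on the product of
  their arguments.\<close>

lemma comm_12_24_eq_13_34:
  assumes "x \<in> K" "y \<in> K" "z \<in> K"
  shows "comm (E R12 x) (E R24 (y * z)) = comm (E R13 (x * y)) (E R34 z)"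
  by (rule comm_shift[where b = "E R23 y"])
     (use assms in \<open>auto simp: E_closed K_mult E_12_23 E_23_34 E_collect\<close>)

lemma comm_13_34:
  assumes "x \<in> K" "z \<in> K"
  shows "comm (E R13 x) (E R34 z) = Z (x * z)"
proof -
  have u: "e * z = z" "e * e = e" "x * e = x" "z * e = z" "x * z * e = x * z"
    using K_unit(2)[OF assms(2)] K_unit(2)[OF K_unit(1)] K_unit(2)[OF assms(1)]
      K_unit(2)[OF K_mult[OF assms]] by (simp_all add: mult.commute)
  have "comm (E R13 x) (E R34 z) = comm (E R12 x) (E R24 z)"
    using comm_12_24_eq_13_34[OF assms(1) K_unit(1) assms(2)] by (simp only: u)
  also have "\<dots> = comm (E R13 (x * z)) (E R34 e)"
    using comm_12_24_eq_13_34[OF assms K_unit(1)] by (simp only: u)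
  also have "\<dots> = Z (x * z)"
    using comm_12_24_eq_13_34[OF K_mult[OF assms] K_unit(1) K_unit(1)] by (simp only: u Z_def)
  finally show ?thesis .
qed

lemma comm_12_24: "x \<in> K \<Longrightarrow> z \<in> K \<Longrightarrow> comm (E R12 x) (E R24 z) = Z (x * z)"
  using comm_12_24_eq_13_34[of x z e] comm_13_34[of "x * z" e] by (simp add: K_unit K_mult)

lemma E_12_24:
  assumes "x \<in> K" "y \<in> K"
  shows "E R12 x \<otimes> E R24 y = Z (x * y) \<otimes> (E R24 y \<otimes> E R12 x)"
  using assms by (simp add: comm_eq E_closed flip: comm_12_24)

lemma E_13_34:
  assumes "x \<in> K" "y \<in> K"
  shows "E R13 x \<otimes> E R34 y = Z (x * y) \<otimes> (E R34 y \<otimes> E R13 x)"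
  using assms by (simp add: comm_eq E_closed flip: comm_13_34)

text \<open>\<open>Z x\<close> is a commutator in two ways. The factors of one of them commute with 12 and 24, or those of
  the other with 13 and 34. For 23, moving \<open>E R23 y\<close> through \<open>E R12 x\<close> produces a factor in 13,
  which commutes with \<open>Z x\<close>.\<close>

lemma Z_central:
  assumes x: "x \<in> K" and y: "y \<in> K"
  shows "Z x \<otimes> E \<alpha> y = E \<alpha> y \<otimes> Z x"
proof -
  note c = E_closed K_unit x y
  have 13: "Z x = comm (E R13 x) (E R34 e)" using comm_13_34[of x e] x by (simp add: K_unit)
  have z13: "Z u \<otimes> E R13 y = E R13 y \<otimes> Z u" if "u \<in> K" "y \<in> K" for u y
    unfolding Z_def using that by (intro commutes_comm) (auto simp: c E_collect)
  show ?thesis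
  proof (cases \<alpha>)
    case R12 then show ?thesis unfolding 13
      by (simp only:, intro commutes_comm) (auto simp: c E_collect)
  next
    case R24 then show ?thesis unfolding 13
      by (simp only:, intro commutes_comm) (auto simp: c E_collect)
  next
    case R13 then show ?thesis using z13[OF x y] by simp
  next
    case R34 then show ?thesis unfolding Z_def
      by (simp only:, intro commutes_comm) (auto simp: c E_collect)
  next
    case R23
    define a where "a = E R12 x"
    define b where "b = E R23 y"
    define p where "p = E R13 (x * y)"
    define q where "q = E R24 e"
    have cl: "a \<in> carrier Q" "b \<in> carrier Q" "p \<in> carrier Q" "q \<in> carrier Q" "Z x \<in> carrier Q"
      by (auto simp: a_def b_def p_def q_def c K_mult Z_closed)
    have ab: "a \<otimes> b = p \<otimes> (b \<otimes> a)" unfolding a_def b_def p_def by (rule E_12_23[OF x y])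
    have aq: "a \<otimes> q = Z x \<otimes> (q \<otimes> a)"
      using E_12_24[OF x K_unit(1)] x by (simp add: a_def q_def K_unit)
    have qb: "q \<otimes> b = b \<otimes> q" and pq: "q \<otimes> p = p \<otimes> q"
      by (simp_all add: q_def b_def p_def E_collect c K_mult)
    have zp: "Z x \<otimes> p = p \<otimes> Z x" unfolding p_def using x y by (intro z13 K_mult)
    have "p \<otimes> (Z x \<otimes> (b \<otimes> (q \<otimes> a))) = Z x \<otimes> (q \<otimes> (p \<otimes> (b \<otimes> a)))"
      using cl by (simp add: lift2[OF zp] lift2[OF qb] lift2[OF pq])
    also have "\<dots> = (Z x \<otimes> (q \<otimes> a)) \<otimes> b" using cl by (simp add: m_assoc ab)
    also have "\<dots> = a \<otimes> (b \<otimes> q)" using cl by (simp add: m_assoc qb flip: aq)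
    also have "\<dots> = p \<otimes> (b \<otimes> (a \<otimes> q))" using cl by (simp add: lift3[OF ab])
    also have "\<dots> = p \<otimes> (b \<otimes> (Z x \<otimes> (q \<otimes> a)))" by (simp only: aq)
    finally have "Z x \<otimes> (b \<otimes> (q \<otimes> a)) = b \<otimes> (Z x \<otimes> (q \<otimes> a))" using cl by simp
    then have "(Z x \<otimes> b) \<otimes> (q \<otimes> a) = (b \<otimes> Z x) \<otimes> (q \<otimes> a)" using cl by (simp add: m_assoc)
    then show ?thesis using cl R23 by (simp add: b_def)
  qed
qed

text \<open>\<open>Z x\<close> is a product of elements that commute with \<open>Z y\<close>.\<close>

lemma Z_commute:
  assumes "x \<in> K" "y \<in> K" shows "Z x \<otimes> Z y = Z y \<otimes> Z x"
  unfolding Z_def[of x]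
  by (rule commutes_comm) (use assms in \<open>auto simp: E_closed Z_closed K_unit Z_central\<close>)

lemma Z_add:
  assumes x: "x \<in> K" and y: "y \<in> K"
  shows "Z x \<otimes> Z y = Z (x + y)"
proof -
  note c = E_closed K_unit Z_closed x y
  have "E R12 (x + y) \<otimes> E R24 e = E R12 x \<otimes> (E R12 y \<otimes> E R24 e)"
    by (simp add: c m_assoc flip: E_add)
  also have "\<dots> = E R12 x \<otimes> (Z y \<otimes> (E R24 e \<otimes> E R12 y))"
    using E_12_24[OF y K_unit(1)] y by (simp add: K_unit)
  also have "\<dots> = Z y \<otimes> (E R12 x \<otimes> (E R24 e \<otimes> E R12 y))"
    by (simp add: c lift2[OF Z_central])
  also have "\<dots> = Z y \<otimes> (Z x \<otimes> (E R24 e \<otimes> (E R12 x \<otimes> E R12 y)))"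
    using lift3[OF E_12_24[OF x K_unit(1)], of "E R12 y"] by (simp add: c K_mult)
  also have "\<dots> = (Z x \<otimes> Z y) \<otimes> (E R24 e \<otimes> E R12 (x + y))"
    by (simp add: c m_assoc E_add lift2[OF Z_commute] K_add)
  finally have "Z x \<otimes> Z y = comm (E R12 (x + y)) (E R24 e)"
    by (intro comm_unique) (auto simp: c K_add)
  then show ?thesis by (simp add: Z_def)
qed

definition Psi :: "'r ut \<Rightarrow> 'a" where
  "Psi u = E R34 (m34 u) \<otimes> (E R23 (m23 u) \<otimes> (E R24 (m24 u) \<otimes>
     (E R12 (m12 u) \<otimes> (E R13 (m13 u) \<otimes> Z (m14 u)))))"

lemma Psi_closed: "u \<in> unip K \<Longrightarrow> Psi u \<in> carrier Q"
  by (simp add: unip_def Psi_def E_closed Z_closed)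

lemma E_add_lift: "x \<in> K \<Longrightarrow> y \<in> K \<Longrightarrow> w \<in> carrier Q \<Longrightarrow> E \<alpha> x \<otimes> (E \<alpha> y \<otimes> w) = E \<alpha> (x + y) \<otimes> w"
  by (simp add: E_closed flip: E_add m_assoc)

lemma Z_add_lift: "x \<in> K \<Longrightarrow> y \<in> K \<Longrightarrow> w \<in> carrier Q \<Longrightarrow> Z x \<otimes> (Z y \<otimes> w) = Z (x + y) \<otimes> w"
  by (simp add: Z_closed flip: Z_add m_assoc)

text \<open>Oriented towards the order 34, 23, 24, 12, 13, 14, the relations form a terminating rewrite system.
  In this order the product of root elements has exactly its parameters as matrix entries.\<close>

lemma Psi_mult:
  assumes "u \<in> unip K" "v \<in> unip K"
  shows "Psi u \<otimes> Psi v = Psi (u * v)"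
proof -
  note k = E_closed Z_closed K_mult K_add
  note r = E_add Z_add E_add_lift Z_add_lift Z_central lift2[OF Z_central]
    E_12_23 lift3[OF E_12_23] E_23_34 lift3[OF E_23_34] E_12_24 lift3[OF E_12_24]
    E_13_34 lift3[OF E_13_34] E_collect E_collect[THEN lift2]
  show ?thesis
    using assms unfolding unip_def Psi_def
    by (simp add: k m_assoc r) (simp add: algebra_simps)
qed

lemma commutes_Psi:
  assumes g: "g \<in> carrier Q" and c: "\<And>\<alpha> x. x \<in> K \<Longrightarrow> E \<alpha> x \<otimes> g = g \<otimes> E \<alpha> x" and u: "u \<in> unip K"
  shows "Psi u \<otimes> g = g \<otimes> Psi u"
proof -
  have z: "Z x \<otimes> g = g \<otimes> Z x" if "x \<in> K" for x
    unfolding Z_def by (rule commutes_comm) (use that in \<open>auto simp: g c E_closed K_unit\<close>)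
  show ?thesis
    using u unfolding unip_def Psi_def
    by (simp add: g E_closed Z_closed m_assoc c z lift2[OF c] lift2[OF z])
qed

lemma E_zero: "0 \<in> K \<Longrightarrow> E \<alpha> 0 = \<one>"
  using E_add[of 0 0 \<alpha>] E_closed[of 0 \<alpha>] by simp

lemma inv_E: "x \<in> K \<Longrightarrow> - x \<in> K \<Longrightarrow> 0 \<in> K \<Longrightarrow> inv (E \<alpha> x) = E \<alpha> (- x)"
  by (rule inv_equality) (simp_all add: E_add E_zero E_closed)

text \<open>A conjugation that rescales the root subgroups fixes the centre, on which the two scaling
  factors cancel.\<close>

lemma conj_Psi:
  assumes t: "t \<in> carrier Q" and c: "\<And>\<alpha> x. x \<in> K \<Longrightarrow> c \<alpha> * x \<in> K"
    and qconj: "\<And>\<alpha> x. x \<in> K \<Longrightarrow> t \<otimes> E \<alpha> x = E \<alpha> (c \<alpha> * x) \<otimes> t"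
    and c1: "c R12 * c R24 = 1" and u: "u \<in> unip K"
  shows "t \<otimes> Psi u = Psi (UT 1 1 1 1 (c R12 * m12 u) (c R13 * m13 u) (m14 u) (c R23 * m23 u)
           (c R24 * m24 u) (c R34 * m34 u)) \<otimes> t"
proof -
  have z: "t \<otimes> Z x = Z x \<otimes> t" if x: "x \<in> K" for x
  proof -
    note k = x K_unit c E_closed Z_closed t K_mult
    have "(c R12 * x) * (c R24 * e) = (c R12 * c R24) * (x * e)" by (simp only: ac_simps)
    also have "\<dots> = x" using x by (simp add: c1 K_unit)
    finally have Zx: "E R12 (c R12 * x) \<otimes> E R24 (c R24 * e) = Z x \<otimes> (E R24 (c R24 * e) \<otimes> E R12 (c R12 * x))"
      using E_12_24[of "c R12 * x" "c R24 * e"] by (simp add: k)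
    have e: "E R12 x \<otimes> E R24 e = Z x \<otimes> (E R24 e \<otimes> E R12 x)"
      using E_12_24[OF x K_unit(1)] x by (simp add: K_unit)
    have "t \<otimes> (E R12 x \<otimes> E R24 e) = E R12 (c R12 * x) \<otimes> (E R24 (c R24 * e) \<otimes> t)"
      by (simp add: k qconj lift2[OF qconj])
    also have "\<dots> = Z x \<otimes> (E R24 (c R24 * e) \<otimes> (E R12 (c R12 * x) \<otimes> t))"
      using lift3[OF Zx, of t] by (simp add: k)
    also have "\<dots> = Z x \<otimes> (t \<otimes> (E R24 e \<otimes> E R12 x))"
      by (simp add: k qconj lift2[OF qconj])
    finally have "(t \<otimes> Z x) \<otimes> (E R24 e \<otimes> E R12 x) = (Z x \<otimes> t) \<otimes> (E R24 e \<otimes> E R12 x)"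
      by (simp add: k e m_assoc)
    then show ?thesis by (simp add: k)
  qed
  show ?thesis
    using u unfolding unip_def Psi_def
    by (simp add: t c E_closed Z_closed m_assoc qconj z lift2[OF qconj] lift2[OF z])
qed

end

section \<open>Root subgroups and the torus\<close>

primrec el :: "root \<Rightarrow> 'r::comm_ring_1 \<Rightarrow> 'r ut" where
  "el R12 x = UT 1 1 1 1 x 0 0 0 0 0"
| "el R13 x = UT 1 1 1 1 0 x 0 0 0 0"
| "el R23 x = UT 1 1 1 1 0 0 0 x 0 0"
| "el R24 x = UT 1 1 1 1 0 0 0 0 x 0"
| "el R34 x = UT 1 1 1 1 0 0 0 0 0 x"

definition diagonal :: "'r::comm_ring_1 ut \<Rightarrow> bool" where
  "diagonal D \<longleftrightarrow> dA D * dA' D = 1 \<and> dB D * dB' D = 1 \<and>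
     m12 D = 0 \<and> m13 D = 0 \<and> m14 D = 0 \<and> m23 D = 0 \<and> m24 D = 0 \<and> m34 D = 0"

text \<open>The character by which a diagonal matrix acts on a root subgroup.\<close>

primrec chD :: "root \<Rightarrow> 'r::comm_ring_1 ut \<Rightarrow> 'r" where
  "chD R12 D = dA' D"
| "chD R13 D = dB' D"
| "chD R23 D = dA D * dB' D"
| "chD R24 D = dA D"
| "chD R34 D = dB D"

lemma diagonal_el: "diagonal D \<Longrightarrow> D * el \<alpha> x = el \<alpha> (chD \<alpha> D * x) * D"
proof -
  assume D: "diagonal D"
  have a: "dA' D * y * dA D = y" "dB' D * y * dB D = y" for y
    using D by (simp_all add: diagonal_def mult.commute[of _ y] mult.assoc)
       (simp_all add: mult.commute)
  have "dA D * dB' D * y * dB D = dA D * y" for y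
    using a(2)[of "dA D * y"] by (simp add: ac_simps)
  then show ?thesis
    using D by (cases \<alpha>; intro ut_eqI) (simp_all add: diagonal_def a)
qed

lemma el_add: "el \<alpha> x * el \<alpha> y = el \<alpha> (x + y)"
  by (cases \<alpha>; rule ut_eqI) (simp_all add: ac_simps)

lemma el_commute:
  "(\<alpha>, \<beta>) \<in> {(R13, R12), (R12, R34), (R13, R23), (R13, R24), (R24, R23), (R24, R34)} \<Longrightarrow>
   el \<alpha> x * el \<beta> y = el \<beta> y * el \<alpha> x"
  by (rule ut_eqI) auto

lemma el_commute_orth: "x * y = 0 \<Longrightarrow> el \<alpha> x * el \<beta> y = el \<beta> y * el \<alpha> x"
  by (cases \<alpha>; cases \<beta>; rule ut_eqI) (simp_all add: ac_simps)

lemma el_12_23: "el R12 x * el R23 y = el R13 (x * y) * (el R23 y * el R12 x)"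
  by (rule ut_eqI) auto

lemma el_23_34: "el R23 x * el R34 y = el R24 (x * y) * (el R34 y * el R23 x)"
  by (rule ut_eqI) auto

definition upart :: "'r::comm_ring_1 ut \<Rightarrow> 'r ut" where
  "upart g = UT 1 1 1 1 (m12 g * dA' g) (m13 g * dB' g) (m14 g) (m23 g * dB' g) (m24 g) (m34 g)"

definition dpart :: "'r::comm_ring_1 ut \<Rightarrow> 'r ut" where
  "dpart g = UT (dA g) (dA' g) (dB g) (dB' g) 0 0 0 0 0 0"

definition uinv :: "'r::comm_ring_1 ut \<Rightarrow> 'r ut" where
  "uinv g = (let x12 = - (m12 g * dA' g); x23 = - (dA' g * m23 g * dB' g);
                 x34 = - (dB' g * m34 g); x13 = - ((m13 g + x12 * m23 g) * dB' g)
     in UT (dA' g) (dA g) (dB' g) (dB g) x12 x13 (- (m14 g + x12 * m24 g + x13 * m34 g))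
          x23 (- (dA' g * m24 g + x23 * m34 g)) x34)"

lemma uinv_left:
  assumes "dA g * dA' g = 1" "dB g * dB' g = 1"
  shows "uinv g * g = 1"
proof -
  have a: "x * dA' g * dA g = x" "x * dB' g * dB g = x" for x
    using assms by (simp_all add: mult.assoc mult.commute[of "dA' g"] mult.commute[of "dB' g"])
  show ?thesis
    by (rule ut_eqI)
       (use assms in \<open>simp_all add: uinv_def Let_def a mult.commute[of "dA' g" "dA g"]
          mult.commute[of "dB' g" "dB g"] distrib_right left_diff_distrib\<close>)
qed

lemma uinv_right:
  assumes "dA g * dA' g = 1" "dB g * dB' g = 1"
  shows "g * uinv g = 1"
proof -
  have "dA (uinv g) * dA' (uinv g) = 1" "dB (uinv g) * dB' (uinv g) = 1"
    using assms by (simp_all add: uinv_def Let_def mult.commute)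
  then have "uinv (uinv g) * uinv g = 1" by (rule uinv_left)
  moreover have "uinv (uinv g) = uinv (uinv g) * (uinv g * g)" using assms by (simp add: uinv_left)
  ultimately show ?thesis by (metis mult.assoc mult_1)
qed

lemma upart_dpart:
  assumes "dA g * dA' g = 1" "dB g * dB' g = 1"
  shows "g = upart g * dpart g"
  by (rule ut_eqI)
     (use assms in \<open>simp_all add: upart_def dpart_def mult.assoc mult.commute[of "dA' g"]
        mult.commute[of "dB' g"]\<close>)

section \<open>Rings with three places\<close>

datatype place = P0 | P1 | PI

text \<open>The order of vanishing of \<open>t\<^sup>i (t - 1)\<^sup>j\<close>.\<close>

fun pval :: "place \<Rightarrow> int \<Rightarrow> int \<Rightarrow> int" where
  "pval P0 i j = i"
| "pval P1 i j = j"
| "pval PI i j = - i - j"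

text \<open>Exponents of \<open>t\<close> and \<open>t - 1\<close> in the two diagonal entries.\<close>

datatype coord = A1 | A2 | B1 | B2

definition unit_exp :: "coord \<Rightarrow> coord \<Rightarrow> int" where
  "unit_exp a b = (if a = b then 1 else 0)"

definition scale :: "int \<Rightarrow> (coord \<Rightarrow> int) \<Rightarrow> coord \<Rightarrow> int" where
  "scale m E a = m * E a"

definition restrict_exp :: "coord set \<Rightarrow> (coord \<Rightarrow> int) \<Rightarrow> coord \<Rightarrow> int" where
  "restrict_exp A E a = (if a \<in> A then E a else 0)"

text \<open>The character of the torus on a root subgroup is the product of the powers \<open>wA\<close> and \<open>wB\<close> of the two
  diagonal entries.\<close>

primrec wA :: "root \<Rightarrow> int" where
  "wA R12 = -1" | "wA R13 = 0" | "wA R23 = 1" | "wA R24 = 1" | "wA R34 = 0"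

primrec wB :: "root \<Rightarrow> int" where
  "wB R12 = 0" | "wB R13 = -1" | "wB R23 = -1" | "wB R24 = 0" | "wB R34 = 1"

text \<open>The valuation, at the place \<open>v\<close>, of the character by which the torus element with exponents \<open>E\<close> acts
  on the root subgroup \<open>\<alpha>\<close>.\<close>

definition wt :: "place \<Rightarrow> root \<Rightarrow> (coord \<Rightarrow> int) \<Rightarrow> int" where
  "wt v \<alpha> E = pval v (wA \<alpha> * E A1 + wB \<alpha> * E B1) (wA \<alpha> * E A2 + wB \<alpha> * E B2)"

lemma wt_minus: "wt v \<alpha> (- E) = - wt v \<alpha> E"
  by (cases v) (simp_all add: wt_def)

lemma wt_scale: "wt v \<alpha> (scale m E) = m * wt v \<alpha> E"
  by (cases v) (simp_all add: wt_def scale_def algebra_simps)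

lemma wt_bound:
  assumes "\<And>a. \<bar>E a\<bar> \<le> m"
  shows "\<bar>wt v \<alpha> E\<bar> \<le> 4 * m"
  using assms[of A1] assms[of A2] assms[of B1] assms[of B2]
  by (cases v; cases \<alpha>) (auto simp: wt_def)

primrec unif :: "place \<Rightarrow> int \<times> int" where
  "unif P0 = (1, 0)" | "unif P1 = (0, 1)" | "unif PI = (-1, 0)"

text \<open>A torus element that expands the root subgroup \<open>\<alpha>\<close> at the place \<open>v\<close>.\<close>

definition dir :: "root \<Rightarrow> place \<Rightarrow> coord \<Rightarrow> int" where
  "dir \<alpha> v a = (case a of A1 \<Rightarrow> - wA \<alpha> * fst (unif v) | A2 \<Rightarrow> - wA \<alpha> * snd (unif v)
                        | B1 \<Rightarrow> - wB \<alpha> * fst (unif v) | B2 \<Rightarrow> - wB \<alpha> * snd (unif v))"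

lemma wt_dir: "wt v \<alpha> (dir \<alpha> v) \<le> -1"
  by (cases v; cases \<alpha>) (auto simp: wt_def dir_def)

lemma wt_dir_restrict: "wt v \<alpha> (restrict_exp A (dir \<alpha> v)) \<le> 0"
  by (cases v; cases \<alpha>) (auto simp: wt_def dir_def restrict_exp_def)

lemma dir_bound: "\<bar>dir \<alpha> v a\<bar> \<le> 1"
  by (cases v; cases \<alpha>; cases a) (auto simp: dir_def)

text \<open>Two root subgroups are tame if one torus element expands both of them.\<close>

lemma tame_same_place:
  assumes "(\<alpha>, \<beta>) \<in> {(R13, R12), (R12, R34), (R13, R23), (R13, R24), (R24, R23), (R24, R34),
                     (R12, R23), (R23, R34)} \<or> \<alpha> = \<beta>"
  shows "\<exists>E. wt v \<alpha> E \<le> -1 \<and> wt v \<beta> E \<le> -1"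
proof -
  define F where "F a b = (\<lambda>x. case x of A1 \<Rightarrow> a * fst (unif v) | A2 \<Rightarrow> a * snd (unif v)
                        | B1 \<Rightarrow> b * fst (unif v) | B2 \<Rightarrow> b * snd (unif v))" for a b :: int
  have w: "wt v \<gamma> (F a b) = wA \<gamma> * a + wB \<gamma> * b" for \<gamma> a b
    by (cases v) (auto simp: wt_def F_def)
  from assms consider "\<alpha> = \<beta>" | "\<alpha> = R13 \<and> \<beta> = R12" | "\<alpha> = R12 \<and> \<beta> = R34" | "\<alpha> = R13 \<and> \<beta> = R23"
    | "\<alpha> = R13 \<and> \<beta> = R24" | "\<alpha> = R24 \<and> \<beta> = R23" | "\<alpha> = R24 \<and> \<beta> = R34" | "\<alpha> = R12 \<and> \<beta> = R23"
    | "\<alpha> = R23 \<and> \<beta> = R34" by auto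
  then show ?thesis
  proof cases
    case 1 then show ?thesis using wt_dir by blast
  next
    case 2 then show ?thesis by (intro exI[of _ "F 1 1"]) (simp add: w)
  next
    case 3 then show ?thesis by (intro exI[of _ "F 1 (-1)"]) (simp add: w)
  next
    case 4 then show ?thesis by (intro exI[of _ "F 0 1"]) (simp add: w)
  next
    case 5 then show ?thesis by (intro exI[of _ "F (-1) 1"]) (simp add: w)
  next
    case 6 then show ?thesis by (intro exI[of _ "F (-1) 0"]) (simp add: w)
  next
    case 7 then show ?thesis by (intro exI[of _ "F (-1) (-1)"]) (simp add: w)
  next
    case 8 then show ?thesis by (intro exI[of _ "F 1 2"]) (simp add: w)
  next
    case 9 then show ?thesis by (intro exI[of _ "F (-2) (-1)"]) (simp add: w)
  qed
qed

text \<open>Some unit has order 1 at \<open>v\<close> and order 0 at \<open>w\<close>, and vice versa, so the torus acts on the two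
  places independently.\<close>

lemma tame_distinct_places:
  assumes "v \<noteq> w"
  shows "\<exists>E. wt v \<alpha> E \<le> -1 \<and> wt w \<beta> E \<le> -1"
proof -
  have *: "\<exists>i j. pval v i j = 1 \<and> pval w i j = 0" if "v \<noteq> w" for v w
  proof (cases v; cases w)
    assume "v = P0" "w = P1" then show ?thesis by (intro exI[of _ 1] exI[of _ 0]) auto
  next
    assume "v = P0" "w = PI" then show ?thesis by (intro exI[of _ 1] exI[of _ "-1"]) auto
  next
    assume "v = P1" "w = P0" then show ?thesis by (intro exI[of _ 0] exI[of _ 1]) auto
  next
    assume "v = P1" "w = PI" then show ?thesis by (intro exI[of _ "-1"] exI[of _ 1]) auto
  next
    assume "v = PI" "w = P0" then show ?thesis by (intro exI[of _ 0] exI[of _ "-1"]) auto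
  next
    assume "v = PI" "w = P1" then show ?thesis by (intro exI[of _ "-1"] exI[of _ 0]) auto
  qed (use that in auto)
  obtain i j i' j' where o: "pval v i j = 1" "pval w i j = 0" "pval w i' j' = 1" "pval v i' j' = 0"
    using *[OF assms] *[OF assms[symmetric]] by blast
  define E where "E x = (case x of A1 \<Rightarrow> - wA \<alpha> * i - wA \<beta> * i' | A2 \<Rightarrow> - wA \<alpha> * j - wA \<beta> * j'
    | B1 \<Rightarrow> - wB \<alpha> * i - wB \<beta> * i' | B2 \<Rightarrow> - wB \<alpha> * j - wB \<beta> * j')" for x
  have "wt x \<gamma> E = - (wA \<alpha> * wA \<gamma> + wB \<alpha> * wB \<gamma>) * pval x i j - (wA \<beta> * wA \<gamma> + wB \<beta> * wB \<gamma>) * pval x i' j'"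
    for x \<gamma> by (cases x) (simp_all add: wt_def E_def algebra_simps)
  then have "wt v \<alpha> E = - (wA \<alpha> * wA \<alpha> + wB \<alpha> * wB \<alpha>)" "wt w \<beta> E = - (wA \<beta> * wA \<beta> + wB \<beta> * wB \<beta>)"
    using o by simp_all
  moreover have "wA \<gamma> * wA \<gamma> + wB \<gamma> * wB \<gamma> \<ge> 1" for \<gamma> by (cases \<gamma>) auto
  ultimately show ?thesis by (intro exI[of _ E]) (simp only: neg_le_iff_le)
qed

lemma exp_decomp: "E = scale (E A1) (unit_exp A1) + (scale (E A2) (unit_exp A2) +
      (scale (E B1) (unit_exp B1) + scale (E B2) (unit_exp B2)))"
proof
  fix a show "E a = (scale (E A1) (unit_exp A1) + (scale (E A2) (unit_exp A2) +
      (scale (E B1) (unit_exp B1) + scale (E B2) (unit_exp B2)))) a"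
    by (cases a) (simp_all add: scale_def unit_exp_def)
qed

text \<open>The ring is a product of three rings with idempotents \<open>eps v\<close>; \<open>Bv v n\<close> is the set of elements of
  the factor at \<open>v\<close> with pole order at most \<open>n\<close>, \<open>u i j\<close> is \<open>t\<^sup>i (t - 1)\<^sup>j\<close>, and \<open>c0\<close> is the group of
  constants. The condition \<open>u_ord\<close> says that the size of a unit controls its exponents.\<close>

locale places =
  fixes eps :: "place \<Rightarrow> 'r::comm_ring_1" and Bv :: "place \<Rightarrow> int \<Rightarrow> 'r set"
    and u :: "int \<Rightarrow> int \<Rightarrow> 'r" and c0 :: "'r set"
  assumes Bv_zero: "0 \<in> Bv v n"
    and Bv_add: "x \<in> Bv v n \<Longrightarrow> y \<in> Bv v n \<Longrightarrow> x + y \<in> Bv v n"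
    and Bv_minus: "x \<in> Bv v n \<Longrightarrow> - x \<in> Bv v n"
    and Bv_mult: "x \<in> Bv v m \<Longrightarrow> y \<in> Bv v n \<Longrightarrow> x * y \<in> Bv v (m + n)"
    and Bv_mono: "m \<le> n \<Longrightarrow> Bv v m \<subseteq> Bv v n"
    and Bv_eps: "x \<in> Bv v n \<Longrightarrow> eps v * x = x"
    and Bv_exhaust: "\<exists>n. eps v * x \<in> Bv v n"
    and eps_Bv: "eps v \<in> Bv v 0"
    and eps_orth: "v \<noteq> w \<Longrightarrow> eps v * eps w = 0"
    and eps_sum: "eps P0 + eps P1 + eps PI = 1"
    and u_add: "u i j * u i' j' = u (i + i') (j + j')"
    and u_zero: "u 0 0 = 1"
    and u_shift: "x \<in> Bv v n \<Longrightarrow> u i j * x \<in> Bv v (n - pval v i j)"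
    and c0_one: "1 \<in> c0"
    and c0_mult: "c \<in> c0 \<Longrightarrow> d \<in> c0 \<Longrightarrow> c * d \<in> c0"
    and c0_inv: "c \<in> c0 \<Longrightarrow> \<exists>d\<in>c0. c * d = 1"
    and c0_Bv: "c \<in> c0 \<Longrightarrow> eps v * c \<in> Bv v 0"
    and u_ord: "c \<in> c0 \<Longrightarrow> eps v * (c * u i j) \<in> Bv v n \<Longrightarrow> - pval v i j \<le> n"
begin

definition B :: "nat \<Rightarrow> 'r set" where
  "B n = {x. \<forall>v. eps v * x \<in> Bv v (int n)}"

lemma eps_idem: "eps v * eps v = eps v" "eps v * (eps v * x) = eps v * x"
  using Bv_eps[OF eps_Bv[of v]] by (simp_all flip: mult.assoc)

lemma B_zero: "0 \<in> B n" by (simp add: B_def Bv_zero)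

lemma B_add: "x \<in> B n \<Longrightarrow> y \<in> B n \<Longrightarrow> x + y \<in> B n"
  by (simp add: B_def distrib_left Bv_add)

lemma B_minus: "x \<in> B n \<Longrightarrow> - x \<in> B n"
  by (simp add: B_def Bv_minus)

lemma B_mult: "x \<in> B m \<Longrightarrow> y \<in> B n \<Longrightarrow> x * y \<in> B (m + n)"
proof -
  assume a: "x \<in> B m" "y \<in> B n"
  have "(eps v * x) * (eps v * y) \<in> Bv v (int m + int n)" for v
    using a by (intro Bv_mult) (auto simp: B_def)
  moreover have "(eps v * x) * (eps v * y) = eps v * (x * y)" for v
    using eps_idem(2)[of v "x * y"] by (simp add: ac_simps)
  ultimately show ?thesis by (simp add: B_def)
qed

lemma B_mono: "m \<le> n \<Longrightarrow> B m \<subseteq> B n"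
  unfolding B_def using Bv_mono[of "int m" "int n"] by auto

lemma B_one: "1 \<in> B n"
proof -
  have "1 \<in> B 0" by (simp add: B_def eps_Bv)
  then show ?thesis using B_mono[of 0 n] by blast
qed

lemma Bv_B: "x \<in> Bv v (int n) \<Longrightarrow> x \<in> B n"
proof -
  assume x: "x \<in> Bv v (int n)"
  have "eps w * x \<in> Bv w (int n)" for w
  proof (cases "w = v")
    case True then show ?thesis using x Bv_eps by simp
  next
    case False
    have "eps w * x = (eps w * eps v) * x" using Bv_eps[OF x] by (simp add: mult.assoc)
    then show ?thesis using eps_orth[OF False] by (simp add: Bv_zero)
  qed
  then show ?thesis by (simp add: B_def)
qed

lemma Bv_orth: "x \<in> Bv v m \<Longrightarrow> y \<in> Bv w n \<Longrightarrow> v \<noteq> w \<Longrightarrow> x * y = 0"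
proof -
  assume a: "x \<in> Bv v m" "y \<in> Bv w n" "v \<noteq> w"
  have "x * y = (eps v * x) * (eps w * y)" using a by (simp only: Bv_eps)
  also have "\<dots> = (eps v * eps w) * (x * y)" by (simp only: ac_simps)
  finally show ?thesis using eps_orth[OF a(3)] by simp
qed

lemma u_inv: "u i j * u (- i) (- j) = 1" "u (- i) (- j) * u i j = 1"
  by (simp_all add: u_add u_zero)

lemma u_B: "u i j \<in> B (nat (\<bar>i\<bar> + \<bar>j\<bar>))"
proof -
  have "eps v * u i j \<in> Bv v (\<bar>i\<bar> + \<bar>j\<bar>)" for v
  proof -
    have "0 - pval v i j \<le> \<bar>i\<bar> + \<bar>j\<bar>" by (cases v) auto
    from subsetD[OF Bv_mono[OF this] u_shift[OF eps_Bv]] show ?thesis by (simp add: mult.commute)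
  qed
  then show ?thesis by (simp add: B_def)
qed

definition chi :: "root \<Rightarrow> (coord \<Rightarrow> int) \<Rightarrow> 'r" where
  "chi \<alpha> E = u (wA \<alpha> * E A1 + wB \<alpha> * E B1) (wA \<alpha> * E A2 + wB \<alpha> * E B2)"

definition tor :: "(coord \<Rightarrow> int) \<Rightarrow> 'r ut" where
  "tor E = UT (u (E A1) (E A2)) (u (- E A1) (- E A2)) (u (E B1) (E B2)) (u (- E B1) (- E B2))
     0 0 0 0 0 0"

lemma chi_add: "chi \<alpha> (E + F) = chi \<alpha> E * chi \<alpha> F"
  by (simp add: chi_def u_add algebra_simps)

lemma chi_zero: "chi \<alpha> 0 = 1" by (simp add: chi_def u_zero)

lemma chi_minus: "chi \<alpha> E * chi \<alpha> (- E) = 1" "chi \<alpha> (- E) * chi \<alpha> E = 1"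
  by (simp_all add: chi_zero flip: chi_add)

lemma chi_shift: "x \<in> Bv v n \<Longrightarrow> chi \<alpha> E * x \<in> Bv v (n - wt v \<alpha> E)"
  unfolding chi_def wt_def by (rule u_shift)

text \<open>The inverse of the \<open>n\<close>-th power of an expanding torus element lowers the pole order by at least \<open>n\<close>.\<close>

lemma expand_shift:
  assumes x: "x \<in> Bv v m" and D: "wt v \<alpha> D \<le> -1"
  shows "chi \<alpha> (- scale (int n) D) * x \<in> Bv v (m - int n)"
proof -
  have "int n * wt v \<alpha> D \<le> int n * (-1)" using D by (intro mult_left_mono) auto
  then have "m - wt v \<alpha> (- scale (int n) D) \<le> m - int n" by (simp add: wt_minus wt_scale)
  then show ?thesis using chi_shift[OF x] Bv_mono by blast
qed

lemma expand_contract: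
  "x \<in> Bv v (int n) \<Longrightarrow> wt v \<alpha> D \<le> -1 \<Longrightarrow> chi \<alpha> (- scale (int n) D) * x \<in> Bv v 0"
  using expand_shift[of x v "int n" \<alpha> D n] by simp

lemma tor_add: "tor (E + F) = tor E * tor F"
  by (rule ut_eqI) (simp_all add: tor_def u_add algebra_simps)

lemma tor_zero: "tor 0 = 1" by (simp add: tor_def u_zero one_ut_def)

lemma diagonal_tor: "diagonal (tor E)" by (simp add: diagonal_def tor_def u_inv)

lemma chD_tor: "chD \<alpha> (tor E) = chi \<alpha> E"
  by (cases \<alpha>) (simp_all add: tor_def chi_def u_add)

definition const_diag :: "'r ut set" where
  "const_diag = {D. diagonal D \<and> dA D \<in> c0 \<and> dA' D \<in> c0 \<and> dB D \<in> c0 \<and> dB' D \<in> c0}"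

definition units :: "'r set" where "units = {c * u i j | c i j. c \<in> c0}"

definition G :: "'r ut set" where
  "G = {g. dA g \<in> units \<and> dB g \<in> units \<and> dA g * dA' g = 1 \<and> dB g * dB' g = 1}"

text \<open>Since the fields of a matrix include the inverses of its diagonal entries, \<open>Sz 0\<close> is a group, and
  \<open>texp_bound\<close> bounds the exponents of the diagonal part.\<close>

definition Sz :: "nat \<Rightarrow> 'r ut set" where
  "Sz n = {g \<in> G. dA g \<in> B n \<and> dA' g \<in> B n \<and> dB g \<in> B n \<and> dB' g \<in> B n \<and> m12 g \<in> B n \<and>
     m13 g \<in> B n \<and> m14 g \<in> B n \<and> m23 g \<in> B n \<and> m24 g \<in> B n \<and> m34 g \<in> B n}"

lemma units_mult: "x \<in> units \<Longrightarrow> y \<in> units \<Longrightarrow> x * y \<in> units"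
proof -
  assume "x \<in> units" "y \<in> units"
  then obtain c i j d i' j' where "x = c * u i j" "c \<in> c0" "y = d * u i' j'" "d \<in> c0"
    by (auto simp: units_def)
  then have "x * y = (c * d) * u (i + i') (j + j')" "c * d \<in> c0"
    by (simp_all add: c0_mult ac_simps flip: u_add)
  then show ?thesis unfolding units_def by blast
qed

lemma units_inv: "x \<in> units \<Longrightarrow> x * y = 1 \<Longrightarrow> y \<in> units"
proof -
  assume "x \<in> units" and xy: "x * y = 1"
  then obtain c i j where x: "x = c * u i j" "c \<in> c0" by (auto simp: units_def)
  obtain d where d: "d \<in> c0" "c * d = 1" using c0_inv x(2) by blast
  have "y = (c * d) * (u i j * u (-i) (-j)) * y" by (simp add: d u_inv)
  also have "\<dots> = (x * y) * (d * u (-i) (-j))" by (simp only: x ac_simps)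
  finally have "y = d * u (-i) (-j)" using xy by simp
  then show ?thesis using d unfolding units_def by blast
qed

lemma units_u: "u i j \<in> units" unfolding units_def using c0_one by (metis (mono_tags, lifting) mem_Collect_eq mult_1)

lemma units_c0: "c \<in> c0 \<Longrightarrow> c \<in> units"
  unfolding units_def using u_zero by (metis (mono_tags, lifting) mem_Collect_eq mult_1_right)

lemma G_mult: "g \<in> G \<Longrightarrow> h \<in> G \<Longrightarrow> g * h \<in> G"
proof -
  have *: "a * b * (c * d) = 1" if "a * c = 1" "b * d = 1" for a b c d :: 'r
    using that by (metis mult.commute mult.left_commute mult_1)
  show "g \<in> G \<Longrightarrow> h \<in> G \<Longrightarrow> g * h \<in> G"
    by (simp add: G_def units_mult *)
qed

lemma G_one: "1 \<in> G"
  using units_c0[OF c0_one] by (simp add: G_def)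

lemma G_inv: "g \<in> G \<Longrightarrow> uinv g \<in> G" "g \<in> G \<Longrightarrow> uinv g * g = 1" "g \<in> G \<Longrightarrow> g * uinv g = 1"
  using units_inv[of "dA g" "dA' g"] units_inv[of "dB g" "dB' g"]
  by (auto simp: G_def uinv_left uinv_right) (auto simp: uinv_def Let_def mult.commute)

lemma tor_G: "tor E \<in> G" by (simp add: G_def tor_def units_u u_inv)

lemma el_G: "el \<alpha> x \<in> G" using units_c0[OF c0_one] by (cases \<alpha>) (simp_all add: G_def)

lemma const_diag_G: "D \<in> const_diag \<Longrightarrow> D \<in> G" by (simp add: const_diag_def G_def diagonal_def units_c0)

lemma Sz_G: "g \<in> Sz n \<Longrightarrow> g \<in> G" by (simp add: Sz_def)

lemma Sz_mono: "m \<le> n \<Longrightarrow> Sz m \<subseteq> Sz n"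
  unfolding Sz_def using B_mono by blast

lemma Sz_mult: "g \<in> Sz m \<Longrightarrow> h \<in> Sz n \<Longrightarrow> g * h \<in> Sz (m + n)"
proof -
  assume g: "g \<in> Sz m" and h: "h \<in> Sz n"
  have m: "x \<in> B m \<Longrightarrow> x \<in> B (m + n)" and n: "x \<in> B n \<Longrightarrow> x \<in> B (m + n)" for x
    using B_mono[of m "m + n"] B_mono[of n "m + n"] by auto
  show ?thesis
    using g h unfolding Sz_def by (auto simp: G_mult intro!: B_add B_mult intro: m n)
qed

lemma Sz_one: "1 \<in> Sz n" by (simp add: Sz_def G_one B_one B_zero)

lemma Sz_inv: "g \<in> Sz 0 \<Longrightarrow> uinv g \<in> Sz 0"
proof -
  assume g: "g \<in> Sz 0"
  have m: "x \<in> B 0 \<Longrightarrow> y \<in> B 0 \<Longrightarrow> x * y \<in> B 0" for x y using B_mult[of x 0 y 0] by simp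
  have d: "x \<in> B 0 \<Longrightarrow> y \<in> B 0 \<Longrightarrow> x - y \<in> B 0" for x y
    using B_add[OF _ B_minus, of x 0 y] by simp
  have "uinv g \<in> G" using g G_inv(1) Sz_G by blast
  then show ?thesis
    using g unfolding Sz_def
    by (simp add: uinv_def Let_def B_add B_minus m d)
qed

lemma el_Sz: "x \<in> Bv v (int n) \<Longrightarrow> el \<alpha> x \<in> Sz n"
  using Bv_B[of x v n] el_G[of \<alpha> x] by (cases \<alpha>) (simp_all add: Sz_def B_zero B_one)

lemma tor_unit_Sz: "tor (scale m (unit_exp a)) \<in> Sz (nat \<bar>m\<bar>)"
proof -
  have "u m 0 \<in> B (nat \<bar>m\<bar>)" "u (-m) 0 \<in> B (nat \<bar>m\<bar>)" "u 0 m \<in> B (nat \<bar>m\<bar>)"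
    "u 0 (-m) \<in> B (nat \<bar>m\<bar>)"
    using u_B[of m 0] u_B[of "-m" 0] u_B[of 0 m] u_B[of 0 "-m"] by simp_all
  then show ?thesis
    using tor_G[of "scale m (unit_exp a)"]
    by (cases a) (simp_all add: Sz_def tor_def scale_def unit_exp_def B_zero B_one u_zero)
qed

lemma const_diag_Sz: "D \<in> const_diag \<Longrightarrow> D \<in> Sz 0"
  using const_diag_G[of D] c0_Bv by (auto simp: Sz_def const_diag_def B_def diagonal_def Bv_zero)

lemma const_diag_mult: "D \<in> const_diag \<Longrightarrow> D' \<in> const_diag \<Longrightarrow> D * D' \<in> const_diag"
  using const_diag_G[of D] const_diag_G[of D'] G_mult[of D D'] by (simp add: const_diag_def diagonal_def c0_mult G_def)

lemma tor_const_commute: "D \<in> const_diag \<Longrightarrow> tor E * D = D * tor E"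
  by (rule ut_eqI) (simp_all add: const_diag_def diagonal_def tor_def mult.commute)

text \<open>The quotient of two representations has no pole and no zero at any place, so its exponents vanish.\<close>

lemma units_unique:
  assumes "c * u i j = d * u k l" "c \<in> c0" "d \<in> c0"
  shows "c = d \<and> i = k \<and> j = l"
proof -
  have *: "- pval v (i - k) (j - l) \<le> 0" if "c * u i j = d * u k l" "c \<in> c0" "d \<in> c0"
    for v c d i j k l
  proof -
    have "c * u (i - k) (j - l) = c * u i j * u (- k) (- l)"
      by (simp add: mult.assoc u_add)
    also have "\<dots> = d" using that by (simp add: mult.assoc u_inv)
    finally have "eps v * (c * u (i - k) (j - l)) \<in> Bv v 0" using c0_Bv that by simp
    then show ?thesis using u_ord that by blast
  qed
  have "i = k" "j = l"
    using *[OF assms, of P0] *[OF assms, of P1] *[OF assms(1)[symmetric] assms(3,2), of P0]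
      *[OF assms(1)[symmetric] assms(3,2), of P1] by auto
  moreover have "c = c * (u i j * u (-i) (-j))" "d = d * (u i j * u (-i) (-j))" by (simp_all add: u_inv)
  ultimately show ?thesis using assms(1) by (metis mult.assoc)
qed

lemma dpart_exists:
  assumes "g \<in> G"
  shows "\<exists>E D. D \<in> const_diag \<and> dpart g = tor E * D"
proof -
  obtain c i j d k l where cd: "dA g = c * u i j" "c \<in> c0" "dB g = d * u k l" "d \<in> c0"
    using assms by (auto simp: G_def units_def)
  obtain c' d' where cd': "c' \<in> c0" "c * c' = 1" "d' \<in> c0" "d * d' = 1"
    using c0_inv cd(2,4) by blast
  define E where "E x = (case x of A1 \<Rightarrow> i | A2 \<Rightarrow> j | B1 \<Rightarrow> k | B2 \<Rightarrow> l)" for x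
  define D where "D = UT c c' d d' 0 0 0 0 0 0"
  have D: "D \<in> const_diag" using cd cd' by (simp add: D_def const_diag_def diagonal_def)
  have g: "dA g * dA' g = 1" "dB g * dB' g = 1" using assms by (auto simp: G_def)
  have "dA' g = (c * u i j) * dA' g * (u (-i) (-j) * c')"
    using cd' u_inv[of i j] by (metis mult.commute mult.left_commute mult_1)
  then have "dA' g = u (-i) (-j) * c'" using g cd by simp
  moreover have "dB' g = (d * u k l) * dB' g * (u (-k) (-l) * d')"
    using cd' u_inv[of k l] by (metis mult.commute mult.left_commute mult_1)
  then have "dB' g = u (-k) (-l) * d'" using g cd by simp
  ultimately have "dpart g = tor E * D"
    by (intro ut_eqI) (simp_all add: dpart_def D_def tor_def E_def cd mult.commute)
  then show ?thesis using D by blast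
qed

text \<open>The exponents of the torus part and the constant part of a matrix; both are unique by
  \<open>tor_const_unique\<close>.\<close>

definition texp :: "'r ut \<Rightarrow> coord \<Rightarrow> int" where
  "texp g = (SOME E. \<exists>D. D \<in> const_diag \<and> dpart g = tor E * D)"

definition tconst :: "'r ut \<Rightarrow> 'r ut" where
  "tconst g = (SOME D. D \<in> const_diag \<and> dpart g = tor (texp g) * D)"

lemma texp_tconst: assumes "g \<in> G" shows "tconst g \<in> const_diag" "dpart g = tor (texp g) * tconst g"
proof -
  have "\<exists>D. D \<in> const_diag \<and> dpart g = tor (texp g) * D"
    unfolding texp_def
    by (rule someI_ex[where P = "\<lambda>E. \<exists>D. D \<in> const_diag \<and> dpart g = tor E * D"]) (rule dpart_exists[OF assms])
  then have "tconst g \<in> const_diag \<and> dpart g = tor (texp g) * tconst g"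
    unfolding tconst_def by (rule someI_ex)
  then show "tconst g \<in> const_diag" "dpart g = tor (texp g) * tconst g" by auto
qed

lemma tor_const_unique:
  assumes "tor E * D = tor F * D'" "D \<in> const_diag" "D' \<in> const_diag"
  shows "E = F \<and> D = D'"
proof -
  have "dA D * u (E A1) (E A2) = dA D' * u (F A1) (F A2)"
    "dB D * u (E B1) (E B2) = dB D' * u (F B1) (F B2)"
    using arg_cong[OF assms(1), of dA] arg_cong[OF assms(1), of dB]
    by (simp_all add: tor_def mult.commute)
  from this[THEN units_unique] assms(2,3)
  have "E A1 = F A1" "E A2 = F A2" "E B1 = F B1" "E B2 = F B2"
    unfolding const_diag_def by simp_all
  then have EF: "E = F" using coord.exhaust by (intro ext) (metis)
  moreover have "D = D'"
  proof -
    have "tor (- E) * (tor E * D) = tor (- E) * (tor E * D')" using assms EF by simp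
    then show ?thesis by (simp flip: mult.assoc tor_add add: tor_zero)
  qed
  ultimately show ?thesis by simp
qed

lemma texp_tconst_unique:
  assumes "g \<in> G" "dpart g = tor E * D" "D \<in> const_diag"
  shows "texp g = E" "tconst g = D"
  using tor_const_unique[of "texp g" "tconst g" E D] texp_tconst[OF assms(1)] assms by auto

lemma dpart_mult: "dpart (g * h) = dpart g * dpart h"
  by (rule ut_eqI) (simp_all add: dpart_def)

lemma texp_tconst_mult:
  assumes "g \<in> G" "h \<in> G"
  shows "texp (g * h) = texp g + texp h" "tconst (g * h) = tconst g * tconst h"
proof -
  have "dpart (g * h) = tor (texp g) * (tconst g * tor (texp h)) * tconst h"
    using assms by (simp add: dpart_mult texp_tconst mult.assoc)
  also have "\<dots> = tor (texp g + texp h) * (tconst g * tconst h)"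
    by (simp only: tor_const_commute[OF texp_tconst(1)[OF assms(1)], symmetric] mult.assoc tor_add)
  finally show "texp (g * h) = texp g + texp h" "tconst (g * h) = tconst g * tconst h"
    using texp_tconst_unique[OF G_mult[OF assms]] const_diag_mult texp_tconst(1) assms by blast+
qed

lemma texp_bound:
  assumes g: "g \<in> Sz n"
  shows "\<bar>texp g a\<bar> \<le> int n"
proof -
  have gG: "g \<in> G" using g by (rule Sz_G)
  note e = texp_tconst[OF gG]
  have k: "dA (tconst g) \<in> c0" "dA' (tconst g) \<in> c0" "dB (tconst g) \<in> c0" "dB' (tconst g) \<in> c0"
    using e(1) by (auto simp: const_diag_def)
  have d: "dA g = dA (tconst g) * u (texp g A1) (texp g A2)" "dA' g = dA' (tconst g) * u (- texp g A1) (- texp g A2)"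
    "dB g = dB (tconst g) * u (texp g B1) (texp g B2)" "dB' g = dB' (tconst g) * u (- texp g B1) (- texp g B2)"
    using arg_cong[OF e(2), of dA] arg_cong[OF e(2), of "dA'"] arg_cong[OF e(2), of dB]
      arg_cong[OF e(2), of "dB'"]
    by (simp_all add: dpart_def tor_def mult.commute)
  have b: "eps v * dA g \<in> Bv v (int n)" "eps v * dA' g \<in> Bv v (int n)" "eps v * dB g \<in> Bv v (int n)"
    "eps v * dB' g \<in> Bv v (int n)" for v using g by (auto simp: Sz_def B_def)
  note b' = b[unfolded d]
  have "- pval v (texp g A1) (texp g A2) \<le> int n" "- pval v (- texp g A1) (- texp g A2) \<le> int n"
    "- pval v (texp g B1) (texp g B2) \<le> int n" "- pval v (- texp g B1) (- texp g B2) \<le> int n" for v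
    using u_ord[OF k(1) b'(1)] u_ord[OF k(2) b'(2)] u_ord[OF k(3) b'(3)] u_ord[OF k(4) b'(4)]
    by auto
  from this[of P0] this[of P1] show ?thesis by (cases a) auto
qed

end

section \<open>Words for the elements of the big group\<close>

text \<open>A map \<open>\<sigma>\<close> on the letters \<open>Sz L\<close> that respects triangles up to the cost \<open>M\<close>. The group \<open>W\<close> plays the
  role of the free group on the letters.\<close>

locale cover = places eps Bv u c0 + conj_norm W N
  for eps :: "place \<Rightarrow> 'r::comm_ring_1" and Bv u c0 and W (structure) and N :: "nat \<Rightarrow> 'a set" +
  fixes \<sigma> :: "'r ut \<Rightarrow> 'a" and L M :: nat
  assumes sig_closed: "\<sigma> s \<in> carrier W"
    and L_ge: "2 \<le> L"
    and sig_mult: "s \<in> Sz L \<Longrightarrow> t \<in> Sz L \<Longrightarrow> s * t \<in> Sz L \<Longrightarrow> near M (\<sigma> s \<otimes> \<sigma> t) (\<sigma> (s * t))"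
begin

definition X :: "coord \<Rightarrow> 'a" where "X a = \<sigma> (tor (unit_exp a))"

definition torus_word :: "(coord \<Rightarrow> int) \<Rightarrow> 'a" where
  "torus_word E = X A1 [^] E A1 \<otimes> (X A2 [^] E A2 \<otimes> (X B1 [^] E B1 \<otimes> X B2 [^] E B2))"

definition pole_order :: "place \<Rightarrow> 'r \<Rightarrow> nat" where
  "pole_order v x = (LEAST n. x \<in> Bv v (int n))"

text \<open>The torus word contracts \<open>x\<close> to a letter. It is as long as the pole order of \<open>x\<close>.\<close>

definition root_word :: "root \<Rightarrow> place \<Rightarrow> 'r \<Rightarrow> 'a" where
  "root_word \<alpha> v x = (let E = scale (int (pole_order v x)) (dir \<alpha> v)
     in torus_word E \<otimes> \<sigma> (el \<alpha> (chi \<alpha> (- E) * x)) \<otimes> inv (torus_word E))"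

definition place_word :: "place \<Rightarrow> 'r ut \<Rightarrow> 'a" where
  "place_word v w = root_word R34 v (eps v * m34 w) \<otimes> (root_word R23 v (eps v * m23 w) \<otimes> (root_word R24 v (eps v * m24 w) \<otimes>
     (root_word R12 v (eps v * m12 w) \<otimes> (root_word R13 v (eps v * m13 w) \<otimes>
       comm (root_word R12 v (eps v * m14 w)) (root_word R24 v (eps v))))))"

definition nf_word :: "'r ut \<Rightarrow> 'a" where
  "nf_word g = place_word P0 (upart g) \<otimes> (place_word P1 (upart g) \<otimes> place_word PI (upart g)) \<otimes>
     (torus_word (texp g) \<otimes> \<sigma> (tconst g))"

lemma X_closed [simp]: "X a \<in> carrier W" by (simp add: X_def sig_closed)

lemma torus_word_closed [simp]: "torus_word E \<in> carrier W" by (simp add: torus_word_def)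

lemma root_word_closed [simp]: "root_word \<alpha> v x \<in> carrier W" by (simp add: root_word_def Let_def sig_closed)

lemma place_word_closed [simp]: "place_word v w \<in> carrier W" by (simp add: place_word_def comm_closed)

lemma nf_word_closed [simp]: "nf_word g \<in> carrier W" by (simp add: nf_word_def sig_closed)

lemma Sz_le: "s \<in> Sz m \<Longrightarrow> m \<le> n \<Longrightarrow> s \<in> Sz n"
  using Sz_mono by blast

lemma el_Sz0: "x \<in> Bv v 0 \<Longrightarrow> el \<alpha> x \<in> Sz n"
  using Sz_le[OF el_Sz[of x v 0]] by simp

lemma sig_swap:
  assumes "s \<in> Sz 1" "t \<in> Sz 1" "s' \<in> Sz 1" "t' \<in> Sz 1" "s * t = s' * t'"
  shows "near (2 * M) (\<sigma> s \<otimes> \<sigma> t) (\<sigma> s' \<otimes> \<sigma> t')"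
proof -
  have l: "x \<in> Sz L" if "x \<in> Sz 1" for x using Sz_le[OF that] L_ge by simp
  have "s * t \<in> Sz L" using Sz_le[OF Sz_mult[OF assms(1,2)]] L_ge by simp
  then have "near (M + M) (\<sigma> s \<otimes> \<sigma> t) (\<sigma> s' \<otimes> \<sigma> t')"
    using assms by (intro near_trans[OF sig_mult near_sym[OF sig_mult, of s' t', folded assms(5)]])
      (auto simp: l)
  then show ?thesis by (simp add: mult_2)
qed

lemma unit_exp_scale: "unit_exp a = scale 1 (unit_exp a)"
  by (simp add: scale_def fun_eq_iff)

lemma tor_unit_Sz1: "tor (unit_exp a) \<in> Sz 1"
  using tor_unit_Sz[of 1 a] by (simp flip: unit_exp_scale)

lemma tor_commute: "tor E * tor F = tor F * tor E"
  by (simp add: add.commute flip: tor_add)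

lemma X_commute: "near (2 * M) (X a \<otimes> X b) (X b \<otimes> X a)"
  unfolding X_def by (intro sig_swap tor_unit_Sz1 tor_commute)

lemma X_sig_el:
  assumes "y \<in> Bv v 0" "chi \<alpha> (unit_exp a) * y \<in> Bv v 0"
  shows "near (2 * M) (X a \<otimes> \<sigma> (el \<alpha> y)) (\<sigma> (el \<alpha> (chi \<alpha> (unit_exp a) * y)) \<otimes> X a)"
  unfolding X_def
  by (intro sig_swap tor_unit_Sz1)
     (use assms in \<open>auto simp: diagonal_el[OF diagonal_tor] chD_tor intro: el_Sz0\<close>)

lemma X_const: "D \<in> const_diag \<Longrightarrow> near (2 * M) (X a \<otimes> \<sigma> D) (\<sigma> D \<otimes> X a)"
  unfolding X_def by (intro sig_swap tor_unit_Sz1 tor_const_commute) (auto intro: Sz_le[OF const_diag_Sz])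

lemma scale_add: "scale (m + n) E = scale m E + scale n E"
  by (simp add: scale_def fun_eq_iff distrib_right)

lemma scale_simps [simp]: "scale 0 E = 0" "scale 1 E = E" "scale (- m) E = - scale m E"
  by (simp_all add: scale_def fun_eq_iff)

text \<open>Valuations are linear along a line in the torus, so the path stays among the letters if both of
  its ends do.\<close>

lemma chi_scale_between:
  assumes "y \<in> Bv v 0" "chi \<alpha> (scale m E) * y \<in> Bv v 0" "(0 \<le> k \<and> k \<le> m) \<or> (m \<le> k \<and> k \<le> 0)"
  shows "chi \<alpha> (scale k E) * y \<in> Bv v 0"
proof -
  have *: "chi \<alpha> (scale k E) * y = chi \<alpha> (scale (k - m) E) * (chi \<alpha> (scale m E) * y)"
    using scale_add[of "k - m" m E] by (simp flip: mult.assoc chi_add)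
  have 1: "chi \<alpha> (scale k E) * y \<in> Bv v (0 - k * wt v \<alpha> E)"
    using chi_shift[OF assms(1), of \<alpha> "scale k E"] by (simp add: wt_scale)
  have 2: "chi \<alpha> (scale k E) * y \<in> Bv v (0 - (k - m) * wt v \<alpha> E)"
    unfolding * using chi_shift[OF assms(2), of \<alpha> "scale (k - m) E"] by (simp only: wt_scale)
  have "0 - k * wt v \<alpha> E \<le> 0 \<or> 0 - (k - m) * wt v \<alpha> E \<le> 0"
    using assms(3) by (cases "wt v \<alpha> E \<ge> 0") (auto simp: mult_nonneg_nonneg mult_nonpos_nonpos)
  then show ?thesis using 1 2 Bv_mono by blast
qed

lemma X_push:
  assumes "y \<in> Bv v 0" "chi \<alpha> (scale m (unit_exp a)) * y \<in> Bv v 0"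
  shows "near (nat \<bar>m\<bar> * (2 * M)) (X a [^] m \<otimes> \<sigma> (el \<alpha> y))
           (\<sigma> (el \<alpha> (chi \<alpha> (scale m (unit_exp a)) * y)) \<otimes> X a [^] m)"
proof -
  define z where "z k = \<sigma> (el \<alpha> (chi \<alpha> (scale k (unit_exp a)) * y))" for k
  have "near (nat \<bar>m\<bar> * (2 * M)) (X a [^] m \<otimes> z 0) (z m \<otimes> X a [^] m)"
  proof (rule push_int)
    fix k assume k: "(0 \<le> k \<and> k < m) \<or> (m \<le> k \<and> k < 0)"
    have e: "chi \<alpha> (scale (k + 1) (unit_exp a)) * y
        = chi \<alpha> (unit_exp a) * (chi \<alpha> (scale k (unit_exp a)) * y)"
      by (simp add: scale_add chi_add ac_simps)
    show "near (2 * M) (X a \<otimes> z k) (z (k + 1) \<otimes> X a)"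
      unfolding z_def e
    proof (rule X_sig_el)
      show "chi \<alpha> (scale k (unit_exp a)) * y \<in> Bv v 0"
        by (rule chi_scale_between[OF assms]) (use k in auto)
      show "chi \<alpha> (unit_exp a) * (chi \<alpha> (scale k (unit_exp a)) * y) \<in> Bv v 0"
        unfolding e[symmetric] by (rule chi_scale_between[OF assms]) (use k in auto)
    qed
  qed (auto simp: z_def sig_closed)
  then show ?thesis by (simp add: z_def chi_zero)
qed

lemma sig_one: "near M (\<sigma> 1) \<one>"
proof -
  have "near M (\<sigma> 1 \<otimes> \<sigma> 1) (\<sigma> (1 * 1))" by (rule sig_mult) (simp_all add: Sz_one)
  then have "near M (\<sigma> 1 \<otimes> \<sigma> 1 \<otimes> inv (\<sigma> 1)) (\<sigma> 1 \<otimes> inv (\<sigma> 1))"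
    by (intro near_multR) (simp_all add: sig_closed)
  then show ?thesis by (simp add: sig_closed m_assoc)
qed

lemma inv_X: "near (2 * M) (inv (X a)) (\<sigma> (tor (- unit_exp a)))"
proof -
  have s: "tor (- unit_exp a) \<in> Sz 1"
    using tor_unit_Sz[of "-1" a] by simp
  have "near M (X a \<otimes> \<sigma> (tor (- unit_exp a))) (\<sigma> (tor (unit_exp a) * tor (- unit_exp a)))"
    unfolding X_def
    by (intro sig_mult Sz_le[OF tor_unit_Sz1] Sz_le[OF s] Sz_le[OF Sz_mult[OF tor_unit_Sz1 s]])
       (use L_ge in auto)
  then have "near (M + M) (X a \<otimes> \<sigma> (tor (- unit_exp a))) \<one>"
    using near_trans sig_one by (simp add: tor_zero flip: tor_add)
  then have "near (2 * M) (inv (X a) \<otimes> (X a \<otimes> \<sigma> (tor (- unit_exp a)))) (inv (X a) \<otimes> \<one>)"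
    by (intro near_multL) (simp_all add: mult_2)
  then show ?thesis using near_sym by (simp add: sig_closed inv_cancel_left)
qed

text \<open>Bounded powers are products of boundedly many letters and cost only a constant.\<close>

lemma X_power:
  assumes "\<bar>m\<bar> \<le> int L"
  shows "near (Suc (nat \<bar>m\<bar>) * (3 * M)) (X a [^] m) (\<sigma> (tor (scale m (unit_exp a))))"
  using assms
proof (induction m rule: int_induct[where k = 0])
  case base
  have "tor (scale 0 (unit_exp a)) = 1" by (simp only: scale_simps tor_zero)
  then show ?case
    unfolding int_pow_0 by (simp only:) (rule near_mono[OF near_sym[OF sig_one]], simp)
next
  have step: "near (k * (3 * M) + 3 * M) (X a [^] m \<otimes> X') (\<sigma> (tor (scale (m + s) (unit_exp a))))"
    if "near (k * (3 * M)) (X a [^] m) (\<sigma> (tor (scale m (unit_exp a))))"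
      "near (2 * M) X' (\<sigma> (tor (scale s (unit_exp a))))" "\<bar>s\<bar> \<le> int L"
      "\<bar>m\<bar> \<le> int L" "\<bar>m + s\<bar> \<le> int L" for k m s X'
  proof -
    have szL: "tor (scale k (unit_exp a)) \<in> Sz L" if "\<bar>k\<bar> \<le> int L" for k
      by (rule Sz_le[OF tor_unit_Sz]) (use that in auto)
    have "near M (\<sigma> (tor (scale m (unit_exp a))) \<otimes> \<sigma> (tor (scale s (unit_exp a))))
       (\<sigma> (tor (scale (m + s) (unit_exp a))))"
      unfolding scale_add tor_add using szL that sig_mult by (metis scale_add tor_add)
    from near_trans[OF near_mult[OF that(1,2)] this] show ?thesis
      by (rule near_mono) simp
  qed
  {
    case (step1 m)
    have "near (2 * M) (X a) (\<sigma> (tor (scale 1 (unit_exp a))))" by (simp add: X_def near_refl sig_closed)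
    then have "near (Suc (nat \<bar>m\<bar>) * (3 * M) + 3 * M) (X a [^] m \<otimes> X a) (\<sigma> (tor (scale (m + 1) (unit_exp a))))"
      using step1 L_ge by (intro step) auto
    moreover have "X a [^] (m + 1) = X a [^] m \<otimes> X a"
      by (simp add: int_pow_mult int_pow_1)
    moreover have "Suc (nat \<bar>m + 1\<bar>) * (3 * M) = Suc (nat \<bar>m\<bar>) * (3 * M) + 3 * M"
      using step1(1) by (simp add: nat_add_distrib)
    ultimately show ?case by simp
  next
    case (step2 m)
    have "near (2 * M) (inv (X a)) (\<sigma> (tor (scale (-1) (unit_exp a))))" using inv_X by simp
    then have "near (Suc (nat \<bar>m\<bar>) * (3 * M) + 3 * M) (X a [^] m \<otimes> inv (X a))
        (\<sigma> (tor (scale (m + -1) (unit_exp a))))"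
      using step2 L_ge by (intro step) auto
    moreover have "X a [^] (m - 1) = X a [^] m \<otimes> inv (X a)"
      using int_pow_mult[of "X a" m "-1"] by (simp add: int_pow_neg int_pow_1)
    moreover have "Suc (nat \<bar>m - 1\<bar>) * (3 * M) = Suc (nat \<bar>m\<bar>) * (3 * M) + 3 * M"
    proof -
      have "nat \<bar>m - 1\<bar> = Suc (nat \<bar>m\<bar>)" using step2(1) by simp
      then show ?thesis by (simp only: mult_Suc)
    qed
    ultimately show ?case by simp
  }
qed

end

section \<open>The asymptotic group of words\<close>

locale abels_asym = cover eps Bv u c0 W N \<sigma> L M + asymptotic W N nn
  for eps :: "place \<Rightarrow> 'r::comm_ring_1" and Bv u c0 and W (structure) and N :: "nat \<Rightarrow> 'a set"
    and \<sigma> L M and nn :: "'i \<Rightarrow> nat"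
begin

abbreviation qmult (infixl "\<odot>" 70) where "x \<odot> y \<equiv> x \<otimes>\<^bsub>Q\<^esub> y"

definition Exps :: "('i \<Rightarrow> coord \<Rightarrow> int) set" where
  "Exps = {E. \<exists>c::nat. \<forall>i a. \<bar>E i a\<bar> \<le> int (c * nn i)}"

definition KK :: "place \<Rightarrow> ('i \<Rightarrow> 'r) set" where
  "KK v = {x. \<exists>c::nat. \<forall>i. x i \<in> Bv v (int (c * nn i))}"

definition letter_cl :: "('i \<Rightarrow> 'r ut) \<Rightarrow> ('i \<Rightarrow> 'a) set" where
  "letter_cl s = cl (\<lambda>i. \<sigma> (s i))"

definition coord_cl :: "coord \<Rightarrow> ('i \<Rightarrow> int) \<Rightarrow> ('i \<Rightarrow> 'a) set" where
  "coord_cl a f = cl (\<lambda>i. X a [^] f i)"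

definition torus_cl :: "('i \<Rightarrow> coord \<Rightarrow> int) \<Rightarrow> ('i \<Rightarrow> 'a) set" where
  "torus_cl E = cl (\<lambda>i. torus_word (E i))"

definition root_cl :: "place \<Rightarrow> root \<Rightarrow> ('i \<Rightarrow> 'r) \<Rightarrow> ('i \<Rightarrow> 'a) set" where
  "root_cl v \<alpha> x = cl (\<lambda>i. root_word \<alpha> v (x i))"

sublocale Q: group Q by (rule group_Q)

lemma letter_cl_closed [simp]: "letter_cl s \<in> carrier Q" by (simp add: letter_cl_def sig_closed)
lemma coord_cl_closed [simp]: "coord_cl a f \<in> carrier Q" by (simp add: coord_cl_def)
lemma torus_cl_closed [simp]: "torus_cl E \<in> carrier Q" by (simp add: torus_cl_def)
lemma root_cl_closed [simp]: "root_cl v \<alpha> x \<in> carrier Q" by (simp add: root_cl_def)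

lemma Exps_add: "E \<in> Exps \<Longrightarrow> F \<in> Exps \<Longrightarrow> E + F \<in> Exps"
proof -
  assume "E \<in> Exps" "F \<in> Exps"
  then obtain c d where "\<bar>E i a\<bar> \<le> int (c * nn i)" "\<bar>F i a\<bar> \<le> int (d * nn i)" for i a
    unfolding Exps_def by blast
  then have "\<bar>E i a\<bar> + \<bar>F i a\<bar> \<le> int ((c + d) * nn i)" for i a
    unfolding add_mult_distrib of_nat_add by (intro add_mono)
  then have "\<bar>(E + F) i a\<bar> \<le> int ((c + d) * nn i)" for i a
    using abs_triangle_ineq[of "E i a" "F i a"] by (simp only: plus_fun_apply) (meson order_trans)
  then show ?thesis unfolding Exps_def by blast
qed

lemma Exps_minus: "E \<in> Exps \<Longrightarrow> - E \<in> Exps" by (simp add: Exps_def)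

lemma Exps_scale: "(\<lambda>i. scale (int (c * nn i)) E) \<in> Exps"
proof -
  define m where "m = Max (range (\<lambda>a. nat \<bar>E a\<bar>))"
  have "finite (UNIV :: coord set)"
  proof -
    have "(UNIV :: coord set) = {A1, A2, B1, B2}" using coord.exhaust by auto
    then show ?thesis by (metis finite.emptyI finite.insertI)
  qed
  then have "nat \<bar>E a\<bar> \<le> m" for a unfolding m_def by (intro Max_ge) auto
  then have "int (c * nn i) * \<bar>E a\<bar> \<le> int (c * nn i) * int m" for i a
    by (intro mult_left_mono) (simp_all add: nat_le_iff)
  then have "\<bar>scale (int (c * nn i)) E a\<bar> \<le> int ((c * m) * nn i)" for i a
    by (simp add: scale_def abs_mult ac_simps)
  then show ?thesis unfolding Exps_def by blast
qed

lemma coord_cl_add: "coord_cl a f \<odot> coord_cl a g = coord_cl a (\<lambda>i. f i + g i)"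
  by (simp add: coord_cl_def cl_mult int_pow_mult)

lemma coord_cl_commute:
  assumes "\<And>i. \<bar>f i\<bar> \<le> int (c * nn i)" "\<And>i. \<bar>g i\<bar> \<le> int (d * nn i)"
  shows "coord_cl a f \<odot> coord_cl b g = coord_cl b g \<odot> coord_cl a f"
proof -
  have "cl (\<lambda>i. X a [^] f i \<otimes> X b [^] g i) = cl (\<lambda>i. X b [^] g i \<otimes> X a [^] f i)"
  proof (subst cl_eq_iff)
    have "near (c * d * (2 * M) * (nn i)\<^sup>2) (X a [^] f i \<otimes> X b [^] g i) (X b [^] g i \<otimes> X a [^] f i)" for i
    proof (rule near_mono[OF near_commute_pow[OF X_commute]])
      have "nat \<bar>f i\<bar> * nat \<bar>g i\<bar> * (2 * M) \<le> (c * nn i) * (d * nn i) * (2 * M)"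
        using assms[of i] by (intro mult_mono) (auto simp: nat_le_iff)
      then show "nat \<bar>f i\<bar> * (nat \<bar>g i\<bar> * (2 * M)) \<le> c * d * (2 * M) * (nn i)\<^sup>2"
        by (simp add: power2_eq_square ac_simps)
    qed simp_all
    then show "\<exists>C. \<forall>i. near (C * (nn i)\<^sup>2) (X a [^] f i \<otimes> X b [^] g i) (X b [^] g i \<otimes> X a [^] f i)"
      by blast
  qed simp_all
  then show ?thesis by (simp add: coord_cl_def cl_mult)
qed

lemma torus_cl_coord: "torus_cl E = coord_cl A1 (\<lambda>i. E i A1) \<odot> (coord_cl A2 (\<lambda>i. E i A2) \<odot> (coord_cl B1 (\<lambda>i. E i B1) \<odot> coord_cl B2 (\<lambda>i. E i B2)))"
  by (simp add: torus_cl_def coord_cl_def cl_mult torus_word_def)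

lemma torus_cl_add:
  assumes "E \<in> Exps" "F \<in> Exps"
  shows "torus_cl E \<odot> torus_cl F = torus_cl (E + F)"
proof -
  obtain c d where cd: "\<bar>E i a\<bar> \<le> int (c * nn i)" "\<bar>F i a\<bar> \<le> int (d * nn i)" for i a
    using assms unfolding Exps_def by blast
  have com: "coord_cl a (\<lambda>i. E i a) \<odot> coord_cl b (\<lambda>i. F i b) = coord_cl b (\<lambda>i. F i b) \<odot> coord_cl a (\<lambda>i. E i a)" for a b
    by (rule coord_cl_commute[OF cd])
  have com': "coord_cl a (\<lambda>i. E i a) \<odot> (coord_cl b (\<lambda>i. F i b) \<odot> w) = coord_cl b (\<lambda>i. F i b) \<odot> (coord_cl a (\<lambda>i. E i a) \<odot> w)"
    if "w \<in> carrier Q" for a b w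
    using Q.lift2[OF com] that by simp
  have add': "coord_cl a f \<odot> (coord_cl a g \<odot> w) = coord_cl a (\<lambda>i. f i + g i) \<odot> w" if "w \<in> carrier Q" for a f g w
    using that by (simp flip: Q.m_assoc add: coord_cl_add)
  show ?thesis
    unfolding torus_cl_coord
    by (simp add: Q.m_assoc com[of A2 A1] com'[of _ A2 A1] com[of B1 A1] com'[of _ B1 A1]
        com[of B2 A1] com'[of _ B2 A1] com[of B1 A2] com'[of _ B1 A2] com[of B2 A2] com'[of _ B2 A2]
        com[of B2 B1] com'[of _ B2 B1] coord_cl_add add')
qed

lemma torus_cl_zero: "torus_cl 0 = \<one>\<^bsub>Q\<^esub>"
  by (simp add: torus_cl_def torus_word_def cl_one)

lemma inv_torus_cl: "E \<in> Exps \<Longrightarrow> inv\<^bsub>Q\<^esub> (torus_cl E) = torus_cl (- E)"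
  by (rule Q.inv_equality) (simp_all add: torus_cl_add Exps_minus torus_cl_zero)

lemma torus_cl_commute: "E \<in> Exps \<Longrightarrow> F \<in> Exps \<Longrightarrow> torus_cl E \<odot> torus_cl F = torus_cl F \<odot> torus_cl E"
  by (simp add: torus_cl_add add.commute)

lemma letter_cl_mult:
  assumes "\<And>i. s i \<in> Sz L" "\<And>i. t i \<in> Sz L" "\<And>i. s i * t i \<in> Sz L"
  shows "letter_cl s \<odot> letter_cl t = letter_cl (\<lambda>i. s i * t i)"
proof -
  have "cl (\<lambda>i. \<sigma> (s i) \<otimes> \<sigma> (t i)) = cl (\<lambda>i. \<sigma> (s i * t i))"
    by (rule cl_eqI_const[OF sig_mult]) (use assms in auto)
  then show ?thesis by (simp add: letter_cl_def cl_mult sig_closed)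
qed

lemma letter_cl_mult0:
  assumes "\<And>i. s i \<in> Sz 0" "\<And>i. t i \<in> Sz 0"
  shows "letter_cl s \<odot> letter_cl t = letter_cl (\<lambda>i. s i * t i)"
  by (rule letter_cl_mult) (use assms Sz_mult[of _ 0 _ 0] Sz_le[of _ 0 L] in auto)

lemma coord_cl_tconst:
  assumes "\<And>i. D i \<in> const_diag" "\<And>i. \<bar>f i\<bar> \<le> int (c * nn i)"
  shows "coord_cl a f \<odot> letter_cl D = letter_cl D \<odot> coord_cl a f"
proof -
  have "cl (\<lambda>i. X a [^] f i \<otimes> \<sigma> (D i)) = cl (\<lambda>i. \<sigma> (D i) \<otimes> X a [^] f i)"
  proof (rule cl_eqI_linear)
    fix i
    have "near (nat \<bar>f i\<bar> * (2 * M)) (X a [^] f i \<otimes> \<sigma> (D i)) (\<sigma> (D i) \<otimes> X a [^] f i)"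
      by (rule push_int[where z = "\<lambda>_. \<sigma> (D i)"]) (simp_all add: sig_closed X_const assms)
    moreover have "nat \<bar>f i\<bar> * (2 * M) \<le> (c * nn i) * (2 * M)"
      using assms(2)[of i] by (intro mult_right_mono) (auto simp: nat_le_iff)
    ultimately show "near (c * (2 * M) * nn i) (X a [^] f i \<otimes> \<sigma> (D i)) (\<sigma> (D i) \<otimes> X a [^] f i)"
      by (elim near_mono) (simp add: ac_simps)
  qed
  then show ?thesis by (simp add: coord_cl_def letter_cl_def cl_mult sig_closed)
qed

lemma torus_cl_tconst:
  assumes "\<And>i. D i \<in> const_diag" "E \<in> Exps"
  shows "torus_cl E \<odot> letter_cl D = letter_cl D \<odot> torus_cl E"
proof -
  obtain c where "\<bar>E i a\<bar> \<le> int (c * nn i)" for i a using assms unfolding Exps_def by blast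
  then have com: "coord_cl a (\<lambda>i. E i a) \<odot> letter_cl D = letter_cl D \<odot> coord_cl a (\<lambda>i. E i a)" for a
    by (rule coord_cl_tconst[where c = c, OF assms(1)])
  show ?thesis unfolding torus_cl_coord by (simp add: Q.m_assoc com Q.lift2[OF com])
qed

lemma coord_cl_push:
  assumes "\<And>i. y i \<in> Bv v 0" "\<And>i. chi \<alpha> (scale (f i) (unit_exp a)) * y i \<in> Bv v 0"
    and "\<And>i. \<bar>f i\<bar> \<le> int (c * nn i)"
  shows "coord_cl a f \<odot> letter_cl (\<lambda>i. el \<alpha> (y i)) = letter_cl (\<lambda>i. el \<alpha> (chi \<alpha> (scale (f i) (unit_exp a)) * y i)) \<odot> coord_cl a f"
proof -
  have "cl (\<lambda>i. X a [^] f i \<otimes> \<sigma> (el \<alpha> (y i)))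
      = cl (\<lambda>i. \<sigma> (el \<alpha> (chi \<alpha> (scale (f i) (unit_exp a)) * y i)) \<otimes> X a [^] f i)"
  proof (rule cl_eqI_linear)
    fix i
    have "nat \<bar>f i\<bar> * (2 * M) \<le> (c * nn i) * (2 * M)"
      using assms(3)[of i] by (intro mult_right_mono) (auto simp: nat_le_iff)
    then show "near (c * (2 * M) * nn i) (X a [^] f i \<otimes> \<sigma> (el \<alpha> (y i)))
        (\<sigma> (el \<alpha> (chi \<alpha> (scale (f i) (unit_exp a)) * y i)) \<otimes> X a [^] f i)"
      by (intro near_mono[OF X_push[OF assms(1,2)]]) (simp add: ac_simps)
  qed
  then show ?thesis by (simp add: coord_cl_def letter_cl_def cl_mult sig_closed)
qed

lemma restrict_unit: "scale (E a) (unit_exp a) + restrict_exp A E = restrict_exp (insert a A) E" if "a \<notin> A"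
  using that by (auto simp: fun_eq_iff scale_def unit_exp_def restrict_exp_def)

lemma restrict_UNIV: "restrict_exp {A1, A2, B1, B2} E = E"
proof
  fix a show "restrict_exp {A1, A2, B1, B2} E a = E a"
    by (cases a) (simp_all add: restrict_exp_def)
qed

lemma restrict_empty: "restrict_exp {} E = 0"
  by (simp add: restrict_exp_def fun_eq_iff)

text \<open>A torus element conjugates a letter of a root subgroup provided the whole path, coordinate by
  coordinate, stays among the letters.\<close>

lemma torus_cl_push:
  assumes E: "E \<in> Exps" and y: "\<And>i A. chi \<alpha> (restrict_exp A (E i)) * y i \<in> Bv v 0"
  shows "torus_cl E \<odot> letter_cl (\<lambda>i. el \<alpha> (y i)) = letter_cl (\<lambda>i. el \<alpha> (chi \<alpha> (E i) * y i)) \<odot> torus_cl E"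
proof -
  obtain c where c: "\<bar>E i a\<bar> \<le> int (c * nn i)" for i a using E unfolding Exps_def by blast
  define k where "k A = letter_cl (\<lambda>i. el \<alpha> (chi \<alpha> (restrict_exp A (E i)) * y i))" for A
  have step: "coord_cl a (\<lambda>i. E i a) \<odot> k A = k (insert a A) \<odot> coord_cl a (\<lambda>i. E i a)" if "a \<notin> A" for a A
  proof -
    have e: "chi \<alpha> (restrict_exp (insert a A) (E i)) * y i
        = chi \<alpha> (scale (E i a) (unit_exp a)) * (chi \<alpha> (restrict_exp A (E i)) * y i)" for i
      by (simp add: chi_add mult.assoc flip: restrict_unit[OF that])
    show ?thesis unfolding k_def e
      by (rule coord_cl_push[OF y]) (use y c in \<open>auto simp flip: e\<close>)
  qed
  have [simp]: "k A \<in> carrier Q" for A by (simp add: k_def)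
  have "torus_cl E \<odot> k {} = k {A1, A2, B1, B2} \<odot> torus_cl E"
    unfolding torus_cl_coord by (simp add: Q.m_assoc step Q.lift2[OF step])
  then show ?thesis by (simp add: k_def restrict_empty restrict_UNIV chi_zero)
qed

definition qconj :: "('i \<Rightarrow> 'a) set \<Rightarrow> ('i \<Rightarrow> 'a) set \<Rightarrow> ('i \<Rightarrow> 'a) set" where
  "qconj t x = t \<odot> x \<odot> inv\<^bsub>Q\<^esub> t"

lemma qconj_closed [simp]: "t \<in> carrier Q \<Longrightarrow> x \<in> carrier Q \<Longrightarrow> qconj t x \<in> carrier Q"
  by (simp add: qconj_def)

lemma qconj_mult: "t \<in> carrier Q \<Longrightarrow> x \<in> carrier Q \<Longrightarrow> y \<in> carrier Q \<Longrightarrow> qconj t x \<odot> qconj t y = qconj t (x \<odot> y)"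
  by (simp add: qconj_def Q.m_assoc Q.inv_cancel_left)

lemma qconj_qconj: "t \<in> carrier Q \<Longrightarrow> s \<in> carrier Q \<Longrightarrow> x \<in> carrier Q \<Longrightarrow> qconj t (qconj s x) = qconj (t \<odot> s) x"
  by (simp add: qconj_def Q.m_assoc Q.inv_mult_group)

lemma qconj_eqI: "t \<in> carrier Q \<Longrightarrow> x \<in> carrier Q \<Longrightarrow> y \<in> carrier Q \<Longrightarrow> t \<odot> x = y \<odot> t \<Longrightarrow> qconj t x = y"
  by (simp add: qconj_def Q.m_assoc)

text \<open>Both sides are pushed along a common expanding direction until they are so deep inside
  the root subgroup that every torus path of the relevant length is admissible.\<close>

lemma contraction_unique:
  assumes E: "E \<in> Exps" "F \<in> Exps"
    and y: "\<And>i. y i \<in> Bv v 0" "\<And>i. z i \<in> Bv v 0"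
    and eq: "\<And>i. chi \<alpha> (E i) * y i = chi \<alpha> (F i) * z i"
  shows "qconj (torus_cl E) (letter_cl (\<lambda>i. el \<alpha> (y i))) = qconj (torus_cl F) (letter_cl (\<lambda>i. el \<alpha> (z i)))"
proof -
  obtain c d where cd: "\<bar>E i a\<bar> \<le> int (c * nn i)" "\<bar>F i a\<bar> \<le> int (d * nn i)" for i a
    using E unfolding Exps_def by blast
  define S where "S i = scale (int ((4 * (c + d)) * nn i)) (dir \<alpha> v)" for i
  have S: "S \<in> Exps" unfolding S_def by (rule Exps_scale)
  have *: "qconj (torus_cl E) (letter_cl (\<lambda>i. el \<alpha> (y i)))
      = qconj (torus_cl S) (letter_cl (\<lambda>i. el \<alpha> (chi \<alpha> (- S i) * (chi \<alpha> (E i) * y i))))"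
    if E: "E \<in> Exps" "\<And>i a. \<bar>E i a\<bar> \<le> int (c' * nn i)" "c' \<le> c + d" and y: "\<And>i. y i \<in> Bv v 0" for E y c'
  proof -
    define w where "w i = chi \<alpha> (- S i) * y i" for i
    have w: "w i \<in> Bv v (- int (4 * (c + d) * nn i))" for i
      using expand_shift[OF y wt_dir, where n = "4 * (c + d) * nn i"] by (simp add: w_def S_def)
    have "torus_cl (- S) \<odot> letter_cl (\<lambda>i. el \<alpha> (y i)) = letter_cl (\<lambda>i. el \<alpha> (chi \<alpha> ((- S) i) * y i)) \<odot> torus_cl (- S)"
    proof (rule torus_cl_push)
      fix i A
      have "restrict_exp A ((- S) i) = - scale (int (4 * (c + d) * nn i)) (restrict_exp A (dir \<alpha> v))"
        by (auto simp: fun_eq_iff restrict_exp_def S_def scale_def)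
      then have "wt v \<alpha> (restrict_exp A ((- S) i)) \<ge> 0"
        using wt_dir_restrict[of v \<alpha> A] by (simp add: wt_minus wt_scale mult_le_0_iff)
      moreover have "chi \<alpha> (restrict_exp A ((- S) i)) * y i \<in> Bv v (0 - wt v \<alpha> (restrict_exp A ((- S) i)))"
        by (rule chi_shift[OF y])
      ultimately show "chi \<alpha> (restrict_exp A ((- S) i)) * y i \<in> Bv v 0"
        using Bv_mono[of "0 - wt v \<alpha> (restrict_exp A ((- S) i))" 0] by auto
    qed (use S Exps_minus in auto)
    then have 1: "qconj (torus_cl (- S)) (letter_cl (\<lambda>i. el \<alpha> (y i))) = letter_cl (\<lambda>i. el \<alpha> (w i))"
      by (intro qconj_eqI) (simp_all add: w_def)
    have "torus_cl E \<odot> letter_cl (\<lambda>i. el \<alpha> (w i)) = letter_cl (\<lambda>i. el \<alpha> (chi \<alpha> (E i) * w i)) \<odot> torus_cl E"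
    proof (rule torus_cl_push[OF E(1)])
      fix i A
      have "\<bar>restrict_exp A (E i) a\<bar> \<le> int (c' * nn i)" for a
        using E(2)[of i a] by (simp add: restrict_exp_def)
      then have "\<bar>wt v \<alpha> (restrict_exp A (E i))\<bar> \<le> 4 * int (c' * nn i)" by (rule wt_bound)
      moreover have "c' * nn i \<le> (c + d) * nn i" using E(3) by simp
      ultimately have "- int (4 * (c + d) * nn i) - wt v \<alpha> (restrict_exp A (E i)) \<le> 0"
        by (simp add: algebra_simps flip: of_nat_mult of_nat_add)
      then show "chi \<alpha> (restrict_exp A (E i)) * w i \<in> Bv v 0"
        using chi_shift[OF w] Bv_mono by blast
    qed
    then have 2: "qconj (torus_cl E) (letter_cl (\<lambda>i. el \<alpha> (w i))) = letter_cl (\<lambda>i. el \<alpha> (chi \<alpha> (E i) * w i))"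
      by (intro qconj_eqI) simp_all
    have "qconj (torus_cl E) (letter_cl (\<lambda>i. el \<alpha> (y i))) = qconj (torus_cl E) (qconj (torus_cl S) (qconj (torus_cl (- S)) (letter_cl (\<lambda>i. el \<alpha> (y i)))))"
      using S by (simp add: qconj_qconj torus_cl_add Exps_minus torus_cl_zero)
    also have "\<dots> = qconj (torus_cl S) (qconj (torus_cl E) (letter_cl (\<lambda>i. el \<alpha> (w i))))"
      using S E by (simp add: qconj_qconj 1 torus_cl_commute)
    also have "\<dots> = qconj (torus_cl S) (letter_cl (\<lambda>i. el \<alpha> (chi \<alpha> (- S i) * (chi \<alpha> (E i) * y i))))"
      unfolding 2 by (simp add: w_def mult.left_commute)
    finally show ?thesis .
  qed
  show ?thesis
    unfolding *[OF E(1) cd(1) le_add1 y(1)] *[OF E(2) cd(2) le_add2 y(2)] eq ..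
qed

lemma KK_eps: "x \<in> KK v \<Longrightarrow> eps v * x i = x i"
  unfolding KK_def using Bv_eps by blast

lemma KK_add: "x \<in> KK v \<Longrightarrow> y \<in> KK v \<Longrightarrow> x + y \<in> KK v"
proof -
  assume "x \<in> KK v" "y \<in> KK v"
  then obtain c d where cd: "x i \<in> Bv v (int (c * nn i))" "y i \<in> Bv v (int (d * nn i))" for i
    unfolding KK_def by blast
  have "int (c * nn i) \<le> int ((c + d) * nn i)" "int (d * nn i) \<le> int ((c + d) * nn i)" for i
    unfolding of_nat_le_iff by simp_all
  then have "x i + y i \<in> Bv v (int ((c + d) * nn i))" for i
    using cd[of i] by (meson Bv_add Bv_mono subsetD)
  then show ?thesis unfolding KK_def plus_fun_apply by blast
qed

lemma KK_mult: "x \<in> KK v \<Longrightarrow> y \<in> KK v \<Longrightarrow> x * y \<in> KK v"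
proof -
  assume "x \<in> KK v" "y \<in> KK v"
  then obtain c d where cd: "x i \<in> Bv v (int (c * nn i))" "y i \<in> Bv v (int (d * nn i))" for i
    unfolding KK_def by blast
  have "x i * y i \<in> Bv v (int ((c + d) * nn i))" for i
    using Bv_mult[OF cd(1)[of i] cd(2)[of i]] by (simp add: algebra_simps)
  then have "\<forall>i. (x * y) i \<in> Bv v (int ((c + d) * nn i))" by simp
  then show ?thesis unfolding KK_def by blast
qed

lemma KK_chi: "x \<in> KK v \<Longrightarrow> E \<in> Exps \<Longrightarrow> (\<lambda>i. chi \<alpha> (E i) * x i) \<in> KK v"
proof -
  assume "x \<in> KK v" "E \<in> Exps"
  then obtain c d where cd: "x i \<in> Bv v (int (c * nn i))" "\<bar>E i a\<bar> \<le> int (d * nn i)" for i a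
    unfolding KK_def Exps_def by blast
  have "chi \<alpha> (E i) * x i \<in> Bv v (int ((c + 4 * d) * nn i))" for i
  proof -
    have "\<bar>wt v \<alpha> (E i)\<bar> \<le> 4 * int (d * nn i)" using cd(2) by (rule wt_bound)
    then have "int (c * nn i) - wt v \<alpha> (E i) \<le> int ((c + 4 * d) * nn i)"
      by (simp add: algebra_simps)
    then show ?thesis using chi_shift[OF cd(1)] Bv_mono by blast
  qed
  then show ?thesis unfolding KK_def by blast
qed

text \<open>The word \<open>root_word\<close> uses one particular contraction. Up to quadratic cost every other contraction by
  a torus element of linear length gives the same element.\<close>

lemma root_cl_eq:
  assumes x: "x \<in> KK v" and E: "E \<in> Exps" and y: "\<And>i. y i \<in> Bv v 0" and eq: "\<And>i. chi \<alpha> (E i) * y i = x i"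
  shows "root_cl v \<alpha> x = qconj (torus_cl E) (letter_cl (\<lambda>i. el \<alpha> (y i)))"
proof -
  obtain c where c: "x i \<in> Bv v (int (c * nn i))" for i using x unfolding KK_def by blast
  have sz: "x i \<in> Bv v (int (pole_order v (x i)))" "pole_order v (x i) \<le> c * nn i" for i
    unfolding pole_order_def
    by (rule LeastI[of "\<lambda>n. x i \<in> Bv v (int n)", OF c], rule Least_le[of "\<lambda>n. x i \<in> Bv v (int n)", OF c])
  define F where "F i = scale (int (pole_order v (x i))) (dir \<alpha> v)" for i
  have "\<bar>F i a\<bar> \<le> int (c * nn i)" for i a
  proof -
    have "int (pole_order v (x i)) * \<bar>dir \<alpha> v a\<bar> \<le> int (c * nn i) * 1"
      using sz(2)[of i] dir_bound[of \<alpha> v a] by (intro mult_mono) (simp_all del: of_nat_mult)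
    then show ?thesis by (simp add: F_def scale_def abs_mult)
  qed
  then have F: "F \<in> Exps" unfolding Exps_def by blast
  have zB: "chi \<alpha> (- F i) * x i \<in> Bv v 0" for i
    unfolding F_def by (rule expand_contract[OF sz(1) wt_dir])
  have "root_cl v \<alpha> x = qconj (torus_cl F) (letter_cl (\<lambda>i. el \<alpha> (chi \<alpha> (- F i) * x i)))"
    by (simp add: root_cl_def root_word_def Let_def F_def[symmetric] qconj_def torus_cl_def letter_cl_def cl_mult cl_inv sig_closed)
  also have "\<dots> = qconj (torus_cl E) (letter_cl (\<lambda>i. el \<alpha> (y i)))"
    by (rule contraction_unique[OF F E zB y]) (simp add: eq chi_minus flip: mult.assoc)
  finally show ?thesis .
qed

lemma torus_cl_root_cl:
  assumes x: "x \<in> KK v" and E: "E \<in> Exps"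
  shows "qconj (torus_cl E) (root_cl v \<alpha> x) = root_cl v \<alpha> (\<lambda>i. chi \<alpha> (E i) * x i)"
proof -
  obtain c where c: "x i \<in> Bv v (int (c * nn i))" for i using x unfolding KK_def by blast
  define F where "F i = scale (int (c * nn i)) (dir \<alpha> v)" for i
  have F: "F \<in> Exps" unfolding F_def by (rule Exps_scale)
  have zB: "chi \<alpha> (- F i) * x i \<in> Bv v 0" for i
    unfolding F_def by (rule expand_contract[OF c wt_dir])
  have "root_cl v \<alpha> x = qconj (torus_cl F) (letter_cl (\<lambda>i. el \<alpha> (chi \<alpha> (- F i) * x i)))"
    by (rule root_cl_eq[OF x F zB]) (simp add: chi_minus flip: mult.assoc)
  moreover have "root_cl v \<alpha> (\<lambda>i. chi \<alpha> (E i) * x i) = qconj (torus_cl (E + F)) (letter_cl (\<lambda>i. el \<alpha> (chi \<alpha> (- F i) * x i)))"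
  proof (rule root_cl_eq[OF KK_chi[OF x E] Exps_add[OF E F] zB])
    fix i
    have "chi \<alpha> (F i) * (chi \<alpha> (- F i) * x i) = x i" by (simp add: chi_minus flip: mult.assoc)
    then show "chi \<alpha> ((E + F) i) * (chi \<alpha> (- F i) * x i) = chi \<alpha> (E i) * x i"
      by (simp add: chi_add mult.assoc)
  qed
  ultimately show ?thesis using E F by (simp add: qconj_qconj torus_cl_add)
qed

end

definition conjU :: "'r::comm_ring_1 ut \<Rightarrow> 'r ut \<Rightarrow> 'r ut" where
  "conjU g w = UT 1 1 1 1 (chD R12 g * m12 w) (chD R13 g * m13 w) (m14 w) (chD R23 g * m23 w)
     (chD R24 g * m24 w) (chD R34 g * m34 w)"

lemma upart_mult:
  assumes "dA g * dA' g = 1" "dB g * dB' g = 1" "dA h * dA' h = 1" "dB h * dB' h = 1"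
  shows "upart (g * h) = upart g * conjU g (upart h)"
proof -
  have a: "dA h * (dA' h * x) = x" "dB h * (dB' h * x) = x" "dA g * (dA' g * x) = x"
    "dB g * (dB' g * x) = x" for x
    using assms by (simp_all flip: mult.assoc)
  have c: "a * b + d = d + a * b" for a b d :: 'a by simp
  show ?thesis
    by (rule ut_eqI) (simp_all add: upart_def conjU_def algebra_simps a)
qed

context abels_asym
begin

section \<open>Tame relations\<close>

text \<open>Two root subgroups that are expanded by a common torus element can be contracted to letters
  simultaneously.\<close>

lemma common_contraction:
  assumes x: "x \<in> KK v" and y: "y \<in> KK w" and D: "wt v \<alpha> D \<le> -1" "wt w \<beta> D \<le> -1"
  obtains E x0 y0 where "E \<in> Exps" "\<And>i. x0 i \<in> Bv v 0" "\<And>i. y0 i \<in> Bv w 0"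
    "\<And>i. chi \<alpha> (E i) * x0 i = x i" "\<And>i. chi \<beta> (E i) * y0 i = y i"
    "root_cl v \<alpha> x = qconj (torus_cl E) (letter_cl (\<lambda>i. el \<alpha> (x0 i)))"
    "root_cl w \<beta> y = qconj (torus_cl E) (letter_cl (\<lambda>i. el \<beta> (y0 i)))"
proof -
  obtain c d where cd: "x i \<in> Bv v (int (c * nn i))" "y i \<in> Bv w (int (d * nn i))" for i
    using x y unfolding KK_def by blast
  define E where "E i = scale (int ((c + d) * nn i)) D" for i
  have E: "E \<in> Exps" unfolding E_def by (rule Exps_scale)
  have *: "chi \<gamma> (- E i) * z \<in> Bv s 0"
    if "z \<in> Bv s (int (c' * nn i))" "c' \<le> c + d" "wt s \<gamma> D \<le> -1" for z s c' \<gamma> i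
  proof -
    have "int (c' * nn i) \<le> int ((c + d) * nn i)"
      using that(2) unfolding of_nat_le_iff by simp
    then have "z \<in> Bv s (int ((c + d) * nn i))" using that(1) Bv_mono by blast
    then show ?thesis unfolding E_def using that(3) by (rule expand_contract)
  qed
  define x0 where "x0 i = chi \<alpha> (- E i) * x i" for i
  define y0 where "y0 i = chi \<beta> (- E i) * y i" for i
  have 1: "x0 i \<in> Bv v 0" "y0 i \<in> Bv w 0" for i
    using *[OF cd(1) le_add1 D(1)] *[OF cd(2) le_add2 D(2)] by (simp_all add: x0_def y0_def)
  have 2: "chi \<alpha> (E i) * x0 i = x i" "chi \<beta> (E i) * y0 i = y i" for i
    by (simp_all add: x0_def y0_def chi_minus flip: mult.assoc)
  show ?thesis
    by (rule that[OF E 1 2 root_cl_eq[OF x E 1(1) 2(1)] root_cl_eq[OF y E 1(2) 2(2)]])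
qed

lemma root_cl_commute:
  assumes x: "x \<in> KK v" and y: "y \<in> KK w" and D: "wt v \<alpha> D \<le> -1" "wt w \<beta> D \<le> -1"
    and c: "\<And>a b. a \<in> Bv v 0 \<Longrightarrow> b \<in> Bv w 0 \<Longrightarrow> el \<alpha> a * el \<beta> b = el \<beta> b * el \<alpha> a"
  shows "root_cl v \<alpha> x \<odot> root_cl w \<beta> y = root_cl w \<beta> y \<odot> root_cl v \<alpha> x"
proof -
  obtain E x0 y0 where r: "E \<in> Exps" "\<And>i. x0 i \<in> Bv v 0" "\<And>i. y0 i \<in> Bv w 0"
    "root_cl v \<alpha> x = qconj (torus_cl E) (letter_cl (\<lambda>i. el \<alpha> (x0 i)))"
    "root_cl w \<beta> y = qconj (torus_cl E) (letter_cl (\<lambda>i. el \<beta> (y0 i)))"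
    by (rule common_contraction[OF x y D]) blast
  have "letter_cl (\<lambda>i. el \<alpha> (x0 i)) \<odot> letter_cl (\<lambda>i. el \<beta> (y0 i)) = letter_cl (\<lambda>i. el \<beta> (y0 i)) \<odot> letter_cl (\<lambda>i. el \<alpha> (x0 i))"
    using el_Sz0[OF r(2)] el_Sz0[OF r(3)] c[OF r(2) r(3)] by (simp add: letter_cl_mult0)
  then show ?thesis unfolding r by (simp add: qconj_mult)
qed

lemma root_cl_add:
  assumes x: "x \<in> KK v" and y: "y \<in> KK v"
  shows "root_cl v \<alpha> x \<odot> root_cl v \<alpha> y = root_cl v \<alpha> (x + y)"
proof -
  obtain E x0 y0 where r: "E \<in> Exps" "\<And>i. x0 i \<in> Bv v 0" "\<And>i. y0 i \<in> Bv v 0"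
    "\<And>i. chi \<alpha> (E i) * x0 i = x i" "\<And>i. chi \<alpha> (E i) * y0 i = y i"
    "root_cl v \<alpha> x = qconj (torus_cl E) (letter_cl (\<lambda>i. el \<alpha> (x0 i)))"
    "root_cl v \<alpha> y = qconj (torus_cl E) (letter_cl (\<lambda>i. el \<alpha> (y0 i)))"
    by (rule common_contraction[OF x y wt_dir wt_dir]) blast
  have "root_cl v \<alpha> (x + y) = qconj (torus_cl E) (letter_cl (\<lambda>i. el \<alpha> (x0 i + y0 i)))"
    by (rule root_cl_eq[OF KK_add[OF x y] r(1)]) (simp_all add: r Bv_add distrib_left)
  then show ?thesis
    unfolding r(6,7) using el_Sz0[OF r(2)] el_Sz0[OF r(3)] by (simp add: qconj_mult letter_cl_mult0 el_add)
qed

text \<open>After a simultaneous contraction the relation holds between letters, and the contraction of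
  \<open>x * y\<close> is the product of the contractions because the characters multiply.\<close>

lemma root_cl_commutator:
  assumes x: "x \<in> KK v" and y: "y \<in> KK v" and D: "wt v \<alpha> D \<le> -1" "wt v \<beta> D \<le> -1"
    and c: "\<And>a b :: 'r. el \<alpha> a * el \<beta> b = el \<gamma> (a * b) * (el \<beta> b * el \<alpha> a)"
    and ch: "\<And>E. chi \<gamma> E = chi \<alpha> E * chi \<beta> E"
  shows "root_cl v \<alpha> x \<odot> root_cl v \<beta> y = root_cl v \<gamma> (x * y) \<odot> (root_cl v \<beta> y \<odot> root_cl v \<alpha> x)"
proof -
  obtain E x0 y0 where r: "E \<in> Exps" "\<And>i. x0 i \<in> Bv v 0" "\<And>i. y0 i \<in> Bv v 0"
    "\<And>i. chi \<alpha> (E i) * x0 i = x i" "\<And>i. chi \<beta> (E i) * y0 i = y i"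
    "root_cl v \<alpha> x = qconj (torus_cl E) (letter_cl (\<lambda>i. el \<alpha> (x0 i)))"
    "root_cl v \<beta> y = qconj (torus_cl E) (letter_cl (\<lambda>i. el \<beta> (y0 i)))"
    by (rule common_contraction[OF x y D]) blast
  have xy: "x0 i * y0 i \<in> Bv v 0" for i using Bv_mult[OF r(2) r(3), of i i] by simp
  have "root_cl v \<gamma> (x * y) = qconj (torus_cl E) (letter_cl (\<lambda>i. el \<gamma> (x0 i * y0 i)))"
    by (rule root_cl_eq[OF KK_mult[OF x y] r(1) xy]) (simp add: ch ac_simps flip: r(4,5))
  moreover have "el \<beta> (y0 i) * el \<alpha> (x0 i) \<in> Sz 0" for i
    using Sz_mult[where m = 0 and n = 0, OF el_Sz0[OF r(3)] el_Sz0[OF r(2)]] by simp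
  ultimately show ?thesis
    unfolding r(6,7) using el_Sz0[OF r(2)] el_Sz0[OF r(3)] el_Sz0[OF xy]
    by (simp add: qconj_mult letter_cl_mult0 c)
qed

lemma abels_place: "abels Q (KK v) (\<lambda>_. eps v) (root_cl v)"
proof (intro abels.intro abels_axioms.intro Q.is_group)
  show "(\<lambda>_. eps v) \<in> KK v"
    using eps_Bv by (auto simp: KK_def intro!: exI[of _ 0])
  show "x * (\<lambda>_. eps v) = x" if "x \<in> KK v" for x
    using KK_eps[OF that] by (simp add: fun_eq_iff mult.commute)
next
  fix x y \<alpha> \<beta> assume xy: "x \<in> KK v" "y \<in> KK v"
    and p: "(\<alpha>, \<beta>) \<in> {(R13, R12), (R12, R34), (R13, R23), (R13, R24), (R24, R23), (R24, R34)}"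
  obtain D where "wt v \<alpha> D \<le> -1" "wt v \<beta> D \<le> -1" using tame_same_place[of \<alpha> \<beta> v] p by auto
  then show "root_cl v \<alpha> x \<odot> root_cl v \<beta> y = root_cl v \<beta> y \<odot> root_cl v \<alpha> x"
    by (rule root_cl_commute[OF xy]) (rule el_commute[OF p])
next
  fix x y assume xy: "x \<in> KK v" "y \<in> KK v"
  obtain D where D: "wt v R12 D \<le> -1" "wt v R23 D \<le> -1" using tame_same_place[of R12 R23 v] by auto
  show "root_cl v R12 x \<odot> root_cl v R23 y = root_cl v R13 (x * y) \<odot> (root_cl v R23 y \<odot> root_cl v R12 x)"
    by (rule root_cl_commutator[OF xy D]) (rule el_12_23, simp add: chi_def u_add)
  obtain D where D: "wt v R23 D \<le> -1" "wt v R34 D \<le> -1" using tame_same_place[of R23 R34 v] by auto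
  show "root_cl v R23 x \<odot> root_cl v R34 y = root_cl v R24 (x * y) \<odot> (root_cl v R34 y \<odot> root_cl v R23 x)"
    by (rule root_cl_commutator[OF xy D]) (rule el_23_34, simp add: chi_def u_add)
qed (use root_cl_add KK_add KK_mult in auto)

lemma root_cl_commute_places:
  assumes "x \<in> KK v" "y \<in> KK w" "v \<noteq> w"
  shows "root_cl v \<alpha> x \<odot> root_cl w \<beta> y = root_cl w \<beta> y \<odot> root_cl v \<alpha> x"
proof -
  obtain D where "wt v \<alpha> D \<le> -1" "wt w \<beta> D \<le> -1" using tame_distinct_places[OF assms(3)] by blast
  then show ?thesis
    by (rule root_cl_commute[OF assms(1,2)]) (rule el_commute_orth, rule Bv_orth, use assms in auto)
qed

section \<open>The homomorphism from the big group\<close>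

lemma qconj_eqD: "t \<in> carrier Q \<Longrightarrow> x \<in> carrier Q \<Longrightarrow> qconj t x = y \<Longrightarrow> t \<odot> x = y \<odot> t"
  by (auto simp: qconj_def Q.m_assoc)

definition place_cl :: "place \<Rightarrow> ('i \<Rightarrow> 'r) ut \<Rightarrow> ('i \<Rightarrow> 'a) set" where
  "place_cl v = abels.Psi Q (\<lambda>_. eps v) (root_cl v)"

definition KR :: "('i \<Rightarrow> 'r) set" where
  "KR = {x. \<exists>c. \<forall>i. x i \<in> B (c * nn i)}"

definition UU :: "('i \<Rightarrow> 'r ut) set" where
  "UU = {w. (\<forall>i. dA (w i) = 1 \<and> dA' (w i) = 1 \<and> dB (w i) = 1 \<and> dB' (w i) = 1) \<and>
     (\<lambda>i. m12 (w i)) \<in> KR \<and> (\<lambda>i. m13 (w i)) \<in> KR \<and> (\<lambda>i. m14 (w i)) \<in> KR \<and>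
     (\<lambda>i. m23 (w i)) \<in> KR \<and> (\<lambda>i. m24 (w i)) \<in> KR \<and> (\<lambda>i. m34 (w i)) \<in> KR}"

text \<open>A sequence of matrices is turned into a matrix of sequences, over the factor at the place \<open>v\<close>.\<close>

definition prj :: "place \<Rightarrow> ('i \<Rightarrow> 'r ut) \<Rightarrow> ('i \<Rightarrow> 'r) ut" where
  "prj v w = UT 1 1 1 1 (\<lambda>i. eps v * m12 (w i)) (\<lambda>i. eps v * m13 (w i)) (\<lambda>i. eps v * m14 (w i))
     (\<lambda>i. eps v * m23 (w i)) (\<lambda>i. eps v * m24 (w i)) (\<lambda>i. eps v * m34 (w i))"

definition unip_cl :: "('i \<Rightarrow> 'r ut) \<Rightarrow> ('i \<Rightarrow> 'a) set" where
  "unip_cl w = place_cl P0 (prj P0 w) \<odot> (place_cl P1 (prj P1 w) \<odot> place_cl PI (prj PI w))"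

lemma KR_KK: "x \<in> KR \<Longrightarrow> (\<lambda>i. eps v * x i) \<in> KK v"
  by (fastforce simp: KR_def KK_def B_def)

lemma KR_add: "x \<in> KR \<Longrightarrow> y \<in> KR \<Longrightarrow> (\<lambda>i. x i + y i) \<in> KR"
proof -
  assume "x \<in> KR" "y \<in> KR"
  then obtain c d where cd: "x i \<in> B (c * nn i)" "y i \<in> B (d * nn i)" for i
    unfolding KR_def by blast
  have "x i + y i \<in> B ((c + d) * nn i)" for i
    using cd[of i] B_mono[of "c * nn i" "(c + d) * nn i"] B_mono[of "d * nn i" "(c + d) * nn i"]
    by (intro B_add) auto
  then show ?thesis unfolding KR_def by blast
qed

lemma KR_mult: "x \<in> KR \<Longrightarrow> y \<in> KR \<Longrightarrow> (\<lambda>i. x i * y i) \<in> KR"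
proof -
  assume "x \<in> KR" "y \<in> KR"
  then obtain c d where cd: "x i \<in> B (c * nn i)" "y i \<in> B (d * nn i)" for i
    unfolding KR_def by blast
  have "x i * y i \<in> B ((c + d) * nn i)" for i
    using B_mult[OF cd(1)[of i] cd(2)[of i]] by (simp add: algebra_simps)
  then show ?thesis unfolding KR_def by blast
qed

lemma prj_unip: "w \<in> UU \<Longrightarrow> prj v w \<in> unip (KK v)"
  by (simp add: UU_def prj_def unip_def KR_KK)

lemma UU_mult: "w \<in> UU \<Longrightarrow> w' \<in> UU \<Longrightarrow> (\<lambda>i. w i * w' i) \<in> UU"
  by (simp add: UU_def KR_add KR_mult)

lemma prj_mult:
  assumes "w \<in> UU" "w' \<in> UU"
  shows "prj v (\<lambda>i. w i * w' i) = prj v w * prj v w'"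
proof -
  have e: "eps v * (x * y) = eps v * x * (eps v * y)" for x y
    using eps_idem(2)[of v "x * y"] by (simp add: ac_simps)
  show ?thesis
    using assms by (intro ut_eqI) (simp_all add: prj_def UU_def fun_eq_iff distrib_left e)
qed

lemma place_cl_closed: "w \<in> UU \<Longrightarrow> place_cl v (prj v w) \<in> carrier Q"
  unfolding place_cl_def by (rule abels.Psi_closed[OF abels_place prj_unip])

lemma place_cl_mult:
  "w \<in> UU \<Longrightarrow> w' \<in> UU \<Longrightarrow> place_cl v (prj v w) \<odot> place_cl v (prj v w') = place_cl v (prj v (\<lambda>i. w i * w' i))"
  unfolding place_cl_def by (subst abels.Psi_mult[OF abels_place]) (simp_all add: prj_unip prj_mult)

lemma place_cl_commute:
  assumes "w \<in> UU" "w' \<in> UU" "v \<noteq> v'"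
  shows "place_cl v (prj v w) \<odot> place_cl v' (prj v' w') = place_cl v' (prj v' w') \<odot> place_cl v (prj v w)"
proof -
  have "place_cl v' (prj v' w') \<odot> root_cl v \<alpha> x = root_cl v \<alpha> x \<odot> place_cl v' (prj v' w')" if "x \<in> KK v" for \<alpha> x
    unfolding place_cl_def
    by (rule abels.commutes_Psi[OF abels_place _ _ prj_unip[OF assms(2)]])
       (use root_cl_commute_places that assms(3) in auto)
  then show ?thesis
    unfolding place_cl_def[of v]
    by (intro abels.commutes_Psi[OF abels_place _ _ prj_unip[OF assms(1)]])
       (use place_cl_closed assms in auto)
qed

lemma unip_cl_closed: "w \<in> UU \<Longrightarrow> unip_cl w \<in> carrier Q"
  by (simp add: unip_cl_def place_cl_closed)

lemma unip_cl_mult: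
  assumes "w \<in> UU" "w' \<in> UU"
  shows "unip_cl w \<odot> unip_cl w' = unip_cl (\<lambda>i. w i * w' i)"
proof -
  note c = place_cl_closed[OF assms(1)] place_cl_closed[OF assms(2)] place_cl_closed[OF UU_mult[OF assms]]
  have com: "place_cl v (prj v w) \<odot> place_cl v' (prj v' w') = place_cl v' (prj v' w') \<odot> place_cl v (prj v w)"
    if "v \<noteq> v'" for v v' by (rule place_cl_commute[OF assms that])
  have com': "place_cl v (prj v w) \<odot> (place_cl v' (prj v' w') \<odot> a) = place_cl v' (prj v' w') \<odot> (place_cl v (prj v w) \<odot> a)"
    if "v \<noteq> v'" "a \<in> carrier Q" for v v' a
    using Q.lift2[OF com[OF that(1)]] that(2) c by simp
  have m: "place_cl v (prj v w) \<odot> (place_cl v (prj v w') \<odot> a) = place_cl v (prj v (\<lambda>i. w i * w' i)) \<odot> a"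
    if "a \<in> carrier Q" for v a
    using that by (simp add: c place_cl_mult[OF assms, symmetric] Q.m_assoc)
  show ?thesis
    unfolding unip_cl_def
    by (simp add: Q.m_assoc c com com' m place_cl_mult[OF assms])
qed

definition diag_cl :: "('i \<Rightarrow> 'r ut) \<Rightarrow> ('i \<Rightarrow> 'a) set" where
  "diag_cl g = torus_cl (\<lambda>i. texp (g i)) \<odot> letter_cl (\<lambda>i. tconst (g i))"

definition GG :: "('i \<Rightarrow> 'r ut) set" where
  "GG = {g. \<exists>c. \<forall>i. g i \<in> Sz (c * nn i)}"

lemma diag_cl_closed [simp]: "diag_cl g \<in> carrier Q" by (simp add: diag_cl_def)

lemma GG_G: "g \<in> GG \<Longrightarrow> g i \<in> G"
  using Sz_G by (auto simp: GG_def)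

lemma GG_Exps: "g \<in> GG \<Longrightarrow> (\<lambda>i. texp (g i)) \<in> Exps"
  using texp_bound by (fastforce simp: GG_def Exps_def simp del: of_nat_mult)

lemma upart_UU: "g \<in> GG \<Longrightarrow> (\<lambda>i. upart (g i)) \<in> UU"
proof -
  assume "g \<in> GG"
  then have "(\<lambda>i. m12 (g i)) \<in> KR" "(\<lambda>i. m13 (g i)) \<in> KR" "(\<lambda>i. m14 (g i)) \<in> KR"
    "(\<lambda>i. m23 (g i)) \<in> KR" "(\<lambda>i. m24 (g i)) \<in> KR" "(\<lambda>i. m34 (g i)) \<in> KR"
    "(\<lambda>i. dA' (g i)) \<in> KR" "(\<lambda>i. dB' (g i)) \<in> KR"
    unfolding GG_def KR_def Sz_def by blast+
  then show ?thesis by (simp add: UU_def upart_def KR_mult)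
qed

lemma conjU_UU: "g \<in> GG \<Longrightarrow> w \<in> UU \<Longrightarrow> (\<lambda>i. conjU (g i) (w i)) \<in> UU"
proof -
  assume g: "g \<in> GG" and w: "w \<in> UU"
  have "(\<lambda>i. dA (g i)) \<in> KR" "(\<lambda>i. dB (g i)) \<in> KR" "(\<lambda>i. dA' (g i)) \<in> KR" "(\<lambda>i. dB' (g i)) \<in> KR"
    using g unfolding GG_def KR_def Sz_def by blast+
  then show ?thesis using w by (simp add: UU_def conjU_def KR_mult)
qed

lemma diag_cl_mult:
  assumes "g \<in> GG" "h \<in> GG"
  shows "diag_cl g \<odot> diag_cl h = diag_cl (\<lambda>i. g i * h i)"
proof -
  have k: "tconst (g i) \<in> const_diag" "tconst (h i) \<in> const_diag" for i using texp_tconst GG_G assms by auto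
  have "diag_cl g \<odot> diag_cl h = (torus_cl (\<lambda>i. texp (g i)) \<odot> torus_cl (\<lambda>i. texp (h i))) \<odot> (letter_cl (\<lambda>i. tconst (g i)) \<odot> letter_cl (\<lambda>i. tconst (h i)))"
    unfolding diag_cl_def using Q.lift2[OF torus_cl_tconst[OF k(1) GG_Exps[OF assms(2)]]]
    by (simp add: Q.m_assoc)
  also have "\<dots> = torus_cl (\<lambda>i. texp (g i) + texp (h i)) \<odot> letter_cl (\<lambda>i. tconst (g i) * tconst (h i))"
    using k by (simp add: torus_cl_add GG_Exps assms letter_cl_mult0 const_diag_Sz plus_fun_def)
  finally show ?thesis
    using assms by (simp add: diag_cl_def texp_tconst_mult GG_G)
qed

lemma const_diag_char: "D \<in> const_diag \<Longrightarrow> y \<in> Bv v 0 \<Longrightarrow> chD \<alpha> D * y \<in> Bv v 0"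
proof -
  assume D: "D \<in> const_diag" and y: "y \<in> Bv v 0"
  have "chD \<alpha> D \<in> c0" using D by (cases \<alpha>) (simp_all add: const_diag_def c0_mult)
  then have "(eps v * chD \<alpha> D) * y \<in> Bv v (0 + 0)" using c0_Bv y by (intro Bv_mult)
  moreover have "(eps v * chD \<alpha> D) * y = chD \<alpha> D * y"
    using arg_cong[OF Bv_eps[OF y], of "\<lambda>z. chD \<alpha> D * z"] by (simp only: ac_simps)
  ultimately show ?thesis by simp
qed

lemma KK_const_diag:
  assumes D: "\<And>i. D i \<in> const_diag" and x: "x \<in> KK v"
  shows "(\<lambda>i. chD \<alpha> (D i) * x i) \<in> KK v"
proof -
  obtain c where c: "x i \<in> Bv v (int (c * nn i))" for i using x unfolding KK_def by blast
  have "eps v * chD \<alpha> (D i) \<in> Bv v 0" for i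
    using const_diag_char[OF D eps_Bv] by (simp add: mult.commute)
  from Bv_mult[OF this c] have "(eps v * chD \<alpha> (D i)) * x i \<in> Bv v (int (c * nn i))" for i by simp
  moreover have "(eps v * chD \<alpha> (D i)) * x i = chD \<alpha> (D i) * x i" for i
    using arg_cong[OF KK_eps[OF x, of i], of "\<lambda>z. chD \<alpha> (D i) * z"] by (simp only: ac_simps)
  ultimately show ?thesis unfolding KK_def by auto
qed

lemma chD_texp: "g \<in> G \<Longrightarrow> chD \<alpha> g = chi \<alpha> (texp g) * chD \<alpha> (tconst g)"
proof -
  assume g: "g \<in> G"
  have "chD \<alpha> g = chD \<alpha> (dpart g)" by (cases \<alpha>) (simp_all add: dpart_def)
  also have "\<dots> = chD \<alpha> (tor (texp g)) * chD \<alpha> (tconst g)"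
    unfolding texp_tconst(2)[OF g] by (cases \<alpha>) (simp_all add: ac_simps)
  finally show ?thesis by (simp add: chD_tor)
qed

lemma tconst_root_cl:
  assumes D: "\<And>i. D i \<in> const_diag" and x: "x \<in> KK v"
  shows "qconj (letter_cl D) (root_cl v \<alpha> x) = root_cl v \<alpha> (\<lambda>i. chD \<alpha> (D i) * x i)"
proof -
  obtain E x0 y0 where r: "E \<in> Exps" "\<And>i. x0 i \<in> Bv v 0" "\<And>i. chi \<alpha> (E i) * x0 i = x i"
    "root_cl v \<alpha> x = qconj (torus_cl E) (letter_cl (\<lambda>i. el \<alpha> (x0 i)))"
    by (rule common_contraction[OF x x wt_dir wt_dir]) blast
  note xD = KK_const_diag[OF D x]
  have "letter_cl D \<odot> letter_cl (\<lambda>i. el \<alpha> (x0 i)) = letter_cl (\<lambda>i. el \<alpha> (chD \<alpha> (D i) * x0 i)) \<odot> letter_cl D"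
  proof -
    have d: "diagonal (D i)" for i using D by (simp add: const_diag_def)
    show ?thesis
      using const_diag_Sz[OF D] el_Sz0[OF r(2)] el_Sz0[OF const_diag_char[OF D r(2)]]
      by (simp add: letter_cl_mult0 diagonal_el[OF d])
  qed
  then have "qconj (letter_cl D) (letter_cl (\<lambda>i. el \<alpha> (x0 i))) = letter_cl (\<lambda>i. el \<alpha> (chD \<alpha> (D i) * x0 i))"
    by (intro qconj_eqI) simp_all
  then have "qconj (letter_cl D) (root_cl v \<alpha> x) = qconj (torus_cl E) (letter_cl (\<lambda>i. el \<alpha> (chD \<alpha> (D i) * x0 i)))"
    unfolding r(4) by (simp add: qconj_qconj flip: torus_cl_tconst[OF D r(1)])
       (simp flip: qconj_qconj)
  also have "\<dots> = root_cl v \<alpha> (\<lambda>i. chD \<alpha> (D i) * x i)"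
    by (rule root_cl_eq[OF xD r(1), symmetric]) (simp_all add: const_diag_char D r(2) mult.left_commute flip: r(3))
  finally show ?thesis .
qed

lemma diag_cl_root_cl:
  assumes g: "g \<in> GG" and x: "x \<in> KK v"
  shows "diag_cl g \<odot> root_cl v \<alpha> x = root_cl v \<alpha> (\<lambda>i. chD \<alpha> (g i) * x i) \<odot> diag_cl g"
    and "(\<lambda>i. chD \<alpha> (g i) * x i) \<in> KK v"
proof -
  have D: "tconst (g i) \<in> const_diag" for i using texp_tconst GG_G g by auto
  note xD = KK_const_diag[OF D x]
  have e: "chD \<alpha> (g i) * x i = chi \<alpha> (texp (g i)) * (chD \<alpha> (tconst (g i)) * x i)" for i
    using chD_texp[OF GG_G[OF g]] by (simp add: mult.assoc)
  show "(\<lambda>i. chD \<alpha> (g i) * x i) \<in> KK v"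
    unfolding e by (rule KK_chi[OF xD GG_Exps[OF g]])
  have "qconj (diag_cl g) (root_cl v \<alpha> x) = root_cl v \<alpha> (\<lambda>i. chD \<alpha> (g i) * x i)"
    unfolding diag_cl_def e
    by (simp add: tconst_root_cl[OF D x] torus_cl_root_cl[OF xD GG_Exps[OF g]] flip: qconj_qconj)
  then show "diag_cl g \<odot> root_cl v \<alpha> x = root_cl v \<alpha> (\<lambda>i. chD \<alpha> (g i) * x i) \<odot> diag_cl g"
    by (rule qconj_eqD[rotated 2]) simp_all
qed

lemma diag_cl_place_cl:
  assumes g: "g \<in> GG" and w: "w \<in> UU"
  shows "diag_cl g \<odot> place_cl v (prj v w) = place_cl v (prj v (\<lambda>i. conjU (g i) (w i))) \<odot> diag_cl g"
proof -
  define c where "c \<alpha> = (\<lambda>i. chD \<alpha> (g i))" for \<alpha>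
  have gi: "dA' (g i) * dA (g i) = 1" for i
    using GG_G[OF g, of i] by (simp add: G_def mult.commute)
  have "diag_cl g \<odot> place_cl v (prj v w) = place_cl v (UT 1 1 1 1 (c R12 * m12 (prj v w)) (c R13 * m13 (prj v w))
     (m14 (prj v w)) (c R23 * m23 (prj v w)) (c R24 * m24 (prj v w)) (c R34 * m34 (prj v w))) \<odot> diag_cl g"
    unfolding place_cl_def
  proof (rule abels.conj_Psi[OF abels_place diag_cl_closed _ _ _ prj_unip[OF w]])
    fix \<alpha> x assume x: "x \<in> KK v"
    have e: "c \<alpha> * x = (\<lambda>i. chD \<alpha> (g i) * x i)" by (simp add: c_def times_fun_def)
    show "c \<alpha> * x \<in> KK v" "diag_cl g \<odot> root_cl v \<alpha> x = root_cl v \<alpha> (c \<alpha> * x) \<odot> diag_cl g"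
      unfolding e using diag_cl_root_cl[OF g x] by auto
  next
    show "c R12 * c R24 = 1" by (simp add: c_def fun_eq_iff gi)
  qed
  also have "UT 1 1 1 1 (c R12 * m12 (prj v w)) (c R13 * m13 (prj v w))
     (m14 (prj v w)) (c R23 * m23 (prj v w)) (c R24 * m24 (prj v w)) (c R34 * m34 (prj v w))
     = prj v (\<lambda>i. conjU (g i) (w i))"
    by (simp add: prj_def conjU_def c_def fun_eq_iff mult.left_commute mult.assoc)
  finally show ?thesis .
qed

lemma diag_cl_unip_cl:
  assumes g: "g \<in> GG" and w: "w \<in> UU"
  shows "diag_cl g \<odot> unip_cl w = unip_cl (\<lambda>i. conjU (g i) (w i)) \<odot> diag_cl g"
  unfolding unip_cl_def
  using place_cl_closed[OF w] place_cl_closed[OF conjU_UU[OF g w]] diag_cl_place_cl[OF g w] Q.lift2[OF diag_cl_place_cl[OF g w]]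
  by (simp add: Q.m_assoc)

definition nf_cl :: "('i \<Rightarrow> 'r ut) \<Rightarrow> ('i \<Rightarrow> 'a) set" where
  "nf_cl g = unip_cl (\<lambda>i. upart (g i)) \<odot> diag_cl g"

text \<open>\<open>G\<close> is the semidirect product of its unipotent and its diagonal part; \<open>unip_cl\<close> and \<open>diag_cl\<close> are
  homomorphisms on the two parts and compatible with the action.\<close>

lemma nf_cl_mult:
  assumes g: "g \<in> GG" and h: "h \<in> GG"
  shows "nf_cl g \<odot> nf_cl h = nf_cl (\<lambda>i. g i * h i)"
proof -
  note U = unip_cl_closed[OF upart_UU[OF g]] unip_cl_closed[OF upart_UU[OF h]]
    unip_cl_closed[OF conjU_UU[OF g upart_UU[OF h]]]
  have G: "dA (g i) * dA' (g i) = 1" "dB (g i) * dB' (g i) = 1"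
    "dA (h i) * dA' (h i) = 1" "dB (h i) * dB' (h i) = 1" for i
    using GG_G[OF g, of i] GG_G[OF h, of i] by (auto simp: G_def)
  have "nf_cl g \<odot> nf_cl h = (unip_cl (\<lambda>i. upart (g i)) \<odot> unip_cl (\<lambda>i. conjU (g i) (upart (h i)))) \<odot> (diag_cl g \<odot> diag_cl h)"
    unfolding nf_cl_def using U Q.lift2[OF diag_cl_unip_cl[OF g upart_UU[OF h]]]
    by (simp add: Q.m_assoc)
  then show ?thesis
    using g h by (simp add: nf_cl_def unip_cl_mult upart_UU conjU_UU diag_cl_mult upart_mult G)
qed

lemma place_cl_word: "place_cl v (prj v w) = cl (\<lambda>i. place_word v (w i))"
proof -
  have c: "Q.comm (cl \<phi>) (cl \<psi>) = cl (\<lambda>i. comm (\<phi> i) (\<psi> i))"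
    if "\<And>i. \<phi> i \<in> carrier W" "\<And>i. \<psi> i \<in> carrier W" for \<phi> \<psi>
    using that by (simp add: Q.comm_def comm_def cl_mult cl_inv)
  show ?thesis
    unfolding place_cl_def abels.Psi_def[OF abels_place] abels.Z_def[OF abels_place] prj_def place_word_def root_cl_def
    by (simp add: c cl_mult comm_closed)
qed

lemma nf_cl_word: "nf_cl g = cl (\<lambda>i. nf_word (g i))"
  unfolding nf_cl_def unip_cl_def diag_cl_def torus_cl_def letter_cl_def place_cl_word nf_word_def
  by (simp add: cl_mult sig_closed)

end

context abels_asym
begin

section \<open>Bounded elements\<close>

text \<open>\<open>letter_rep n q s\<close>: the element \<open>q\<close> is represented by the sequence of letters \<open>s\<close> of size \<open>n\<close>. As long
  as the sizes stay below \<open>L\<close>, products of represented elements are represented.\<close>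

definition letter_rep :: "nat \<Rightarrow> ('i \<Rightarrow> 'a) set \<Rightarrow> ('i \<Rightarrow> 'r ut) \<Rightarrow> bool" where
  "letter_rep n q s \<longleftrightarrow> (\<forall>i. s i \<in> Sz n) \<and> q = letter_cl s"

lemma letter_rep_mult:
  assumes "letter_rep m q s" "letter_rep n q' s'" "m + n \<le> L"
  shows "letter_rep (m + n) (q \<odot> q') (\<lambda>i. s i * s' i)"
proof -
  have "s i * s' i \<in> Sz (m + n)" for i using assms by (simp add: letter_rep_def Sz_mult)
  moreover have "letter_cl s \<odot> letter_cl s' = letter_cl (\<lambda>i. s i * s' i)"
  proof (rule letter_cl_mult)
    fix i show "s i \<in> Sz L" "s' i \<in> Sz L" "s i * s' i \<in> Sz L"
      using assms calculation[of i] Sz_le[of _ m L] Sz_le[of _ n L] Sz_le[of _ "m + n" L]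
      by (auto simp: letter_rep_def)
  qed
  ultimately show ?thesis using assms by (simp add: letter_rep_def)
qed

lemma coord_cl_rep:
  assumes "\<And>i. \<bar>f i\<bar> \<le> int n" "n \<le> L"
  shows "letter_rep n (coord_cl a f) (\<lambda>i. tor (scale (f i) (unit_exp a)))"
proof -
  have "tor (scale (f i) (unit_exp a)) \<in> Sz n" for i
    by (rule Sz_le[OF tor_unit_Sz]) (use assms(1)[of i] in auto)
  moreover have "coord_cl a f = letter_cl (\<lambda>i. tor (scale (f i) (unit_exp a)))"
    unfolding coord_cl_def letter_cl_def
  proof (rule cl_eqI_const)
    fix i
    have f: "\<bar>f i\<bar> \<le> int L" using assms(1)[of i] assms(2) by simp
    have "Suc (nat \<bar>f i\<bar>) * (3 * M) \<le> Suc L * (3 * M)"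
      using f by (intro mult_right_mono) (auto simp: nat_le_iff)
    then show "near (Suc L * (3 * M)) (X a [^] f i) (\<sigma> (tor (scale (f i) (unit_exp a))))"
      by (rule near_mono[OF X_power[OF f]])
  qed
  ultimately show ?thesis by (simp add: letter_rep_def)
qed

lemma torus_cl_rep:
  assumes E: "\<And>i a. \<bar>E i a\<bar> \<le> int n" and n: "4 * n \<le> L"
  shows "letter_rep (4 * n) (torus_cl E) (\<lambda>i. tor (E i))"
proof -
  have P: "letter_rep n (coord_cl a (\<lambda>i. E i a)) (\<lambda>i. tor (scale (E i a) (unit_exp a)))" for a
    by (rule coord_cl_rep) (use E n in auto)
  have "letter_rep (n + (n + (n + n))) (torus_cl E) (\<lambda>i. tor (scale (E i A1) (unit_exp A1)) *
     (tor (scale (E i A2) (unit_exp A2)) * (tor (scale (E i B1) (unit_exp B1)) * tor (scale (E i B2) (unit_exp B2)))))"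
    unfolding torus_cl_coord by (intro letter_rep_mult P) (use n in auto)
  moreover have "n + (n + (n + n)) = 4 * n" by simp
  ultimately show ?thesis by (simp flip: tor_add exp_decomp)
qed

lemma el_letter_rep:
  assumes "\<And>i. y i \<in> Bv v 0"
  shows "letter_rep 0 (letter_cl (\<lambda>i. el \<alpha> (y i))) (\<lambda>i. el \<alpha> (y i))"
  using el_Sz0[OF assms] by (simp add: letter_rep_def)

lemma root_cl_rep:
  assumes x: "\<And>i. x i \<in> Bv v (int n)" and n: "8 * n \<le> L"
  shows "x \<in> KK v" "letter_rep (8 * n) (root_cl v \<alpha> x) (\<lambda>i. el \<alpha> (x i))"
proof -
  have "x i \<in> Bv v (int (n * nn i))" for i
  proof -
    have "int n \<le> int (n * nn i)" unfolding of_nat_le_iff using nn_pos[of i] by simp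
    then show ?thesis using x Bv_mono by blast
  qed
  then show KK: "x \<in> KK v" unfolding KK_def by blast
  define D where "D = scale (int n) (dir \<alpha> v)"
  have b: "\<bar>D a\<bar> \<le> int n" for a
    using dir_bound[of \<alpha> v a] by (simp add: D_def scale_def abs_mult mult_left_le)
  have "int n \<le> int (n * nn i)" for i unfolding of_nat_le_iff using nn_pos[of i] by simp
  then have "\<bar>D a\<bar> \<le> int (n * nn i)" for i a using b order_trans by blast
  then have DE: "(\<lambda>i. D) \<in> Exps" unfolding Exps_def by blast
  have y: "chi \<alpha> (- D) * x i \<in> Bv v 0" for i
    unfolding D_def by (rule expand_contract[OF x wt_dir])
  have "root_cl v \<alpha> x = qconj (torus_cl (\<lambda>i. D)) (letter_cl (\<lambda>i. el \<alpha> (chi \<alpha> (- D) * x i)))"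
    by (rule root_cl_eq[OF KK DE y]) (simp add: chi_minus flip: mult.assoc)
  also have "\<dots> = torus_cl (\<lambda>i. D) \<odot> letter_cl (\<lambda>i. el \<alpha> (chi \<alpha> (- D) * x i)) \<odot> torus_cl (\<lambda>i. - D)"
    using DE by (simp add: qconj_def inv_torus_cl fun_Compl_def)
  finally have e: "root_cl v \<alpha> x = \<dots>" .
  have "letter_rep ((4 * n + 0) + 4 * n) (root_cl v \<alpha> x)
      (\<lambda>i. tor D * el \<alpha> (chi \<alpha> (- D) * x i) * tor (- D))"
    unfolding e by (intro letter_rep_mult torus_cl_rep el_letter_rep[OF y]) (use n b in auto)
  moreover have "tor D * el \<alpha> (chi \<alpha> (- D) * x i) * tor (- D) = el \<alpha> (x i)" for i
  proof -
    have "tor D * el \<alpha> (chi \<alpha> (- D) * x i) = el \<alpha> (chi \<alpha> D * (chi \<alpha> (- D) * x i)) * tor D"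
      by (simp add: diagonal_el[OF diagonal_tor] chD_tor)
    also have "chi \<alpha> D * (chi \<alpha> (- D) * x i) = x i" by (simp add: chi_minus flip: mult.assoc)
    finally have "tor D * el \<alpha> (chi \<alpha> (- D) * x i) * tor (- D) = el \<alpha> (x i) * (tor D * tor (- D))"
      by (simp only: mult.assoc)
    also have "tor D * tor (- D) = 1" using tor_add[of D "- D"] by (simp add: tor_zero)
    finally show ?thesis by (simp only: mult_1_right)
  qed
  ultimately show "letter_rep (8 * n) (root_cl v \<alpha> x) (\<lambda>i. el \<alpha> (x i))" by simp
qed

text \<open>Each of the five root elements has size \<open>8 n\<close>, being a letter of size 0 between two torus words of
  size \<open>4 n\<close>, and the commutator that represents the entry 14 has size \<open>16 n\<close>.\<close>

lemma place_cl_rep: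
  assumes w: "\<And>i. eps v * m12 (w i) \<in> Bv v (int n)" "\<And>i. eps v * m13 (w i) \<in> Bv v (int n)"
    "\<And>i. eps v * m14 (w i) \<in> Bv v (int n)" "\<And>i. eps v * m23 (w i) \<in> Bv v (int n)"
    "\<And>i. eps v * m24 (w i) \<in> Bv v (int n)" "\<And>i. eps v * m34 (w i) \<in> Bv v (int n)"
    and n: "56 * n \<le> L"
  shows "letter_rep (56 * n) (place_cl v (prj v w))
     (\<lambda>i. UT 1 1 1 1 (eps v * m12 (w i)) (eps v * m13 (w i)) (eps v * m14 (w i)) (eps v * m23 (w i))
        (eps v * m24 (w i)) (eps v * m34 (w i)))"
proof -
  note E = root_cl_rep(2)[OF w(1)] root_cl_rep(2)[OF w(2)] root_cl_rep(2)[OF w(3)]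
    root_cl_rep(2)[OF w(4)] root_cl_rep(2)[OF w(5)] root_cl_rep(2)[OF w(6)]
  define x where "x i = eps v * m14 (w i)" for i
  have x: "x i \<in> Bv v (int n)" "- x i \<in> Bv v (int n)" for i using w(3) by (simp_all add: x_def Bv_minus)
  have KK: "x \<in> KK v" "- x \<in> KK v" "0 \<in> KK v" "(\<lambda>i. eps v) \<in> KK v" "- (\<lambda>i. eps v) \<in> KK v"
  proof -
    show "x \<in> KK v" "- x \<in> KK v"
      by (rule root_cl_rep(1)[where n = n]; use x n in simp)+
    show "0 \<in> KK v" "(\<lambda>i. eps v) \<in> KK v" "- (\<lambda>i. eps v) \<in> KK v"
      by (rule root_cl_rep(1)[where n = 0]; simp add: Bv_zero eps_Bv Bv_minus)+
  qed
  have z: "letter_rep (8 * n + 8 * 0 + 8 * n + 8 * 0) (abels.Z Q (\<lambda>_. eps v) (root_cl v) x)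
     (\<lambda>i. el R12 (x i) * el R24 (eps v) * el R12 ((- x) i) * el R24 ((- (\<lambda>i. eps v)) i))"
    unfolding abels.Z_def[OF abels_place] Q.comm_def abels.inv_E[OF abels_place KK(1,2,3)]
      abels.inv_E[OF abels_place KK(4,5,3)]
    by (intro letter_rep_mult root_cl_rep(2)) (use n x eps_Bv Bv_minus in auto)
  have "letter_rep (8 * n + (8 * n + (8 * n + (8 * n + (8 * n + (8 * n + 8 * 0 + 8 * n + 8 * 0))))))
     (place_cl v (prj v w)) (\<lambda>i. el R34 (eps v * m34 (w i)) * (el R23 (eps v * m23 (w i)) *
       (el R24 (eps v * m24 (w i)) * (el R12 (eps v * m12 (w i)) * (el R13 (eps v * m13 (w i)) *
       (el R12 (x i) * el R24 (eps v) * el R12 ((- x) i) * el R24 ((- (\<lambda>i. eps v)) i)))))))"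
    unfolding place_cl_def abels.Psi_def[OF abels_place] prj_def ut.sel
    by (intro letter_rep_mult E z[unfolded x_def]; (unfold x_def)?; (rule z[unfolded x_def])?) (use n in auto)
  moreover have "el R12 (x i) * el R24 (eps v) * el R12 ((- x) i) * el R24 ((- (\<lambda>i. eps v)) i)
     = UT 1 1 1 1 0 0 (x i) 0 0 0" for i
    using Bv_eps[OF x(1), of i] by (intro ut_eqI) (simp_all add: mult.commute)
  moreover have "el R34 a34 * (el R23 a23 * (el R24 a24 * (el R12 a12 * (el R13 a13 * UT 1 1 1 1 0 0 a14 0 0 0))))
     = UT 1 1 1 1 a12 a13 a14 a23 a24 a34" for a12 a13 a14 a23 a24 a34 :: 'r
    by (rule ut_eqI) simp_all
  ultimately show ?thesis by (simp add: x_def)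
qed

lemma unip_cl_rep:
  assumes d: "\<And>i. dA (w i) = 1 \<and> dA' (w i) = 1 \<and> dB (w i) = 1 \<and> dB' (w i) = 1"
    and w: "\<And>i. m12 (w i) \<in> B n \<and> m13 (w i) \<in> B n \<and> m14 (w i) \<in> B n \<and>
              m23 (w i) \<in> B n \<and> m24 (w i) \<in> B n \<and> m34 (w i) \<in> B n"
    and n: "168 * n \<le> L"
  shows "letter_rep (168 * n) (unip_cl w) w"
proof -
  define p where "p v i = UT 1 1 1 1 (eps v * m12 (w i)) (eps v * m13 (w i)) (eps v * m14 (w i))
      (eps v * m23 (w i)) (eps v * m24 (w i)) (eps v * m34 (w i))" for v i
  have r: "letter_rep (56 * n) (place_cl v (prj v w)) (p v)" for v
    unfolding p_def by (rule place_cl_rep) (use w n in \<open>auto simp: B_def\<close>)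
  have o: "eps v * x * (eps v' * y) = 0" if "v \<noteq> v'" for v v' x y
  proof -
    have "eps v * x * (eps v' * y) = (eps v * eps v') * (x * y)" by (simp only: ac_simps)
    then show ?thesis using eps_orth[OF that] by simp
  qed
  have s: "eps P0 * x + (eps P1 * x + eps PI * x) = x" for x
    using eps_sum by (simp flip: distrib_right add.assoc)
  have "p P0 i * (p P1 i * p PI i) = w i" for i
    using d[of i] s by (intro ut_eqI) (simp_all add: p_def o distrib_left add.commute add.left_commute)
  then have "w = (\<lambda>i. p P0 i * (p P1 i * p PI i))" by auto
  moreover have "letter_rep (56 * n + (56 * n + 56 * n)) (unip_cl w) (\<lambda>i. p P0 i * (p P1 i * p PI i))"
    unfolding unip_cl_def by (intro letter_rep_mult r) (use n in auto)
  ultimately show ?thesis by simp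
qed

text \<open>A matrix of size \<open>m\<close> has a unipotent part of size \<open>2 m\<close>, since the columns are divided by the diagonal
  entries. With the constant 56 for each of the three places and \<open>4 m\<close> for the torus part, all partial
  products of its normal word are letters if \<open>340 m \<le> L\<close>, and so the triangles evaluate the word.\<close>

lemma nf_cl_letter:
  assumes g: "\<And>i. g i \<in> Sz m" and m: "340 * m \<le> L"
  shows "nf_cl g = letter_cl g"
proof -
  have G: "g i \<in> G" for i using g Sz_G by blast
  have u: "letter_rep (168 * (2 * m)) (unip_cl (\<lambda>i. upart (g i))) (\<lambda>i. upart (g i))"
  proof (rule unip_cl_rep)
    fix i
    have "a * b \<in> B (2 * m)" if "a \<in> B m" "b \<in> B m" for a b
      using B_mult[OF that] by (simp add: mult_2)
    moreover have "a \<in> B (2 * m)" if "a \<in> B m" for a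
      using B_mono[of m "2 * m"] that by auto
    ultimately show "m12 (upart (g i)) \<in> B (2 * m) \<and> m13 (upart (g i)) \<in> B (2 * m) \<and>
      m14 (upart (g i)) \<in> B (2 * m) \<and> m23 (upart (g i)) \<in> B (2 * m) \<and>
      m24 (upart (g i)) \<in> B (2 * m) \<and> m34 (upart (g i)) \<in> B (2 * m)"
      using g[of i] by (simp add: upart_def Sz_def)
  qed (use m in \<open>auto simp: upart_def\<close>)
  have t: "letter_rep (4 * m) (torus_cl (\<lambda>i. texp (g i))) (\<lambda>i. tor (texp (g i)))"
    by (rule torus_cl_rep) (use texp_bound[OF g] m in auto)
  have k: "letter_rep 0 (letter_cl (\<lambda>i. tconst (g i))) (\<lambda>i. tconst (g i))"
    using const_diag_Sz texp_tconst(1)[OF G] by (simp add: letter_rep_def)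
  have "letter_rep (168 * (2 * m) + (4 * m + 0)) (nf_cl g) (\<lambda>i. upart (g i) * (tor (texp (g i)) * tconst (g i)))"
    unfolding nf_cl_def diag_cl_def by (intro letter_rep_mult u t k) (use m in auto)
  moreover have "upart (g i) * (tor (texp (g i)) * tconst (g i)) = g i" for i
    using upart_dpart[of "g i"] G[of i] texp_tconst(2)[OF G[of i]] by (simp add: G_def)
  ultimately show ?thesis by (simp add: letter_rep_def)
qed

end

section \<open>Loops in the big group\<close>

context cover
begin

text \<open>The sequences run over all triples of a bound \<open>n\<close> and two elements of size \<open>n\<close>, so that one equality
  in \<open>Q\<close> gives a constant valid for all of them.\<close>

lemma nf_word_mult: "\<exists>C. \<forall>n\<ge>1. \<forall>g\<in>Sz n. \<forall>h\<in>Sz n. near (C * n\<^sup>2) (nf_word g \<otimes> nf_word h) (nf_word (g * h))"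
proof -
  define nn :: "nat \<times> 'r ut \<times> 'r ut \<Rightarrow> nat" where "nn i = max 1 (fst i)" for i
  define ok :: "nat \<times> 'r ut \<times> 'r ut \<Rightarrow> bool" where
    "ok i \<longleftrightarrow> fst (snd i) \<in> Sz (nn i) \<and> snd (snd i) \<in> Sz (nn i)" for i
  define g where "g i = (if ok i then fst (snd i) else 1)" for i
  define h where "h i = (if ok i then snd (snd i) else 1)" for i
  interpret abels_asym eps Bv u c0 W N \<sigma> L M nn
    by unfold_locales (simp add: nn_def)
  have "g i \<in> Sz (1 * nn i)" "h i \<in> Sz (1 * nn i)" for i
    by (auto simp: g_def h_def ok_def Sz_one)
  then have GG: "g \<in> GG" "h \<in> GG" unfolding GG_def by blast+
  have "cl (\<lambda>i. nf_word (g i) \<otimes> nf_word (h i)) = cl (\<lambda>i. nf_word (g i * h i))"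
    using nf_cl_mult[OF GG] by (simp add: nf_cl_word cl_mult)
  then obtain C where C: "near (C * (nn i)\<^sup>2) (nf_word (g i) \<otimes> nf_word (h i)) (nf_word (g i * h i))" for i
    by (subst (asm) cl_eq_iff) auto
  show ?thesis
  proof (intro exI[of _ C] allI impI ballI)
    fix n x y assume "1 \<le> n" "x \<in> Sz n" "y \<in> Sz n"
    then show "near (C * n\<^sup>2) (nf_word x \<otimes> nf_word y) (nf_word (x * y))"
      using C[of "(n, x, y)"] by (simp add: g_def h_def ok_def nn_def)
  qed
qed

lemma nf_word_letter:
  assumes "340 * m \<le> L"
  shows "\<exists>C. \<forall>s\<in>Sz m. near C (\<sigma> s) (nf_word s)"
proof -
  define g where "g s = (if s \<in> Sz m then s else 1)" for s
  interpret abels_asym eps Bv u c0 W N \<sigma> L M "\<lambda>_ :: 'r ut. 1 :: nat"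
    by unfold_locales simp
  have "nf_cl g = letter_cl g" by (rule nf_cl_letter[OF _ assms]) (simp add: g_def Sz_one)
  then obtain C where "near (C * 1\<^sup>2) (nf_word (g s)) (\<sigma> (g s))" for s
    unfolding nf_cl_word letter_cl_def by (subst (asm) cl_eq_iff) (auto simp: sig_closed)
  then have near: "near C (nf_word (g s)) (\<sigma> (g s))" for s by simp
  have "near C (\<sigma> s) (nf_word s)" if "s \<in> Sz m" for s
    using near_sym[OF near[of s]] that by (simp add: g_def)
  then show ?thesis by blast
qed

definition word :: "'r ut list \<Rightarrow> 'a" where
  "word ss = foldr (\<lambda>s x. \<sigma> s \<otimes> x) ss \<one>"

lemma word_closed [simp]: "word ss \<in> carrier W"
  by (induction ss) (simp_all add: word_def sig_closed)

lemma word_append: "word (ss @ ts) = word ss \<otimes> word ts"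
proof (induction ss)
  case Nil then show ?case using word_closed[of ts] by (simp add: word_def)
next
  case (Cons s ss)
  have "word ((s # ss) @ ts) = \<sigma> s \<otimes> word (ss @ ts)" by (simp add: word_def)
  also have "\<dots> = (\<sigma> s \<otimes> word ss) \<otimes> word ts" by (simp add: Cons m_assoc sig_closed)
  finally show ?case by (simp add: word_def)
qed

lemma prod_list_Sz: "set ss \<subseteq> Sz m \<Longrightarrow> prod_list ss \<in> Sz (m * length ss)"
proof (induction ss)
  case Nil then show ?case by (simp add: Sz_one)
next
  case (Cons s ss) then show ?case using Sz_mult[of s m "prod_list ss" "m * length ss"] by simp
qed

text \<open>Cutting a word in two halves gives \<open>f(n) \<le> f(n div 2) + f(n - n div 2) + D n\<^sup>2\<close>, whose
  solutions are quadratic.\<close>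

lemma word_near_nf_word:
  assumes "340 * m \<le> L"
  shows "\<exists>C. \<forall>ss. ss \<noteq> [] \<longrightarrow> set ss \<subseteq> Sz m \<longrightarrow>
           near (C * (length ss)\<^sup>2) (word ss) (nf_word (prod_list ss))"
proof -
  obtain C0 where C0: "\<And>s. s \<in> Sz m \<Longrightarrow> near C0 (\<sigma> s) (nf_word s)"
    using nf_word_letter[OF assms] by blast
  obtain D where D: "\<And>n g h. n \<ge> 1 \<Longrightarrow> g \<in> Sz n \<Longrightarrow> h \<in> Sz n \<Longrightarrow>
      near (D * n\<^sup>2) (nf_word g \<otimes> nf_word h) (nf_word (g * h))"
    using nf_word_mult by blast
  define D' where "D' = D * (Suc m)\<^sup>2"
  define C where "C = C0 + 3 * D'"
  have "near (C * (length ss)\<^sup>2) (word ss) (nf_word (prod_list ss))"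
    if "ss \<noteq> []" "set ss \<subseteq> Sz m" for ss
    using that
  proof (induction "length ss" arbitrary: ss rule: less_induct)
    case less
    show ?case
    proof (cases "length ss = 1")
      case True
      then obtain s where ss: "ss = [s]" by (metis One_nat_def length_0_conv length_Suc_conv)
      have "near C0 (\<sigma> s) (nf_word s)" using less.prems by (intro C0) (simp add: ss)
      then have "near C (\<sigma> s) (nf_word s)" by (rule near_mono) (simp add: C_def)
      then show ?thesis by (simp add: ss word_def sig_closed)
    next
      case False
      define n where "n = length ss"
      have n2: "n \<ge> 2" using False less.prems(1) by (cases ss) (auto simp: n_def Suc_le_eq)
      define k where "k = n div 2"
      define l where "l = n - k"
      have kl: "1 \<le> k" "1 \<le> l" "k + l = n" "l \<le> k + 1" "k \<le> l" "k < n" "l < n"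
        using n2 by (auto simp: k_def l_def)
      define a where "a = take k ss"
      define b where "b = drop k ss"
      have ab: "ss = a @ b" "length a = k" "length b = l" "set a \<subseteq> Sz m" "set b \<subseteq> Sz m"
        using less.prems kl by (auto simp: a_def b_def l_def n_def dest: in_set_takeD in_set_dropD)
      have ih: "near (C * k\<^sup>2) (word a) (nf_word (prod_list a))" "near (C * l\<^sup>2) (word b) (nf_word (prod_list b))"
      proof -
        have "length a < length ss" "length b < length ss" "a \<noteq> []" "b \<noteq> []"
          using ab(2,3) kl by (auto simp: n_def)
        from less.hyps[OF this(1,3) ab(4)] less.hyps[OF this(2,4) ab(5)]
        show "near (C * k\<^sup>2) (word a) (nf_word (prod_list a))" "near (C * l\<^sup>2) (word b) (nf_word (prod_list b))"
          by (simp_all only: ab(2,3))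
      qed
      have sz: "prod_list a \<in> Sz (Suc m * n)" "prod_list b \<in> Sz (Suc m * n)"
      proof -
        have "m * k \<le> Suc m * n" "m * l \<le> Suc m * n" using kl by (intro mult_mono; simp)+
        then show "prod_list a \<in> Sz (Suc m * n)" "prod_list b \<in> Sz (Suc m * n)"
          using prod_list_Sz[OF ab(4)] prod_list_Sz[OF ab(5)] ab(2,3) Sz_le by auto
      qed
      have "near (D * (Suc m * n)\<^sup>2) (nf_word (prod_list a) \<otimes> nf_word (prod_list b)) (nf_word (prod_list a * prod_list b))"
        by (rule D[OF _ sz]) (use n2 in simp)
      from near_trans[OF near_mult[OF ih] this]
      have "near (C * k\<^sup>2 + C * l\<^sup>2 + D * (Suc m * n)\<^sup>2) (word ss) (nf_word (prod_list ss))"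
        by (simp add: ab(1) word_append)
      moreover have "C * k\<^sup>2 + C * l\<^sup>2 + D * (Suc m * n)\<^sup>2 \<le> C * n\<^sup>2"
      proof -
        \<comment> \<open>The halves have almost the same length, so \<open>2 k l\<close> is at least \<open>n\<^sup>2 / 3\<close>; hence the 3 in \<open>C\<close>.\<close>
        have "n\<^sup>2 \<le> 6 * (k * l)"
        proof -
          have "l = k \<or> l = k + 1" using kl by auto
          then show ?thesis
          proof
            assume "l = k" then show ?thesis using kl(3) by (auto simp: power2_eq_square algebra_simps)
          next
            assume l: "l = k + 1"
            have "k \<le> k * k" using kl(1) by simp
            moreover have "1 \<le> k * k" using kl(1) by simp
            ultimately show ?thesis using kl(3) unfolding l by (auto simp: power2_eq_square algebra_simps)
          qed
        qed
        then have "D' * n\<^sup>2 \<le> D' * (6 * (k * l))" by simp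
        also have "\<dots> \<le> C * (2 * (k * l))" by (simp add: C_def algebra_simps)
        finally have "D' * n\<^sup>2 \<le> C * (2 * (k * l))" .
        moreover have "C * n\<^sup>2 = C * k\<^sup>2 + C * l\<^sup>2 + C * (2 * (k * l))"
          unfolding kl(3)[symmetric] by (simp add: power2_eq_square algebra_simps)
        moreover have "D * (Suc m * n)\<^sup>2 = D' * n\<^sup>2"
          by (simp only: D'_def power_mult_distrib mult.assoc)
        ultimately show ?thesis by simp
      qed
      ultimately show ?thesis unfolding n_def by (rule near_mono)
    qed
  qed
  then show ?thesis by blast
qed

theorem loop_quadratic:
  assumes "340 * m \<le> L"
  shows "\<exists>C. \<forall>ss. set ss \<subseteq> Sz m \<longrightarrow> prod_list ss = 1 \<longrightarrow> word ss \<in> N (C * (length ss)\<^sup>2)"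
proof -
  obtain C where C: "\<And>ss. ss \<noteq> [] \<Longrightarrow> set ss \<subseteq> Sz m \<Longrightarrow>
      near (C * (length ss)\<^sup>2) (word ss) (nf_word (prod_list ss))"
    using word_near_nf_word[OF assms] by blast
  obtain C0 where C0: "\<And>s. s \<in> Sz m \<Longrightarrow> near C0 (\<sigma> s) (nf_word s)"
    using nf_word_letter[OF assms] by blast
  have "word ss \<in> N ((C + C0 + M) * (length ss)\<^sup>2)" if ss: "set ss \<subseteq> Sz m" "prod_list ss = 1" for ss
  proof (cases "ss = []")
    case True then show ?thesis using N_one by (simp add: word_def)
  next
    case False
    have "near C0 (nf_word 1) (\<sigma> 1)" using near_sym[OF C0[OF Sz_one]] .
    then have 1: "near (C0 + M) (nf_word 1) \<one>" using sig_one by (rule near_trans)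
    have "near (C * (length ss)\<^sup>2 + (C0 + M)) (word ss) \<one>"
      using near_trans[OF C[OF False ss(1)], of "C0 + M" \<one>] 1 by (simp add: ss(2))
    moreover have "(C0 + M) * 1 \<le> (C0 + M) * (length ss)\<^sup>2"
      using False by (intro mult_le_mono2) (simp add: Suc_le_eq)
    ultimately have "near ((C + C0 + M) * (length ss)\<^sup>2) (word ss) \<one>"
      by (elim near_mono) (simp add: algebra_simps)
    then show ?thesis by (simp add: near_def)
  qed
  then show ?thesis by blast
qed

end

section \<open>Conjugates and area\<close>

definition cost_ball :: "('a, 'b) monoid_scheme \<Rightarrow> 'a set \<Rightarrow> nat \<Rightarrow> 'a set" where
  "cost_ball F X m = {foldr (\<otimes>\<^bsub>F\<^esub>) xs \<one>\<^bsub>F\<^esub> | xs. set xs \<subseteq> X \<union> (\<lambda>x. inv\<^bsub>F\<^esub> x) ` X \<and> length xs \<le> m}"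

context group
begin

lemma foldr_mult_closed: "set xs \<subseteq> carrier G \<Longrightarrow> foldr (\<otimes>) xs \<one> \<in> carrier G"
  by (induction xs) auto

lemma foldr_mult_append:
  "set xs \<subseteq> carrier G \<Longrightarrow> set ys \<subseteq> carrier G \<Longrightarrow>
   foldr (\<otimes>) (xs @ ys) \<one> = foldr (\<otimes>) xs \<one> \<otimes> foldr (\<otimes>) ys \<one>"
  by (induction xs) (auto simp: foldr_mult_closed m_assoc)

lemma conjugates_carrier: "R \<subseteq> carrier G \<Longrightarrow> conjugates G R \<subseteq> carrier G"
  by (auto simp: conjugates_def)

lemma conj_norm_cost_ball:
  assumes R: "R \<subseteq> carrier G"
  shows "conj_norm G (cost_ball G (conjugates G R))"
proof (intro conj_norm.intro conj_norm_axioms.intro is_group)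
  define Y where "Y = conjugates G R \<union> (\<lambda>x. inv x) ` conjugates G R"
  have Y: "Y \<subseteq> carrier G" using conjugates_carrier[OF R] by (auto simp: Y_def)
  have Y_inv: "inv x \<in> Y" if "x \<in> Y" for x
    using that conjugates_carrier[OF R] by (auto simp: Y_def)
  have Y_conj: "g \<otimes> x \<otimes> inv g \<in> Y" if x: "x \<in> Y" and g: "g \<in> carrier G" for x g
  proof -
    have c: "g \<otimes> x \<otimes> inv g \<in> conjugates G R" if xc: "x \<in> conjugates G R" for x
    proof -
      obtain h y where hy: "x = h \<otimes> y \<otimes> inv h" "h \<in> carrier G" "y \<in> R"
        using xc by (auto simp: conjugates_def)
      then have "g \<otimes> x \<otimes> inv g = (g \<otimes> h) \<otimes> y \<otimes> inv (g \<otimes> h)"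
        using g R by (auto simp: inv_mult_group m_assoc)
      then show ?thesis using hy g unfolding conjugates_def by blast
    qed
    show ?thesis
    proof (cases "x \<in> conjugates G R")
      case True then show ?thesis using c by (simp add: Y_def)
    next
      case False
      then obtain y where y: "x = inv y" "y \<in> conjugates G R" using x by (auto simp: Y_def)
      then have "g \<otimes> x \<otimes> inv g = inv (g \<otimes> y \<otimes> inv g)"
        using g conjugates_carrier[OF R] by (auto simp: inv_mult_group m_assoc)
      then show ?thesis using c[OF y(2)] by (auto simp: Y_def)
    qed
  qed
  have cost_ball: "x \<in> cost_ball G (conjugates G R) m \<longleftrightarrow>
      (\<exists>xs. x = foldr (\<otimes>) xs \<one> \<and> set xs \<subseteq> Y \<and> length xs \<le> m)" for x m
    by (auto simp: cost_ball_def Y_def)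
  fix m n x y g
  show "cost_ball G (conjugates G R) m \<subseteq> carrier G"
    using foldr_mult_closed Y by (auto simp: cost_ball)
  show "\<one> \<in> cost_ball G (conjugates G R) 0" by (auto simp: cost_ball)
  show "x \<otimes> y \<in> cost_ball G (conjugates G R) (m + n)"
    if x: "x \<in> cost_ball G (conjugates G R) m" and y: "y \<in> cost_ball G (conjugates G R) n"
  proof -
    obtain xs ys where "x = foldr (\<otimes>) xs \<one>" "set xs \<subseteq> Y" "length xs \<le> m"
      "y = foldr (\<otimes>) ys \<one>" "set ys \<subseteq> Y" "length ys \<le> n" using x y unfolding cost_ball by blast
    then have "x \<otimes> y = foldr (\<otimes>) (xs @ ys) \<one>" "set (xs @ ys) \<subseteq> Y" "length (xs @ ys) \<le> m + n"
      using foldr_mult_append[of xs ys] Y by auto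
    then show ?thesis unfolding cost_ball by blast
  qed
  show "inv x \<in> cost_ball G (conjugates G R) m" if x: "x \<in> cost_ball G (conjugates G R) m"
  proof -
    obtain xs where xs: "x = foldr (\<otimes>) xs \<one>" "set xs \<subseteq> Y" "length xs \<le> m"
      using x unfolding cost_ball by blast
    have "inv (foldr (\<otimes>) xs \<one>) = foldr (\<otimes>) (rev (map (\<lambda>x. inv x) xs)) \<one>" if "set xs \<subseteq> Y" for xs
      using that
    proof (induction xs)
      case (Cons x xs)
      have "set (map (\<lambda>x. inv x) xs) \<subseteq> carrier G" "set xs \<subseteq> carrier G" "x \<in> carrier G"
        using Cons.prems Y by auto
      then show ?case
        using Cons by (simp add: inv_mult_group foldr_mult_closed foldr_mult_append del: foldr_append)
    qed simp
    then have "inv x = foldr (\<otimes>) (rev (map (\<lambda>x. inv x) xs)) \<one>" using xs by simp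
    moreover have "set (rev (map (\<lambda>x. inv x) xs)) \<subseteq> Y" using xs(2) Y_inv by auto
    ultimately show ?thesis using xs(3) unfolding cost_ball by (metis length_map length_rev)
  qed
  show "g \<otimes> x \<otimes> inv g \<in> cost_ball G (conjugates G R) m"
    if x: "x \<in> cost_ball G (conjugates G R) m" and g: "g \<in> carrier G"
  proof -
    obtain xs where xs: "x = foldr (\<otimes>) xs \<one>" "set xs \<subseteq> Y" "length xs \<le> m"
      using x unfolding cost_ball by blast
    have "g \<otimes> foldr (\<otimes>) xs \<one> \<otimes> inv g = foldr (\<otimes>) (map (\<lambda>x. g \<otimes> x \<otimes> inv g) xs) \<one>" if "set xs \<subseteq> Y" for xs
      using that
    proof (induction xs)
      case Nil then show ?case using g by simp
    next
      case (Cons x xs)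
      have c: "set xs \<subseteq> carrier G" "x \<in> carrier G" using Cons.prems Y by auto
      have "g \<otimes> x \<otimes> inv g \<otimes> (g \<otimes> foldr (\<otimes>) xs \<one> \<otimes> inv g) = g \<otimes> (x \<otimes> foldr (\<otimes>) xs \<one>) \<otimes> inv g"
        using c g foldr_mult_closed[OF c(1)] by (simp add: m_assoc inv_cancel_left)
      then show ?case using Cons by simp
    qed
    then have "g \<otimes> x \<otimes> inv g = foldr (\<otimes>) (map (\<lambda>x. g \<otimes> x \<otimes> inv g) xs) \<one>" using xs by simp
    moreover have "set (map (\<lambda>x. g \<otimes> x \<otimes> inv g) xs) \<subseteq> Y" using xs(2) Y_conj g by auto
    ultimately show ?thesis using xs(3) unfolding cost_ball by (metis length_map)
  qed
  show "cost_ball G (conjugates G R) m \<subseteq> cost_ball G (conjugates G R) n" if "m \<le> n"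
    using that by (fastforce simp: cost_ball_def)
qed

lemma normal_closure_cost_ball:
  assumes R: "R \<subseteq> carrier G"
  shows "normal_closure G R = (\<Union>m. cost_ball G (conjugates G R) m)"
proof
  interpret conj_norm G "cost_ball G (conjugates G R)" by (rule conj_norm_cost_ball[OF R])
  show "normal_closure G R \<subseteq> (\<Union>m. cost_ball G (conjugates G R) m)"
  proof
    fix x assume "x \<in> normal_closure G R"
    then show "x \<in> (\<Union>m. cost_ball G (conjugates G R) m)"
      unfolding normal_closure_def
    proof (induction rule: generate.induct)
      case one then show ?case using N_one by blast
    next
      case (incl h)
      then have "h = foldr (\<otimes>) [h] \<one>" using conjugates_carrier[OF R] by auto
      then have "h \<in> cost_ball G (conjugates G R) 1" unfolding cost_ball_def using incl
        by (intro CollectI exI[of _ "[h]"]) auto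
      then show ?case by blast
    next
      case (inv h)
      then have "inv h = foldr (\<otimes>) [inv h] \<one>" using conjugates_carrier[OF R] by auto
      then have "inv h \<in> cost_ball G (conjugates G R) 1" unfolding cost_ball_def using inv
        by (intro CollectI exI[of _ "[inv h]"]) auto
      then show ?case by blast
    next
      case (eng h1 h2) then show ?case using N_mult by blast
    qed
  qed
  have "foldr (\<otimes>) xs \<one> \<in> normal_closure G R"
    if "set xs \<subseteq> conjugates G R \<union> (\<lambda>x. inv x) ` conjugates G R" for xs
    using that unfolding normal_closure_def
    by (induction xs) (auto intro: generate.intros)
  then show "(\<Union>m. cost_ball G (conjugates G R) m) \<subseteq> normal_closure G R"
    by (auto simp: cost_ball_def)
qed

end

section \<open>Generation of the big group\<close>

context places
begin

definition letters_prod :: "'r ut \<Rightarrow> bool" where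
  "letters_prod g \<longleftrightarrow> (\<exists>ss. set ss \<subseteq> Sz 1 \<and> prod_list ss = g)"

lemma letters_prod_mult: "letters_prod g \<Longrightarrow> letters_prod h \<Longrightarrow> letters_prod (g * h)"
proof -
  assume "letters_prod g" "letters_prod h"
  then obtain ss ts where "set ss \<subseteq> Sz 1" "prod_list ss = g" "set ts \<subseteq> Sz 1" "prod_list ts = h"
    unfolding letters_prod_def by blast
  then have "set (ss @ ts) \<subseteq> Sz 1" "prod_list (ss @ ts) = g * h" by auto
  then show ?thesis unfolding letters_prod_def by blast
qed

lemma letters_prod_letter: "g \<in> Sz 1 \<Longrightarrow> letters_prod g"
  unfolding letters_prod_def by (intro exI[of _ "[g]"]) simp

lemma letters_prod_tor: "letters_prod (tor E)"
proof -
  have *: "letters_prod (tor (scale m (unit_exp a)))" for m a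
  proof (induction m rule: int_induct[where k = 0])
    case base
    show ?case by (rule letters_prod_letter) (use tor_unit_Sz[of 0 a] Sz_mono[of 0 1] in auto)
  next
    case (step1 m)
    have "scale (m + 1) (unit_exp a) = scale m (unit_exp a) + scale 1 (unit_exp a)"
      by (simp add: scale_def fun_eq_iff distrib_right)
    moreover have "tor (scale 1 (unit_exp a)) \<in> Sz 1" using tor_unit_Sz[of 1 a] by simp
    ultimately show ?case using step1(2) letters_prod_letter letters_prod_mult by (simp only: tor_add)
  next
    case (step2 m)
    have "scale (m - 1) (unit_exp a) = scale m (unit_exp a) + scale (-1) (unit_exp a)"
      by (simp add: scale_def fun_eq_iff left_diff_distrib)
    moreover have "tor (scale (-1) (unit_exp a)) \<in> Sz 1" using tor_unit_Sz[of "-1" a] by simp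
    ultimately show ?case using step2(2) letters_prod_letter letters_prod_mult by (simp only: tor_add)
  qed
  show ?thesis
    by (subst exp_decomp, unfold tor_add, intro letters_prod_mult *)
qed

lemma letters_prod_el: "x \<in> Bv v n \<Longrightarrow> letters_prod (el \<alpha> x)"
proof -
  assume x: "x \<in> Bv v n"
  have x': "x \<in> Bv v (int (nat n))" using x Bv_mono[of n "int (nat n)" v] by auto
  define D where "D = scale (int (nat n)) (dir \<alpha> v)"
  have "chi \<alpha> (- D) * x \<in> Bv v 0" unfolding D_def by (rule expand_contract[OF x' wt_dir])
  then have "el \<alpha> (chi \<alpha> (- D) * x) \<in> Sz 1" using el_Sz[of _ v 0] Sz_mono[of 0 1] by auto
  then have "letters_prod (tor D * el \<alpha> (chi \<alpha> (- D) * x) * tor (- D))"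
    by (intro letters_prod_mult letters_prod_tor letters_prod_letter)
  also have "tor D * el \<alpha> (chi \<alpha> (- D) * x) = el \<alpha> x * tor D"
    by (simp add: diagonal_el[OF diagonal_tor] chD_tor chi_minus flip: mult.assoc)
  also have "el \<alpha> x * tor D * tor (- D) = el \<alpha> x"
    using tor_add[of D "- D"] by (simp add: mult.assoc tor_zero)
  finally show ?thesis .
qed

lemma letters_prod_el_all: "letters_prod (el \<alpha> x)"
proof -
  have e: "letters_prod (el \<alpha> (eps v * x))" for v
    using Bv_exhaust[of v x] letters_prod_el by blast
  have "x = eps P0 * x + (eps P1 * x + eps PI * x)"
    using eps_sum by (simp flip: distrib_right add.assoc)
  then have "el \<alpha> x = el \<alpha> (eps P0 * x) * (el \<alpha> (eps P1 * x) * el \<alpha> (eps PI * x))"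
    by (simp only: el_add)
  then show ?thesis using e letters_prod_mult by metis
qed

text \<open>A root element at one place is the conjugate of a letter by a torus element, and the entry 14 is
  reached by a commutator.\<close>

lemma letters_generate: "g \<in> G \<Longrightarrow> letters_prod g"
proof -
  assume g: "g \<in> G"
  have c: "letters_prod (el R12 x * (el R24 1 * (el R12 (- x) * el R24 (- 1))))" for x
    by (intro letters_prod_mult letters_prod_el_all)
  have "el R12 x * (el R24 1 * (el R12 (- x) * el R24 (- 1))) = UT 1 1 1 1 0 0 x 0 0 0" for x :: 'r
    by (rule ut_eqI) simp_all
  then have c: "letters_prod (UT 1 1 1 1 0 0 x 0 0 0)" for x using c[of x] by simp
  define w where "w = upart g"
  have "letters_prod (el R34 (m34 w) * (el R23 (m23 w) * (el R24 (m24 w) * (el R12 (m12 w) *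
      (el R13 (m13 w) * UT 1 1 1 1 0 0 (m14 w) 0 0 0)))) * (tor (texp g) * tconst g))"
    using texp_tconst(1)[OF g] const_diag_Sz Sz_mono[of 0 1]
    by (intro letters_prod_mult letters_prod_el_all c letters_prod_tor letters_prod_letter) auto
  also have "el R34 (m34 w) * (el R23 (m23 w) * (el R24 (m24 w) * (el R12 (m12 w) *
      (el R13 (m13 w) * UT 1 1 1 1 0 0 (m14 w) 0 0 0)))) = w"
    by (rule ut_eqI) (simp_all add: w_def upart_def)
  also have "w * (tor (texp g) * tconst g) = g"
    using upart_dpart[of g] g texp_tconst(2)[OF g] by (simp add: G_def w_def)
  finally show ?thesis .
qed

end

section \<open>Lattices in the big group\<close>

text \<open>The group \<open>H\<close>, embedded by \<open>\<psi>\<close>, is a cocompact lattice, and \<open>f\<close> is a nearest-point map that fixes it.\<close>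

locale lattice_in = places eps Bv u c0 + H: group H
  for eps :: "place \<Rightarrow> 'r::comm_ring_1" and Bv u c0 and H :: "('h, 'b) monoid_scheme" (structure) +
  fixes \<psi> :: "'h \<Rightarrow> 'r ut" and f :: "'r ut \<Rightarrow> 'h"
  assumes psi_mult: "x \<in> carrier H \<Longrightarrow> y \<in> carrier H \<Longrightarrow> \<psi> (x \<otimes> y) = \<psi> x * \<psi> y"
    and psi_G: "x \<in> carrier H \<Longrightarrow> \<psi> x \<in> G"
    and psi_f: "g \<in> G \<Longrightarrow> \<exists>k\<in>Sz 0. g = \<psi> (f g) * k"
    and f_closed: "g \<in> G \<Longrightarrow> f g \<in> carrier H"
    and f_psi: "x \<in> carrier H \<Longrightarrow> f (\<psi> x) = x"
    and finite_Sz: "finite {x \<in> carrier H. \<psi> x \<in> Sz n}"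
begin

lemma psi_one: "\<psi> \<one> = 1"
proof -
  have "\<psi> \<one> * \<psi> \<one> = \<psi> \<one>" using psi_mult[of \<one> \<one>] by simp
  then have "uinv (\<psi> \<one>) * (\<psi> \<one> * \<psi> \<one>) = uinv (\<psi> \<one>) * \<psi> \<one>" by simp
  then show ?thesis using G_inv(2)[OF psi_G[of \<one>]] by (simp flip: mult.assoc)
qed

text \<open>The step is \<open>k * s * uinv k'\<close> with \<open>k\<close> and \<open>k'\<close> in \<open>Sz 0\<close>, and \<open>Sz n\<close> is invariant under multiplication by
  \<open>Sz 0\<close> on both sides.\<close>

lemma f_step:
  assumes x: "x \<in> G" and s: "s \<in> Sz n"
  shows "\<psi> (inv (f x) \<otimes> f (x * s)) \<in> Sz n"
proof -
  have xs: "x * s \<in> G" using x s Sz_G G_mult by blast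
  obtain k where k: "k \<in> Sz 0" "x = \<psi> (f x) * k" using psi_f[OF x] by blast
  obtain k' where k': "k' \<in> Sz 0" "x * s = \<psi> (f (x * s)) * k'" using psi_f[OF xs] by blast
  have "\<psi> (f (x * s)) = x * s * uinv k'"
  proof -
    have "\<psi> (f (x * s)) = \<psi> (f (x * s)) * (k' * uinv k')" using G_inv(3)[OF Sz_G[OF k'(1)]] by simp
    then show ?thesis by (simp only: mult.assoc[symmetric] k'(2)[symmetric])
  qed
  moreover have "\<psi> (inv (f x)) * x = k"
  proof -
    have "\<psi> (inv (f x)) * x = \<psi> (inv (f x)) * \<psi> (f x) * k" using k(2) by (metis mult.assoc)
    also have "\<psi> (inv (f x)) * \<psi> (f x) = 1"
      using f_closed[OF x] by (simp add: psi_one flip: psi_mult)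
    finally show ?thesis by simp
  qed
  ultimately have "\<psi> (inv (f x) \<otimes> f (x * s)) = k * s * uinv k'"
    using f_closed[OF x] f_closed[OF xs] by (simp add: psi_mult flip: mult.assoc)
  also have "\<dots> \<in> Sz (0 + n + 0)" by (intro Sz_mult k(1) s Sz_inv k'(1))
  finally show ?thesis by simp
qed

end

text \<open>A group \<open>F\<close> with a cost and a map \<open>\<tau>\<close> on the lattice that is multiplicative up to bounded cost
  on small elements.  The group \<open>Tw\<close> of pairs of an \<open>F\<close>-valued function on the big group and an
  element of the big group turns paths in the big group, pushed to the lattice by \<open>f\<close>, into
  products of letters.\<close>

locale lattice_cost = lattice_in eps Bv u c0 H \<psi> f + F: conj_norm F N
  for eps :: "place \<Rightarrow> 'r::comm_ring_1" and Bv u c0 and H :: "('h, 'b) monoid_scheme" (structure)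
    and \<psi> f and F :: "('f, 'c) monoid_scheme" and N +
  fixes \<tau> :: "'h \<Rightarrow> 'f" and L M :: nat
  assumes L_ge: "2 \<le> L"
    and tau_closed: "x \<in> carrier H \<Longrightarrow> \<tau> x \<in> carrier F"
    and tau_mult: "x \<in> carrier H \<Longrightarrow> y \<in> carrier H \<Longrightarrow> \<psi> x \<in> Sz L \<Longrightarrow> \<psi> y \<in> Sz L \<Longrightarrow>
      \<psi> (x \<otimes> y) \<in> Sz L \<Longrightarrow> F.near M (\<tau> x \<otimes>\<^bsub>F\<^esub> \<tau> y) (\<tau> (x \<otimes> y))"
begin

definition Tw :: "(('r ut \<Rightarrow> 'f) \<times> 'r ut) monoid" where
  "Tw = \<lparr>carrier = {(\<phi>, g). g \<in> G \<and> (\<forall>x. \<phi> x \<in> carrier F)},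
         mult = (\<lambda>(\<phi>, g) (\<phi>', h). (\<lambda>x. \<phi> x \<otimes>\<^bsub>F\<^esub> \<phi>' (x * g), g * h)),
         one = (\<lambda>x. \<one>\<^bsub>F\<^esub>, 1)\<rparr>"

definition TwN :: "nat \<Rightarrow> (('r ut \<Rightarrow> 'f) \<times> 'r ut) set" where
  "TwN m = {(\<phi>, g). g = 1 \<and> (\<forall>x. \<phi> x \<in> N m)}"

lemma Tw_simps [simp]:
  "(\<phi>, g) \<in> carrier Tw \<longleftrightarrow> g \<in> G \<and> (\<forall>x. \<phi> x \<in> carrier F)"
  "(\<phi>, g) \<otimes>\<^bsub>Tw\<^esub> (\<phi>', h) = (\<lambda>x. \<phi> x \<otimes>\<^bsub>F\<^esub> \<phi>' (x * g), g * h)"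
  "\<one>\<^bsub>Tw\<^esub> = (\<lambda>x. \<one>\<^bsub>F\<^esub>, 1)"
  by (simp_all add: Tw_def)

lemma Tw_inv:
  assumes "g \<in> G" "\<And>x. \<phi> x \<in> carrier F"
  shows "(\<lambda>x. inv\<^bsub>F\<^esub> \<phi> (x * uinv g), uinv g) \<in> carrier Tw"
    and "(\<lambda>x. inv\<^bsub>F\<^esub> \<phi> (x * uinv g), uinv g) \<otimes>\<^bsub>Tw\<^esub> (\<phi>, g) = \<one>\<^bsub>Tw\<^esub>"
  using assms G_inv[OF assms(1)] by simp_all

lemma group_Tw: "group Tw"
proof (rule groupI)
  fix a b c assume "a \<in> carrier Tw" "b \<in> carrier Tw" "c \<in> carrier Tw"
  then show "a \<otimes>\<^bsub>Tw\<^esub> b \<otimes>\<^bsub>Tw\<^esub> c = a \<otimes>\<^bsub>Tw\<^esub> (b \<otimes>\<^bsub>Tw\<^esub> c)"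
    by (cases a; cases b; cases c) (simp add: F.m_assoc mult.assoc)
next
  fix a assume a: "a \<in> carrier Tw"
  show "\<one>\<^bsub>Tw\<^esub> \<otimes>\<^bsub>Tw\<^esub> a = a" using a by (cases a) simp
  obtain \<phi> g where ag: "a = (\<phi>, g)" by (cases a)
  show "\<exists>b\<in>carrier Tw. b \<otimes>\<^bsub>Tw\<^esub> a = \<one>\<^bsub>Tw\<^esub>"
    using a unfolding ag by (intro bexI[where x = "(\<lambda>x. inv\<^bsub>F\<^esub> \<phi> (x * uinv g), uinv g)"] Tw_inv) simp_all
next
  show "\<one>\<^bsub>Tw\<^esub> \<in> carrier Tw" by (simp add: G_one)
qed (auto simp: Tw_def G_mult)

interpretation Tw: group Tw by (rule group_Tw)

lemma inv_Tw:
  "g \<in> G \<Longrightarrow> (\<And>x. \<phi> x \<in> carrier F) \<Longrightarrow> inv\<^bsub>Tw\<^esub> (\<phi>, g) = (\<lambda>x. inv\<^bsub>F\<^esub> \<phi> (x * uinv g), uinv g)"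
  by (rule Tw.inv_equality) (use Tw_inv[of g \<phi>] in auto)

lemma uinv_one: "uinv (1 :: 'r ut) = 1"
  using G_inv(2)[OF G_one] by simp

lemma conj_norm_Tw: "conj_norm Tw TwN"
proof (intro conj_norm.intro conj_norm_axioms.intro group_Tw)
  fix m n x y g
  show "TwN m \<subseteq> carrier Tw" using F.N_carrier G_one by (force simp: TwN_def)
  show "\<one>\<^bsub>Tw\<^esub> \<in> TwN 0" using F.N_one by (simp add: TwN_def)
  show "x \<otimes>\<^bsub>Tw\<^esub> y \<in> TwN (m + n)" if "x \<in> TwN m" "y \<in> TwN n"
    using that F.N_mult by (auto simp: TwN_def)
  show "inv\<^bsub>Tw\<^esub> x \<in> TwN m" if "x \<in> TwN m"
    using that F.N_inv F.N_carrier[of m] by (auto simp: TwN_def inv_Tw G_one uinv_one subset_iff)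
  show "g \<otimes>\<^bsub>Tw\<^esub> x \<otimes>\<^bsub>Tw\<^esub> inv\<^bsub>Tw\<^esub> g \<in> TwN m" if x: "x \<in> TwN m" and g: "g \<in> carrier Tw"
  proof -
    obtain \<phi> h where gh: "g = (\<phi>, h)" "h \<in> G" "\<And>z. \<phi> z \<in> carrier F" using g by (cases g) auto
    obtain \<psi>' where x': "x = (\<psi>', 1)" "\<And>z. \<psi>' z \<in> N m" using x by (auto simp: TwN_def)
    show ?thesis
      using gh x' by (simp add: inv_Tw G_inv TwN_def mult.assoc F.N_conj)
  qed
  show "TwN m \<subseteq> TwN n" if "m \<le> n" using F.N_mono[OF that] by (auto simp: TwN_def)
qed

interpretation TwN: conj_norm Tw TwN by (rule conj_norm_Tw)

lemma near_Tw:
  assumes "g \<in> G" "\<And>x. F.near m (\<phi> x) (\<phi>' x)"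
  shows "TwN.near m (\<phi>, g) (\<phi>', g)"
  using assms F.near_closed[OF assms(2)]
  by (simp add: TwN.near_def inv_Tw TwN_def mult.assoc G_inv) (simp add: F.near_def)

definition \<sigma> :: "'r ut \<Rightarrow> ('r ut \<Rightarrow> 'f) \<times> 'r ut" where
  "\<sigma> s = (if s \<in> G then (\<lambda>x. if x \<in> G then \<tau> (inv (f x) \<otimes> f (x * s)) else \<one>\<^bsub>F\<^esub>, s) else \<one>\<^bsub>Tw\<^esub>)"

lemma f_cancel:
  assumes "x \<in> G" "s \<in> G" "t \<in> G"
  shows "(inv (f x) \<otimes> f (x * s)) \<otimes> (inv (f (x * s)) \<otimes> f (x * s * t)) = inv (f x) \<otimes> f (x * s * t)"
  using assms by (simp add: H.m_assoc f_closed G_mult H.inv_cancel_left)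

lemma G_mult_iff: "s \<in> G \<Longrightarrow> x * s \<in> G \<longleftrightarrow> x \<in> G"
proof
  assume s: "s \<in> G" and xs: "x * s \<in> G"
  have "x * s * uinv s \<in> G" using G_mult[OF xs G_inv(1)[OF s]] .
  then show "x \<in> G" using G_inv(3)[OF s] by (simp add: mult.assoc)
qed (simp add: G_mult)

lemma cover_Tw: "cover eps Bv u c0 Tw TwN \<sigma> L M"
proof (intro cover.intro cover_axioms.intro conj_norm_Tw L_ge)
  show "places eps Bv u c0" by unfold_locales
  show "\<sigma> s \<in> carrier Tw" for s
    by (auto simp: \<sigma>_def G_one tau_closed f_closed G_mult)
  fix s t assume s: "s \<in> Sz L" and t: "t \<in> Sz L" and st: "s * t \<in> Sz L"
  have G: "s \<in> G" "t \<in> G" "s * t \<in> G" using s t st Sz_G by auto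
  have near: "F.near M (\<tau> (inv (f x) \<otimes> f (x * s)) \<otimes>\<^bsub>F\<^esub> \<tau> (inv (f (x * s)) \<otimes> f (x * s * t)))
      (\<tau> (inv (f x) \<otimes> f (x * s * t)))" if x: "x \<in> G" for x
  proof -
    have xs: "x * s \<in> G" "x * s * t \<in> G" using x G by (simp_all add: G_mult)
    have c: "inv (f x) \<otimes> f (x * s) \<in> carrier H" "inv (f (x * s)) \<otimes> f (x * s * t) \<in> carrier H"
      using x xs by (simp_all add: f_closed)
    note fc = f_cancel[OF x G(1,2), unfolded mult.assoc]
    show ?thesis
      using tau_mult[OF c f_step[OF x s] f_step[OF xs(1) t]] f_step[OF x st]
      unfolding mult.assoc fc by simp
  qed
  have "TwN.near M (\<lambda>x. (if x \<in> G then \<tau> (inv (f x) \<otimes> f (x * s)) else \<one>\<^bsub>F\<^esub>) \<otimes>\<^bsub>F\<^esub>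
      (if x * s \<in> G then \<tau> (inv (f (x * s)) \<otimes> f (x * s * t)) else \<one>\<^bsub>F\<^esub>), s * t)
      (\<lambda>x. if x \<in> G then \<tau> (inv (f x) \<otimes> f (x * (s * t))) else \<one>\<^bsub>F\<^esub>, s * t)"
  proof (rule near_Tw[OF G(3)])
    fix x
    show "F.near M ((if x \<in> G then \<tau> (inv (f x) \<otimes> f (x * s)) else \<one>\<^bsub>F\<^esub>) \<otimes>\<^bsub>F\<^esub>
      (if x * s \<in> G then \<tau> (inv (f (x * s)) \<otimes> f (x * s * t)) else \<one>\<^bsub>F\<^esub>))
      (if x \<in> G then \<tau> (inv (f x) \<otimes> f (x * (s * t))) else \<one>\<^bsub>F\<^esub>)"
      using near[of x] F.near_refl[of "\<one>\<^bsub>F\<^esub>" M] G_mult_iff[OF G(1), of x]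
      by (simp add: mult.assoc)
  qed
  then show "TwN.near M (\<sigma> s \<otimes>\<^bsub>Tw\<^esub> \<sigma> t) (\<sigma> (s * t))"
    using G by (simp add: \<sigma>_def)
qed

interpretation C: cover eps Bv u c0 Tw TwN \<sigma> L M by (rule cover_Tw)

text \<open>On the lattice \<open>f\<close> is the identity, so the path from \<open>\<psi> x\<close> along lattice letters is read back letter
  by letter.\<close>

lemma word_at:
  assumes "set xs \<subseteq> carrier H" "x \<in> carrier H"
  shows "fst (C.word (map \<psi> xs)) (\<psi> x) = foldr (\<lambda>y a. \<tau> y \<otimes>\<^bsub>F\<^esub> a) xs \<one>\<^bsub>F\<^esub>"
  using assms
proof (induction xs arbitrary: x)
  case Nil then show ?case by (simp add: C.word_def)
next
  case (Cons y xs)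
  obtain \<phi> g where w: "C.word (map \<psi> xs) = (\<phi>, g)" by (cases "C.word (map \<psi> xs)")
  have y: "y \<in> carrier H" "\<psi> y \<in> G" "\<psi> x \<in> G" "x \<otimes> y \<in> carrier H"
    using Cons.prems psi_G by auto
  have "C.word (map \<psi> (y # xs)) = \<sigma> (\<psi> y) \<otimes>\<^bsub>Tw\<^esub> (\<phi>, g)"
    using w by (simp add: C.word_def)
  then have "fst (C.word (map \<psi> (y # xs))) (\<psi> x) = \<tau> (inv (f (\<psi> x)) \<otimes> f (\<psi> x * \<psi> y)) \<otimes>\<^bsub>F\<^esub> \<phi> (\<psi> x * \<psi> y)"
    using y by (simp add: \<sigma>_def)
  also have "inv (f (\<psi> x)) \<otimes> f (\<psi> x * \<psi> y) = y"
    using y Cons.prems by (simp add: f_psi H.inv_cancel_left flip: psi_mult)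
  also have "\<phi> (\<psi> x * \<psi> y) = foldr (\<lambda>y a. \<tau> y \<otimes>\<^bsub>F\<^esub> a) xs \<one>\<^bsub>F\<^esub>"
    using Cons.IH[of "x \<otimes> y"] Cons.prems y w by (simp flip: psi_mult)
  finally show ?case by simp
qed

lemma psi_foldr: "set xs \<subseteq> carrier H \<Longrightarrow> prod_list (map \<psi> xs) = \<psi> (foldr (\<otimes>) xs \<one>)"
  by (induction xs) (auto simp: psi_one psi_mult H.foldr_mult_closed)

theorem lattice_loop_quadratic:
  assumes "340 * m \<le> L"
  shows "\<exists>C. \<forall>xs. set xs \<subseteq> carrier H \<longrightarrow> (\<forall>x\<in>set xs. \<psi> x \<in> Sz m) \<longrightarrow> foldr (\<otimes>) xs \<one> = \<one> \<longrightarrow>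
     foldr (\<lambda>y a. \<tau> y \<otimes>\<^bsub>F\<^esub> a) xs \<one>\<^bsub>F\<^esub> \<in> N (C * (length xs)\<^sup>2)"
proof -
  obtain C where C: "\<And>ss. set ss \<subseteq> Sz m \<Longrightarrow> prod_list ss = 1 \<Longrightarrow> C.word ss \<in> TwN (C * (length ss)\<^sup>2)"
    using C.loop_quadratic[OF assms] by blast
  have "foldr (\<lambda>y a. \<tau> y \<otimes>\<^bsub>F\<^esub> a) xs \<one>\<^bsub>F\<^esub> \<in> N (C * (length xs)\<^sup>2)"
    if "set xs \<subseteq> carrier H" "\<forall>x\<in>set xs. \<psi> x \<in> Sz m" "foldr (\<otimes>) xs \<one> = \<one>" for xs
  proof -
    have "C.word (map \<psi> xs) \<in> TwN (C * (length (map \<psi> xs))\<^sup>2)"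
      by (rule C) (use that psi_foldr psi_one in auto)
    then have "fst (C.word (map \<psi> xs)) (\<psi> \<one>) \<in> N (C * (length xs)\<^sup>2)"
      by (auto simp: TwN_def)
    then show ?thesis using word_at[OF that(1), of \<one>] by simp
  qed
  then show ?thesis by blast
qed

end

lemma free_group_simps [simp]:
  "w \<in> carrier (free_group S) \<longleftrightarrow> set w \<subseteq> S \<times> UNIV \<and> reduced w"
  "u \<otimes>\<^bsub>free_group S\<^esub> v = foldr cons_red u v" "\<one>\<^bsub>free_group S\<^esub> = []"
  by (simp_all add: free_group_def)

lemma area_le: "w \<in> cost_ball (free_group S) (conjugates (free_group S) (short_relations G S r)) m \<Longrightarrow>
  area G S r w \<le> enat m"
  unfolding area_def word_length_def cost_ball_def
  by (clarsimp, rule Inf_lower2) auto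

context lattice_in
begin

lemma finite_size_bound:
  assumes "finite S" "S \<subseteq> carrier H"
  shows "\<exists>m. \<forall>x\<in>S. \<psi> x \<in> Sz m"
  using assms
proof (induction S rule: finite_induct)
  case (insert x S)
  obtain ss where ss: "set ss \<subseteq> Sz 1" "prod_list ss = \<psi> x"
    using letters_generate[OF psi_G] insert.prems unfolding letters_prod_def by blast
  have "prod_list ss \<in> Sz (length ss)" using ss(1)
  proof (induction ss)
    case (Cons s ss) then show ?case using Sz_mult[of s 1 "prod_list ss" "length ss"] by simp
  qed (simp add: Sz_one)
  moreover obtain m where "\<forall>x\<in>S. \<psi> x \<in> Sz m" using insert by auto
  ultimately have "\<forall>x\<in>insert x S. \<psi> x \<in> Sz (length ss + m)"
    using ss(2) Sz_mono[of "length ss" "length ss + m"] Sz_mono[of m "length ss + m"] by auto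
  then show ?case by blast
qed auto

text \<open>A path of letters of size 1 from 1 to \<open>\<psi> x\<close> is pushed to the lattice; its steps remain of size 1.\<close>

lemma generate_small:
  assumes "{x \<in> carrier H. \<psi> x \<in> Sz 1} \<subseteq> S" "S \<subseteq> carrier H"
  shows "generate H S = carrier H"
proof
  show "generate H S \<subseteq> carrier H" using H.generate_incl[OF assms(2)] .
  have *: "inv (f g) \<otimes> f (g * prod_list ss) \<in> generate H S" if "g \<in> G" "set ss \<subseteq> Sz 1" for g ss
    using that
  proof (induction ss arbitrary: g)
    case Nil then show ?case by (simp add: f_closed generate.one)
  next
    case (Cons s ss)
    have s: "s \<in> Sz 1" "s \<in> G" "g * s \<in> G" using Cons.prems Sz_G G_mult by auto
    have p: "g * s * prod_list ss \<in> G"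
    proof -
      have "set ss \<subseteq> G" using Cons.prems Sz_G by auto
      then have "prod_list ss \<in> G" by (induction ss) (auto simp: G_one G_mult)
      then show ?thesis using s G_mult by blast
    qed
    have "inv (f g) \<otimes> f (g * s) \<in> S"
      using f_step[OF Cons.prems(1) s(1)] assms(1) f_closed Cons.prems(1) s by auto
    moreover have "inv (f (g * s)) \<otimes> f (g * s * prod_list ss) \<in> generate H S"
      using Cons.IH[OF s(3)] Cons.prems(2) by simp
    ultimately have "(inv (f g) \<otimes> f (g * s)) \<otimes> (inv (f (g * s)) \<otimes> f (g * s * prod_list ss)) \<in> generate H S"
      by (rule generate.eng[OF generate.incl])
    then show ?case
      using f_closed[OF Cons.prems(1)] f_closed[OF s(3)] f_closed[OF p]
      by (simp add: H.m_assoc H.inv_cancel_left mult.assoc)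
  qed
  show "carrier H \<subseteq> generate H S"
  proof
    fix x assume x: "x \<in> carrier H"
    obtain ss where "set ss \<subseteq> Sz 1" "prod_list ss = \<psi> x"
      using letters_generate[OF psi_G[OF x]] unfolding letters_prod_def by blast
    then show "x \<in> generate H S"
      using *[OF G_one, of ss] f_psi[OF x] f_psi[of \<one>] x by (simp add: psi_one)
  qed
qed

end

lemma (in group) word_section:
  assumes S: "S \<subseteq> carrier G" "generate G S = carrier G"
  obtains \<tau> where "\<And>x. x \<in> carrier G \<Longrightarrow> \<tau> x \<in> carrier (free_group S)"
    "\<And>x. x \<in> carrier G \<Longrightarrow> word_val G (\<tau> x) = x" "\<And>s. s \<in> S \<Longrightarrow> \<tau> s = [(s, False)]"
proof -
  interpret h: group_hom "free_group S" G "word_val G" by (rule word_val_hom[OF S(1)])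
  have l: "[(s, b)] \<in> carrier (free_group S)" if "s \<in> S" for s b
    using that by (simp add: reduced_def)
  have v: "word_val G [(s, False)] = s" if "s \<in> S" for s
    using that S(1) by (auto simp: word_val_Cons word_val_Nil)
  have "S \<subseteq> word_val G ` carrier (free_group S)"
    using l v by (metis imageI subsetI)
  then have "carrier G \<subseteq> word_val G ` carrier (free_group S)"
    unfolding S(2)[symmetric] by (rule generate_subgroup_incl[OF _ h.img_is_subgroup])
  then have "\<forall>x\<in>carrier G. \<exists>w. w \<in> carrier (free_group S) \<and> word_val G w = x" by blast
  then obtain t where t: "\<And>x. x \<in> carrier G \<Longrightarrow> t x \<in> carrier (free_group S) \<and> word_val G (t x) = x"
    by metis
  define \<tau> where "\<tau> x = (if x \<in> S then [(x, False)] else t x)" for x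
  show ?thesis
    by (rule that[of \<tau>]) (use t l v in \<open>auto simp: \<tau>_def\<close>)
qed

context lattice_in
begin

abbreviation fill :: "'h set \<Rightarrow> 'h word set \<Rightarrow> nat \<Rightarrow> 'h word set" where
  "fill S R \<equiv> cost_ball (free_group S) (conjugates (free_group S) R)"

text \<open>The relations among letters: the triangles of bounded size, and the relations that identify
  the formal inverse of a letter with the letter for the inverse.\<close>

definition letter_relations :: "'h set \<Rightarrow> ('h \<Rightarrow> 'h word) \<Rightarrow> nat \<Rightarrow> 'h word set" where
  "letter_relations S \<tau> n = (let F = free_group S; A = {x \<in> carrier H. \<psi> x \<in> Sz n}
     in (\<lambda>(x, y). \<tau> x \<otimes>\<^bsub>F\<^esub> \<tau> y \<otimes>\<^bsub>F\<^esub> inv\<^bsub>F\<^esub> \<tau> (x \<otimes> y)) ` (A \<times> A) \<union>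
        (\<lambda>s. [(s, True)] \<otimes>\<^bsub>F\<^esub> inv\<^bsub>F\<^esub> [(inv s, False)]) ` S)"

lemma finite_letter_relations: "finite S \<Longrightarrow> finite (letter_relations S \<tau> n)"
  using finite_Sz[of n] by (simp add: letter_relations_def Let_def)

lemma letter_relations_subset:
  assumes S: "S \<subseteq> carrier H" "symmetric_in H S"
    and tau: "\<And>x. x \<in> carrier H \<Longrightarrow> \<tau> x \<in> carrier (free_group S)"
      "\<And>x. x \<in> carrier H \<Longrightarrow> word_val H (\<tau> x) = x"
  shows "letter_relations S \<tau> n \<subseteq> relations H S"
proof -
  define F where "F = free_group S"
  interpret h: group_hom F H "word_val H" unfolding F_def by (rule H.word_val_hom[OF S(1)])
  have rel: "w \<in> relations H S \<longleftrightarrow> w \<in> carrier F \<and> word_val H w = \<one>" for w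
    by (simp add: relations_def F_def)
  have t: "\<tau> x \<in> carrier F" if "x \<in> carrier H" for x using tau(1)[OF that] by (simp only: F_def)
  have l: "[(s, b)] \<in> carrier F" if "s \<in> S" for s b using that by (simp add: F_def reduced_def)
  have "\<tau> x \<otimes>\<^bsub>F\<^esub> \<tau> y \<otimes>\<^bsub>F\<^esub> inv\<^bsub>F\<^esub> \<tau> (x \<otimes> y) \<in> relations H S" if "x \<in> carrier H" "y \<in> carrier H" for x y
    unfolding rel using that t[OF that(1)] t[OF that(2)] t[of "x \<otimes> y"] by (simp add: tau(2))
  moreover have "[(s, True)] \<otimes>\<^bsub>F\<^esub> inv\<^bsub>F\<^esub> [(inv s, False)] \<in> relations H S" if s: "s \<in> S" for s
  proof -
    have "s \<in> carrier H" "inv s \<in> S" using s S by (auto simp: symmetric_in_def)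
    then show ?thesis
      unfolding rel using l[OF s, of True] l[of "inv s" False]
      by (simp add: H.word_val_Cons H.word_val_Nil)
  qed
  ultimately show ?thesis by (auto simp: letter_relations_def Let_def F_def simp del: free_group_simps)
qed

text \<open>A relation \<open>w\<close> is turned into a positive word at linear cost, and the positive word is filled
  by the loop theorem.\<close>

lemma relations_quadratic:
  fixes S :: "'h set"
  assumes S: "S \<subseteq> carrier H" "symmetric_in H S" "\<And>s. s \<in> S \<Longrightarrow> \<psi> s \<in> Sz m"
    and R: "R \<subseteq> relations H S"
    and tau: "\<And>x. x \<in> carrier H \<Longrightarrow> \<tau> x \<in> carrier (free_group S)" "\<And>s. s \<in> S \<Longrightarrow> \<tau> s = [(s, False)]"
    and rel: "letter_relations S \<tau> (340 * m + 2) \<subseteq> fill S R M"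
  shows "\<exists>C. \<forall>w\<in>relations H S. w \<in> fill S R (C * (length w)\<^sup>2)"
proof -
  define F where "F = free_group S"
  define N where "N = cost_ball F (conjugates F R)"
  interpret F: group F unfolding F_def by (rule group_free_group)
  have "R \<subseteq> carrier F" using R by (auto simp: relations_def F_def)
  then interpret FN: conj_norm F N unfolding N_def by (rule F.conj_norm_cost_ball)
  have tF: "\<tau> x \<in> carrier F" if "x \<in> carrier H" for x using tau(1)[OF that] by (simp only: F_def)
  have rel': "letter_relations S \<tau> (340 * m + 2) \<subseteq> N M" using rel by (simp only: N_def F_def)
  interpret lattice_cost eps Bv u c0 H \<psi> f F N \<tau> "340 * m + 2" M
  proof unfold_locales
    fix x y assume xy: "x \<in> carrier H" "y \<in> carrier H" "\<psi> x \<in> Sz (340 * m + 2)" "\<psi> y \<in> Sz (340 * m + 2)"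
    have "\<tau> x \<otimes>\<^bsub>F\<^esub> \<tau> y \<otimes>\<^bsub>F\<^esub> inv\<^bsub>F\<^esub> \<tau> (x \<otimes> y) \<in> letter_relations S \<tau> (340 * m + 2)"
      unfolding letter_relations_def Let_def F_def using xy
      by (intro UnI1 image_eqI[where x = "(x, y)"]) auto
    then show "FN.near M (\<tau> x \<otimes>\<^bsub>F\<^esub> \<tau> y) (\<tau> (x \<otimes> y))"
      using rel' tF xy unfolding FN.near_def by blast
  qed (use tF in auto)
  obtain C where C: "\<And>xs. set xs \<subseteq> carrier H \<Longrightarrow> (\<forall>x\<in>set xs. \<psi> x \<in> Sz m) \<Longrightarrow> foldr (\<otimes>) xs \<one> = \<one> \<Longrightarrow>
      foldr (\<lambda>y a. \<tau> y \<otimes>\<^bsub>F\<^esub> a) xs \<one>\<^bsub>F\<^esub> \<in> N (C * (length xs)\<^sup>2)"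
    using lattice_loop_quadratic[of m] by auto
  define pos where "pos l = (if snd l then inv (fst l) else fst l)" for l :: "'h \<times> bool"
  have pos: "pos l \<in> S" if "fst l \<in> S" for l
    using that S(2) by (auto simp: pos_def symmetric_in_def)
  have single: "[l] \<in> carrier F" if "fst l \<in> S" for l
    using that by (cases l) (simp add: F_def reduced_def)
  have letter: "FN.near M [l] (\<tau> (pos l))" if l: "fst l \<in> S" for l
  proof (cases "snd l")
    case True
    then have e: "l = (fst l, True)" "pos l = inv (fst l)" by (cases l; simp add: pos_def)+
    have "[(fst l, True)] \<otimes>\<^bsub>F\<^esub> inv\<^bsub>F\<^esub> [(inv (fst l), False)] \<in> letter_relations S \<tau> (340 * m + 2)"
      unfolding letter_relations_def Let_def F_def using l by blast
    then have "[l] \<otimes>\<^bsub>F\<^esub> inv\<^bsub>F\<^esub> [(pos l, False)] \<in> N M" using rel' e by auto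
    then show ?thesis
      using tau(2)[OF pos[OF l]] single[OF l] single[of "(pos l, False)"] pos[OF l]
      unfolding FN.near_def by simp
  next
    case False
    then have "\<tau> (pos l) = [l]" using tau(2)[OF l] by (cases l) (simp add: pos_def)
    then show ?thesis using FN.near_refl[OF single[OF l]] by simp
  qed
  have "w \<in> N ((M + C) * (length w)\<^sup>2)" if w: "w \<in> relations H S" for w
  proof -
    have wS: "set w \<subseteq> S \<times> UNIV" and red: "reduced w" and val: "word_val H w = \<one>"
      using w by (auto simp: relations_def)
    have wv: "word_val H v = foldr (\<otimes>) (map pos v) \<one>" for v
      by (induction v) (auto simp: H.word_val_Nil H.word_val_Cons pos_def)
    have posS: "set (map pos w) \<subseteq> S" using wS pos by auto
    define p where "p v = foldr (\<lambda>y a. \<tau> y \<otimes>\<^bsub>F\<^esub> a) (map pos v) \<one>\<^bsub>F\<^esub>" for v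
    have "p w \<in> N (C * (length (map pos w))\<^sup>2)"
      unfolding p_def by (rule C) (use posS S(1,3) val wv in auto)
    moreover have "FN.near (M * length v) (foldr cons_red v []) (p v)" if "set v \<subseteq> S \<times> UNIV" for v
      using that
    proof (induction v)
      case Nil then show ?case using FN.near_refl[OF F.one_closed, of 0] by (simp add: F_def p_def)
    next
      case (Cons l v)
      have "FN.near (M + M * length v) ([l] \<otimes>\<^bsub>F\<^esub> foldr cons_red v []) (\<tau> (pos l) \<otimes>\<^bsub>F\<^esub> p v)"
        using Cons by (intro FN.near_mult letter) auto
      moreover have "[l] \<otimes>\<^bsub>F\<^esub> foldr cons_red v [] = foldr cons_red (l # v) []"
        by (simp add: F_def)
      ultimately show ?case by (simp add: p_def)
    qed
    then have "FN.near (M * length w) w (p w)"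
      using wS foldr_cons_red_Nil[OF red] by metis
    ultimately have "FN.near (M * length w + C * (length w)\<^sup>2) w \<one>\<^bsub>F\<^esub>"
      by (intro FN.near_trans[where y = "p w"]) (auto simp: FN.near_def)
    moreover have "M * length w + C * (length w)\<^sup>2 \<le> (M + C) * (length w)\<^sup>2"
      by (simp add: add_mult_distrib power2_eq_square Suc_le_eq)
    ultimately have "FN.near ((M + C) * (length w)\<^sup>2) w \<one>\<^bsub>F\<^esub>" by (rule FN.near_mono)
    then have "w \<in> carrier F" "w \<otimes>\<^bsub>F\<^esub> inv\<^bsub>F\<^esub> \<one>\<^bsub>F\<^esub> \<in> N ((M + C) * (length w)\<^sup>2)"
      by (auto simp only: FN.near_def)
    then show ?thesis by (simp only: F.inv_one F.r_one)
  qed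
  then show ?thesis unfolding N_def F_def by blast
qed

text \<open>A finite set \<open>T\<close> of relations decides whether a set \<open>R\<close> of relators fills all relations
  quadratically. For the finite presentation, \<open>T\<close> itself is taken as \<open>R\<close>; for the Dehn function, \<open>R\<close>
  is the given set of short relations.\<close>

definition filling_test :: "'h set \<Rightarrow> 'h word set \<Rightarrow> bool" where
  "filling_test S T \<longleftrightarrow> (\<forall>R M. R \<subseteq> relations H S \<longrightarrow> T \<subseteq> fill S R M \<longrightarrow>
     (\<exists>C. \<forall>w\<in>relations H S. w \<in> fill S R (C * (length w)\<^sup>2)))"

lemma filling_testD: "filling_test S T \<Longrightarrow> R \<subseteq> relations H S \<Longrightarrow> T \<subseteq> fill S R M \<Longrightarrow>
    \<exists>C. \<forall>w\<in>relations H S. w \<in> fill S R (C * (length w)\<^sup>2)"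
  unfolding filling_test_def by blast

lemma filling_test_exists:
  assumes S: "finite S" "S \<subseteq> carrier H" "symmetric_in H S" "generate H S = carrier H"
  shows "\<exists>T. finite T \<and> T \<subseteq> relations H S \<and> filling_test S T"
proof -
  obtain m where m: "\<And>s. s \<in> S \<Longrightarrow> \<psi> s \<in> Sz m" using finite_size_bound[OF S(1,2)] by blast
  obtain \<tau> where tau: "\<And>x. x \<in> carrier H \<Longrightarrow> \<tau> x \<in> carrier (free_group S)"
    "\<And>x. x \<in> carrier H \<Longrightarrow> word_val H (\<tau> x) = x" "\<And>s. s \<in> S \<Longrightarrow> \<tau> s = [(s, False)]"
    using H.word_section[OF S(2,4)] by blast
  have t: "filling_test S (letter_relations S \<tau> (340 * m + 2))"
    unfolding filling_test_def by (intro allI impI) (rule relations_quadratic[OF S(2,3) m _ tau(1,3)])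
  show ?thesis
    by (intro exI[of _ "letter_relations S \<tau> (340 * m + 2)"] conjI t
          finite_letter_relations[OF S(1)] letter_relations_subset[OF S(2,3) tau(1,2)])
qed

lemma relations_normal:
  assumes "S \<subseteq> carrier H" "R \<subseteq> relations H S"
  shows "normal_closure (free_group S) R \<subseteq> relations H S"
proof -
  interpret F: group "free_group S" by (rule group_free_group)
  interpret h: group_hom "free_group S" H "word_val H" by (rule H.word_val_hom[OF assms(1)])
  have ker: "relations H S = kernel (free_group S) H (word_val H)"
    by (auto simp: relations_def kernel_def)
  have sub: "subgroup (relations H S) (free_group S)" and nor: "relations H S \<lhd> free_group S"
    unfolding ker by (rule h.subgroup_kernel, rule h.normal_kernel)
  have "conjugates (free_group S) R \<subseteq> relations H S"
    using assms(2) nor unfolding conjugates_def F.normal_inv_iff by blast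
  then show ?thesis unfolding normal_closure_def by (rule F.generate_subgroup_incl[OF _ sub])
qed

theorem lattice_finitely_presented: "finitely_presented H"
proof -
  define S where "S = {x \<in> carrier H. \<psi> x \<in> Sz 1} \<union> (\<lambda>x. inv x) ` {x \<in> carrier H. \<psi> x \<in> Sz 1}"
  have S: "finite S" "S \<subseteq> carrier H" "symmetric_in H S"
    using finite_Sz[of 1] by (auto simp: S_def symmetric_in_def)
  have gen: "generate H S = carrier H" by (rule generate_small) (use S in \<open>auto simp: S_def\<close>)
  obtain R where R: "finite R" "R \<subseteq> relations H S"
    and crit: "filling_test S R"
    using filling_test_exists[OF S gen] by blast
  define F where "F = free_group S"
  interpret F: group F unfolding F_def by (rule group_free_group)
  have RF: "R \<subseteq> carrier F" using R by (auto simp: relations_def F_def)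
  have "w \<in> cost_ball F (conjugates F R) 1" if "w \<in> R" for w
  proof -
    have "w \<in> carrier F" using that RF by blast
    then have e: "w = \<one>\<^bsub>F\<^esub> \<otimes>\<^bsub>F\<^esub> w \<otimes>\<^bsub>F\<^esub> inv\<^bsub>F\<^esub> \<one>\<^bsub>F\<^esub>" "w = foldr (\<otimes>\<^bsub>F\<^esub>) [w] \<one>\<^bsub>F\<^esub>" by simp_all
    have "w \<in> conjugates F R" unfolding conjugates_def using that F.one_closed e(1) by blast
    with e(2) show ?thesis unfolding cost_ball_def by (intro CollectI exI[of _ "[w]"]) auto
  qed
  then have "R \<subseteq> fill S R 1" unfolding F_def by blast
  from filling_testD[OF crit R(2) this] obtain C
    where C: "\<And>w. w \<in> relations H S \<Longrightarrow> w \<in> fill S R (C * (length w)\<^sup>2)" by blast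
  have "relations H S \<subseteq> normal_closure F R"
  proof
    fix w assume "w \<in> relations H S"
    then show "w \<in> normal_closure F R"
      unfolding F.normal_closure_cost_ball[OF RF] using C[of w] by (auto simp: F_def)
  qed
  then have "presents H S R"
    using relations_normal[OF S(2) R(2)] S gen R by (auto simp: presents_def F_def)
  then show ?thesis using S R(1) unfolding finitely_presented_def by blast
qed

theorem lattice_quadratic: "quadratic_Dehn_function H"
  unfolding quadratic_Dehn_function_def
proof (intro allI impI)
  fix S r assume a: "finite S \<and> symmetric_in H S \<and> presents H S (short_relations H S r)"
  define R where "R = short_relations H S r"
  have S: "finite S" "S \<subseteq> carrier H" "symmetric_in H S" "generate H S = carrier H"
    and R: "R \<subseteq> relations H S" "normal_closure (free_group S) R = relations H S"
    using a by (auto simp: presents_def R_def)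
  obtain T where T: "finite T" "T \<subseteq> relations H S"
    and crit: "filling_test S T"
    using filling_test_exists[OF S] by blast
  interpret F: group "free_group S" by (rule group_free_group)
  have RF: "R \<subseteq> carrier (free_group S)" using R by (auto simp: relations_def)
  interpret FN: conj_norm "free_group S" "fill S R" by (rule F.conj_norm_cost_ball[OF RF])
  have "\<forall>w\<in>T. \<exists>k. w \<in> fill S R k"
    using T(2) unfolding R(2)[symmetric] F.normal_closure_cost_ball[OF RF] by blast
  then obtain k where k: "\<And>w. w \<in> T \<Longrightarrow> w \<in> fill S R (k w)" by metis
  have "w \<in> fill S R (Max (k ` T))" if "w \<in> T" for w
    using k[OF that] FN.N_mono[of "k w" "Max (k ` T)"] T(1) that by auto
  then have "T \<subseteq> fill S R (Max (k ` T))" by blast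
  from filling_testD[OF crit R(1) this] obtain C
    where "\<And>w. w \<in> relations H S \<Longrightarrow> w \<in> fill S R (C * (length w)\<^sup>2)" by blast
  then have C: "area H S r w \<le> enat (C * (length w)\<^sup>2)" if "w \<in> relations H S" for w
    using that unfolding R_def by (intro area_le)
  have le: "Dehn_function H S r n \<le> enat (C * n\<^sup>2)" for n
    unfolding Dehn_function_def
  proof (rule SUP_least)
    fix w assume w: "w \<in> {w \<in> relations H S. length w \<le> n}"
    then have "C * (length w)\<^sup>2 \<le> C * n\<^sup>2" by (simp add: power_mono)
    then show "area H S r w \<le> enat (C * n\<^sup>2)" using C[of w] w order_trans by fastforce
  qed
  then have fin: "Dehn_function H S r n \<noteq> \<infinity>" for n
    using le[of n] by (cases "Dehn_function H S r n") auto
  have "(\<lambda>n. real (the_enat (Dehn_function H S r n))) \<in> O(\<lambda>n. real n ^ 2)"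
  proof (rule bigoI[of _ "real C"], rule always_eventually, intro allI)
    fix n
    obtain d where d: "Dehn_function H S r n = enat d" using fin[of n] by auto
    have "d \<le> C * n\<^sup>2" using le[of n] by (simp add: d)
    then have "real d \<le> real (C * n\<^sup>2)" unfolding of_nat_le_iff .
    then show "norm (real (the_enat (Dehn_function H S r n))) \<le> real C * norm (real n ^ 2)"
      by (simp add: d)
  qed
  then show "(\<forall>n. Dehn_function H S r n \<noteq> \<infinity>) \<and>
      (\<lambda>n. real (the_enat (Dehn_function H S r n))) \<in> O(\<lambda>n. real n ^ 2)"
    using fin by blast
qed

end

section \<open>The three places of the rational function field\<close>

text \<open>\<open>Ov v\<close> is the valuation ring at \<open>v\<close>. Membership is stated for some fraction, which need not be
  reduced.\<close>

primrec denom_ok :: "place \<Rightarrow> 'k::field poly \<Rightarrow> 'k poly \<Rightarrow> bool" where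
  "denom_ok P0 p q \<longleftrightarrow> poly q 0 \<noteq> 0"
| "denom_ok P1 p q \<longleftrightarrow> poly q 1 \<noteq> 0"
| "denom_ok PI p q \<longleftrightarrow> q \<noteq> 0 \<and> degree p \<le> degree q"

definition Ov :: "place \<Rightarrow> 'k::field poly fract set" where
  "Ov v = {x. \<exists>p q. denom_ok v p q \<and> to_fract q * x = to_fract p}"

primrec pv :: "place \<Rightarrow> 'k::field poly fract" where
  "pv P0 = t_fract" | "pv P1 = t_fract - 1" | "pv PI = inverse t_fract"

definition tu :: "int \<Rightarrow> int \<Rightarrow> 'k::field poly fract" where
  "tu i j = t_fract powi i * (t_fract - 1) powi j"

lemma to_fract_pow: "to_fract (p ^ n) = to_fract p ^ n"
  by (induction n) simp_all

lemma t_minus_1: "t_fract - 1 = to_fract [:-1, 1:]"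
proof -
  have "t_fract - 1 = to_fract ([:0, 1:] - 1 :: 'a poly)" unfolding t_fract_def by simp
  also have "[:0, 1:] - 1 = [:-1, 1 :: 'a:]" by (simp add: one_pCons)
  finally show ?thesis .
qed

lemma t_nonzero [simp]: "t_fract \<noteq> 0"
  unfolding t_fract_def by (simp del: to_fract_0)

lemma t_minus_1_nonzero [simp]: "t_fract - 1 \<noteq> 0"
  unfolding t_minus_1 by simp

lemma t_neq_1 [simp]: "t_fract \<noteq> 1"
  using t_minus_1_nonzero by (metis diff_self)

lemma pv_nonzero [simp]: "pv v \<noteq> 0" by (cases v) auto

lemma denom_ok_mult: "denom_ok v p q \<Longrightarrow> denom_ok v p' q' \<Longrightarrow> denom_ok v (p * p') (q * q')"
  by (cases v) (auto simp: degree_mult_eq intro: order_trans[OF degree_mult_le add_mono])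

lemma denom_ok_add:
  assumes "denom_ok v p q" "denom_ok v p' q'"
  shows "denom_ok v (p * q' + q * p') (q * q')"
proof (cases v)
  case PI
  have "degree (p * q') \<le> degree (q * q')" "degree (q * p') \<le> degree (q * q')"
    using assms PI degree_mult_le[of p q'] degree_mult_le[of q p'] by (auto simp: degree_mult_eq)
  then show ?thesis using assms PI by (simp add: degree_add_le)
qed (use assms in auto)

lemma OvI: "denom_ok v p q \<Longrightarrow> to_fract q * x = to_fract p \<Longrightarrow> x \<in> Ov v"
  by (auto simp: Ov_def)

lemma Ov_one: "1 \<in> Ov v" by (rule OvI[of v 1 1]) (cases v; simp)+

lemma Ov_zero: "0 \<in> Ov v" by (rule OvI[of v 0 1]) (cases v; simp)+

lemma Ov_mult: "x \<in> Ov v \<Longrightarrow> y \<in> Ov v \<Longrightarrow> x * y \<in> Ov v"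
proof -
  assume "x \<in> Ov v" "y \<in> Ov v"
  then obtain p q p' q' where *: "denom_ok v p q" "to_fract q * x = to_fract p"
    "denom_ok v p' q'" "to_fract q' * y = to_fract p'" by (auto simp: Ov_def)
  have "to_fract (q * q') * (x * y) = (to_fract q * x) * (to_fract q' * y)"
    by (simp only: to_fract_mult ac_simps)
  then show ?thesis using * denom_ok_mult by (intro OvI[of v "p * p'" "q * q'"]) simp_all
qed

lemma Ov_add: "x \<in> Ov v \<Longrightarrow> y \<in> Ov v \<Longrightarrow> x + y \<in> Ov v"
proof -
  assume "x \<in> Ov v" "y \<in> Ov v"
  then obtain p q p' q' where *: "denom_ok v p q" "to_fract q * x = to_fract p"
    "denom_ok v p' q'" "to_fract q' * y = to_fract p'" by (auto simp: Ov_def)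
  have "to_fract (q * q') * (x + y) = (to_fract q * x) * to_fract q' + to_fract q * (to_fract q' * y)"
    by (simp add: algebra_simps)
  also have "\<dots> = to_fract (p * q' + q * p')" using * by simp
  finally show ?thesis by (intro OvI[OF denom_ok_add[OF *(1,3)]])
qed

lemma Ov_const: "const_fract c \<in> Ov v"
  by (rule OvI[of v "[:c:]" 1]) (cases v; simp add: const_fract_def)+

lemma Ov_minus: "x \<in> Ov v \<Longrightarrow> - x \<in> Ov v"
proof -
  assume "x \<in> Ov v"
  then have "const_fract (-1) * x \<in> Ov v" by (intro Ov_mult Ov_const)
  moreover have "const_fract (-1) = - (1 :: 'a poly fract)"
    unfolding const_fract_def by (metis one_pCons minus_pCons minus_zero to_fract_1 to_fract_uminus)
  ultimately show ?thesis by simp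
qed

lemma Ov_poly: "v \<noteq> PI \<Longrightarrow> to_fract p \<in> Ov v"
  by (rule OvI[of v p 1]) (cases v; simp)+

lemma t_Ov0: "t_fract \<in> Ov P0" and t_Ov1: "t_fract \<in> Ov P1"
  by (simp_all add: t_fract_def Ov_poly)

lemma t1_Ov0: "t_fract - 1 \<in> Ov P0" and t1_Ov1: "t_fract - 1 \<in> Ov P1"
  by (simp_all only: t_minus_1) (rule Ov_poly; simp)+

lemma it_OvI: "inverse t_fract \<in> Ov PI" and it_Ov1: "inverse t_fract \<in> Ov P1"
  by (rule OvI[of _ 1 "[:0,1:]"]; simp flip: t_fract_def)+

lemma it1_Ov0: "inverse (t_fract - 1) \<in> Ov P0" and it1_OvI: "inverse (t_fract - 1) \<in> Ov PI"
  by (rule OvI[of _ 1 "[:-1,1:]"]; simp flip: t_minus_1)+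

lemma t1t_OvI: "(t_fract - 1) * inverse t_fract \<in> Ov PI"
  by (rule OvI[of _ "[:-1,1:]" "[:0,1:]"]) (simp_all flip: t_minus_1 t_fract_def)

lemma tt1_OvI: "inverse ((t_fract - 1) * inverse t_fract) \<in> Ov PI"
  by (rule OvI[of _ "[:0,1:]" "[:-1,1:]"]) (simp_all flip: t_minus_1 t_fract_def)

lemma pv_Ov: "pv v \<in> Ov v"
  by (cases v) (simp_all add: t_Ov0 t1_Ov1 it_OvI)

lemma Ov_power: "x \<in> Ov v \<Longrightarrow> x ^ n \<in> Ov v"
  by (induction n) (simp_all add: Ov_one Ov_mult)

lemma Ov_powi: "x \<in> Ov v \<Longrightarrow> inverse x \<in> Ov v \<Longrightarrow> x powi n \<in> Ov v"
  by (auto simp: power_int_def Ov_power)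

lemma Ov_powi_nonneg: "x \<in> Ov v \<Longrightarrow> 0 \<le> n \<Longrightarrow> x powi n \<in> Ov v"
  by (auto simp: power_int_def Ov_power)

text \<open>At a finite place one of \<open>t\<close> and \<open>t - 1\<close> is the uniformizer and the other one is a unit. At infinity
  both have a simple pole, and their quotient is a unit.\<close>

lemma tu_pv: "\<exists>e. tu i j = pv v powi pval v i j * e \<and> e \<in> Ov v \<and> inverse e \<in> Ov v"
proof (cases v)
  case P0
  have "(t_fract - 1) powi j \<in> Ov P0" "inverse ((t_fract - 1) powi j) \<in> Ov P0"
    using Ov_powi[OF t1_Ov0 it1_Ov0, of j] Ov_powi[OF t1_Ov0 it1_Ov0, of "-j"]
    by (simp_all add: power_int_minus)
  then show ?thesis using P0 by (auto simp: tu_def)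
next
  case P1
  have "t_fract powi i \<in> Ov P1" "inverse (t_fract powi i) \<in> Ov P1"
    using Ov_powi[OF t_Ov1 it_Ov1, of i] Ov_powi[OF t_Ov1 it_Ov1, of "-i"]
    by (simp_all add: power_int_minus)
  then show ?thesis using P1 by (auto simp: tu_def mult.commute)
next
  case PI
  define e :: "'a poly fract" where "e = ((t_fract - 1) * inverse t_fract) powi j"
  have "inverse e = ((t_fract - 1) * inverse t_fract) powi (- j)"
    unfolding e_def by (simp only: power_int_minus)
  then have "e \<in> Ov PI" "inverse e \<in> Ov PI"
    using Ov_powi[OF t1t_OvI tt1_OvI] by (simp_all only: e_def)
  moreover have "tu i j = inverse t_fract powi (- i - j) * e"
  proof -
    have "inverse t_fract powi (- i - j) = (t_fract powi i * t_fract powi j :: 'a poly fract)"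
      by (simp add: power_int_inverse power_int_add flip: power_int_minus)
    moreover have "t_fract powi j * e = (t_fract - 1) powi j"
    proof -
      have "t_fract * ((t_fract - 1) * inverse t_fract) = (t_fract - 1 :: 'a poly fract)"
        by (simp add: mult.left_commute)
      then show ?thesis unfolding e_def by (simp only: power_int_mult_distrib[symmetric])
    qed
    ultimately show ?thesis by (simp add: tu_def mult.assoc)
  qed
  ultimately show ?thesis using PI by auto
qed

text \<open>The two finite places are treated together: \<open>pt v\<close> is the point, \<open>lin v\<close> its linear polynomial.\<close>

primrec pt :: "place \<Rightarrow> 'k::field" where "pt P0 = 0" | "pt P1 = 1" | "pt PI = 0"

definition lin :: "place \<Rightarrow> 'k::field poly" where "lin v = [:- pt v, 1:]"

lemma finite_place:
  "v \<noteq> PI \<Longrightarrow> pv v = to_fract (lin v)" "v \<noteq> PI \<Longrightarrow> denom_ok v p q \<longleftrightarrow> poly q (pt v) \<noteq> 0"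
proof -
  have "t_fract = to_fract (lin P0 :: 'a poly)" by (simp add: lin_def t_fract_def)
  moreover have "t_fract - 1 = to_fract (lin P1 :: 'a poly)" by (simp add: lin_def, rule t_minus_1)
  ultimately show "v \<noteq> PI \<Longrightarrow> pv v = to_fract (lin v :: 'a poly)" by (cases v) (auto simp only: pv.simps)
  show "v \<noteq> PI \<Longrightarrow> denom_ok v p q \<longleftrightarrow> poly q (pt v) \<noteq> 0" by (cases v) auto
qed

lemma lin_dvd: "lin v dvd p \<longleftrightarrow> poly p (pt v) = 0"
  by (simp only: lin_def poly_eq_0_iff_dvd)

lemma pv_inverse_notin: "inverse (pv v :: 'k::field poly fract) \<notin> Ov v"
proof
  assume "inverse (pv v :: 'k poly fract) \<in> Ov v"
  then obtain p q :: "'k poly" where pq: "denom_ok v p q" "to_fract q * inverse (pv v) = to_fract p"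
    by (auto simp: Ov_def)
  show False
  proof (cases "v = PI")
    case False
    have "to_fract q = to_fract q * inverse (pv v) * pv v" by simp
    also have "\<dots> = to_fract (p * lin v)" 
      by (simp only: pq(2)) (simp only: finite_place(1)[OF False] to_fract_mult)
    finally have "q = p * lin v" by (simp only: to_fract_eq_iff)
    then have "lin v dvd q" by simp
    then show False using pq(1) finite_place(2)[OF False] lin_dvd by blast
  next
    case PI: True
    have "to_fract q * t_fract = to_fract p" using pq(2) PI by simp
    then have "to_fract (q * [:0, 1:]) = to_fract p" by (simp only: t_fract_def to_fract_mult)
    then have "q * [:0, 1:] = p" by (simp only: to_fract_eq_iff)
    then show False using pq PI by (auto simp: degree_mult_eq)
  qed
qed

lemma pv_powi_in:
  assumes a: "(pv v :: 'k::field poly fract) powi n \<in> Ov v"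
  shows "0 \<le> n"
proof (rule ccontr)
  assume "\<not> 0 \<le> n"
  then have n: "0 \<le> - n - 1" by simp
  have "(pv v :: 'k poly fract) powi n * pv v powi (- n - 1) \<in> Ov v"
    by (rule Ov_mult[OF a Ov_powi_nonneg[OF pv_Ov n]])
  also have "pv v powi n * pv v powi (- n - 1) = inverse (pv v :: 'k poly fract)"
    by (simp add: power_int_minus flip: power_int_add)
  finally show False using pv_inverse_notin by blast
qed

lemma pv_exhaust: "\<exists>n::nat. pv v ^ n * x \<in> Ov v"
proof -
  obtain p q where x: "x = Fract p q" "q \<noteq> 0" by (cases x) auto
  then have e: "to_fract q * x = to_fract p" by (simp add: Fract_conv_to_fract)
  show ?thesis
  proof (cases "v = PI")
    case False
    obtain n r where r: "q = lin v ^ n * r" "\<not> lin v dvd r"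
      using order_decomp[OF x(2), of "pt v"] unfolding lin_def by blast
    have "to_fract r * (pv v ^ n * x) = to_fract q * x"
      unfolding r(1) finite_place(1)[OF False] by (simp only: to_fract_mult to_fract_pow ac_simps)
    then show ?thesis using r(2) finite_place(2)[OF False] lin_dvd e
      by (intro exI[of _ n] OvI[of v p r]) auto
  next
    case PI: True
    have "to_fract ([:0, 1:] ^ degree p :: 'a poly) = t_fract ^ degree p"
      by (simp add: to_fract_pow t_fract_def)
    then have "to_fract ([:0, 1:] ^ degree p * q) * (inverse t_fract ^ degree p * x)
        = (t_fract * inverse t_fract) ^ degree p * (to_fract q * x)"
      by (simp only: to_fract_mult power_mult_distrib ac_simps)
    then have "to_fract ([:0, 1:] ^ degree p * q) * (inverse t_fract ^ degree p * x) = to_fract p"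
      by (simp add: e del: to_fract_mult)
    moreover have "degree p \<le> degree ([:0, 1:] ^ degree p * q)" "[:0, 1:] ^ degree p * q \<noteq> 0"
      using x(2) by (simp_all add: degree_mult_eq degree_power_eq)
    ultimately have "inverse t_fract ^ degree p * x \<in> Ov PI"
      by (intro OvI[of PI p "[:0, 1:] ^ degree p * q"]) simp_all
    then show ?thesis unfolding PI by (intro exI[of _ "degree p"]) simp
  qed
qed

text \<open>All three places are rational: the constant is the value at the point, and at infinity the quotient of
  the leading coefficients.\<close>

lemma residue: "y \<in> Ov v \<Longrightarrow> \<exists>c. inverse (pv v) * (y - const_fract c) \<in> Ov v"
proof -
  assume "y \<in> Ov v"
  then obtain p q where pq: "denom_ok v p q" "to_fract q * y = to_fract p" by (auto simp: Ov_def)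
  have e: "to_fract q * (y - const_fract c) = to_fract (p - Polynomial.smult c q)" for c
  proof -
    have "Polynomial.smult c q = q * [:c:]" by simp
    then show ?thesis
      by (simp only: to_fract_diff right_diff_distrib const_fract_def to_fract_mult pq(2))
  qed
  show ?thesis
  proof (cases "v = PI")
    case False
    define c where "c = poly p (pt v) / poly q (pt v)"
    have "poly q (pt v) \<noteq> 0" using pq(1) finite_place(2)[OF False] by blast
    then have "poly (p - Polynomial.smult c q) (pt v) = 0" by (simp add: c_def)
    then obtain r where r: "p - Polynomial.smult c q = lin v * r" using lin_dvd unfolding dvd_def by blast
    have "to_fract q * (inverse (pv v) * (y - const_fract c)) = inverse (pv v) * to_fract (p - Polynomial.smult c q)"
      unfolding e[symmetric] by (rule mult.left_commute)
    also have "\<dots> = inverse (pv v) * (pv v * to_fract r)"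
      unfolding r to_fract_mult finite_place(1)[OF False] ..
    also have "\<dots> = to_fract r" by simp
    finally show ?thesis using finite_place(2)[OF False] pq(1) by (intro exI[of _ c] OvI[of v r q]) auto
  next
    case PI: True
    define c where "c = Polynomial.coeff p (Polynomial.degree q) / Polynomial.lead_coeff q"
    have q: "q \<noteq> 0" "degree p \<le> degree q" using pq PI by auto
    have d: "degree (p - Polynomial.smult c q) \<le> degree q"
      using q by (intro degree_diff_le) auto
    have z: "Polynomial.coeff (p - Polynomial.smult c q) (degree q) = 0" using q by (simp add: c_def)
    have "degree ([:0, 1:] * (p - Polynomial.smult c q)) \<le> degree q"
    proof (cases "p - Polynomial.smult c q = 0")
      case False
      then have "degree (p - Polynomial.smult c q) \<noteq> degree q" using z by (metis leading_coeff_0_iff)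
      then show ?thesis using d False by (simp add: degree_mult_eq)
    qed simp
    moreover have "to_fract q * (t_fract * (y - const_fract c)) = to_fract ([:0, 1:] * (p - Polynomial.smult c q))"
      unfolding to_fract_mult e[symmetric] t_fract_def by (simp add: mult.left_commute)
    ultimately show ?thesis using PI q
      by (intro exI[of _ c] OvI[of _ "[:0, 1:] * (p - Polynomial.smult c q)" q]) simp_all
  qed
qed

section \<open>The ring of functions regular outside the three places\<close>

lemma class_ring_minus: "\<ominus>\<^bsub>class_ring\<^esub> x = - (x :: 'a::ring_1)"
  by (rule abelian_group.minus_equality[OF ring.is_abelian_group[OF ring_class_ring]]) auto

lemma R_closed:
  "0 \<in> ring_t_inv" "1 \<in> ring_t_inv" "x \<in> ring_t_inv \<Longrightarrow> y \<in> ring_t_inv \<Longrightarrow> x + y \<in> ring_t_inv"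
  "x \<in> ring_t_inv \<Longrightarrow> y \<in> ring_t_inv \<Longrightarrow> x * y \<in> ring_t_inv" "x \<in> ring_t_inv \<Longrightarrow> - x \<in> ring_t_inv"
  using subringE(2,3,6,7)[OF subring_ring_t_inv] subringE(5)[OF subring_ring_t_inv, of x]
  by (auto simp: class_ring_minus)

lemma R_gens: "const_fract c \<in> ring_t_inv" "t_fract \<in> ring_t_inv" "inverse t_fract \<in> ring_t_inv"
  "inverse (t_fract - 1) \<in> ring_t_inv" "t_fract - 1 \<in> ring_t_inv"
proof -
  show "const_fract c \<in> ring_t_inv" "t_fract \<in> ring_t_inv" "inverse t_fract \<in> ring_t_inv"
    "inverse (t_fract - 1) \<in> ring_t_inv"
    unfolding ring_t_inv_def by (auto intro: generate_ring.incl)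
  then show "t_fract - 1 \<in> ring_t_inv" using R_closed(3)[OF _ R_closed(5)[OF R_closed(2)], of t_fract] by simp
qed

lemma R_power: "x \<in> ring_t_inv \<Longrightarrow> x ^ n \<in> ring_t_inv"
  by (induction n) (simp_all add: R_closed)

lemma R_tu: "tu i j \<in> ring_t_inv"
  unfolding tu_def by (intro R_closed) (auto simp: power_int_def R_power R_gens)

lemma R_fraction:
  assumes "(x :: 'k::field poly fract) \<in> ring_t_inv"
  shows "\<exists>f i j. x * (t_fract ^ i * (t_fract - 1) ^ j) = to_fract f"
  using assms unfolding ring_t_inv_def
proof (induction rule: generate_ring.induct)
  case one
  show ?case by (intro exI[of _ 1] exI[of _ 0]) simp
next
  case (incl h)
  then consider c where "h = const_fract c" | "h = t_fract" | "h = inverse t_fract"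
    | "h = inverse (t_fract - 1)" by auto
  then show ?case
  proof cases
    case 1 then show ?thesis by (intro exI[of _ "[:c:]"] exI[of _ 0]) (simp add: const_fract_def)
  next
    case 2 then show ?thesis by (intro exI[of _ "[:0,1:]"] exI[of _ 0]) (simp add: t_fract_def)
  next
    case 3 then show ?thesis by (intro exI[of _ 1] exI[of _ 1] exI[of _ 0]) simp
  next
    case 4 then show ?thesis by (intro exI[of _ 1] exI[of _ 0] exI[of _ 1]) simp
  qed
next
  case (a_inv h)
  then obtain f i j where "h * (t_fract ^ i * (t_fract - 1) ^ j) = to_fract f" by blast
  then show ?case by (intro exI[of _ "- f"] exI[of _ i] exI[of _ j]) (simp add: class_ring_minus)
next
  case (eng_add h h')
  then obtain f i j f' i' j' where e: "h * (t_fract ^ i * (t_fract - 1) ^ j) = to_fract f"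
    "h' * (t_fract ^ i' * (t_fract - 1) ^ j') = to_fract f'" by blast
  define a :: "'k poly fract" where "a = t_fract ^ i * (t_fract - 1) ^ j"
  define b :: "'k poly fract" where "b = t_fract ^ i' * (t_fract - 1) ^ j'"
  have ab: "a = to_fract ([:0,1:] ^ i * [:-1,1:] ^ j)" "b = to_fract ([:0,1:] ^ i' * [:-1,1:] ^ j')"
    unfolding a_def b_def t_minus_1 unfolding t_fract_def by (simp_all add: to_fract_pow)
  have "(h + h') * (a * b) = (h * a) * b + a * (h' * b)" by (simp add: algebra_simps)
  also have "\<dots> = to_fract (f * ([:0,1:] ^ i' * [:-1,1:] ^ j') + [:0,1:] ^ i * [:-1,1:] ^ j * f')"
    using e unfolding a_def[symmetric] b_def[symmetric] by (simp add: ab)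
  finally have "\<exists>F. (h + h') * (a * b) = to_fract F" by blast
  moreover have "a * b = t_fract ^ (i + i') * (t_fract - 1) ^ (j + j')"
    by (simp add: a_def b_def power_add)
  ultimately show ?case by auto
next
  case (eng_mult h h')
  then obtain f i j f' i' j' where e: "h * (t_fract ^ i * (t_fract - 1) ^ j) = to_fract f"
    "h' * (t_fract ^ i' * (t_fract - 1) ^ j') = to_fract f'" by blast
  have "(h * h') * (t_fract ^ (i + i') * (t_fract - 1) ^ (j + j'))
      = (h * (t_fract ^ i * (t_fract - 1) ^ j)) * (h' * (t_fract ^ i' * (t_fract - 1) ^ j'))"
    by (simp add: power_add)
  also have "\<dots> = to_fract (f * f')" using e by simp
  finally have "\<exists>f i j. (h * h') * (t_fract ^ i * (t_fract - 1) ^ j) = to_fract f" by blast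
  then show ?case by simp
qed

text \<open>Evaluation at 0 or 1 shows that a factor \<open>t\<close> or \<open>t - 1\<close> of the product divides \<open>f\<close> or \<open>g\<close>.\<close>

lemma divisor_of_t_powers:
  fixes f g :: "'k::field poly"
  assumes "f * g = [:0,1:] ^ m * [:-1,1:] ^ n"
  shows "\<exists>c i j. c \<noteq> 0 \<and> f = Polynomial.smult c ([:0,1:] ^ i * [:-1,1:] ^ j)"
  using assms
proof (induction "m + n" arbitrary: m n f g)
  case 0
  then have fg: "f * g = 1" by simp
  then have nz: "f \<noteq> 0" "g \<noteq> 0" by auto
  then have "degree f = 0" using arg_cong[OF fg, of degree] by (simp add: degree_mult_eq)
  then obtain c where "f = [:c:]" by (elim degree_eq_zeroE)
  moreover from this have "c \<noteq> 0" using nz by simp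
  ultimately show ?case by (intro exI[of _ c] exI[of _ 0]) simp
next
  case (Suc k)
  have split: ?case if a01: "a \<in> {0, 1}" and fg: "f * g = [:-a, 1:] * h"
      and h: "h = [:0,1:] ^ m' * [:-1,1:] ^ n'" and k: "k = m' + n'" for a h m' n'
  proof -
    have "poly (f * g) a = 0" unfolding fg by simp
    then consider "[:-a, 1:] dvd f" | "[:-a, 1:] dvd g"
      by (auto simp: poly_eq_0_iff_dvd)
    then show ?case
    proof cases
      case 1
      then obtain f' where f': "f = [:-a, 1:] * f'" by (elim dvdE)
      have "[:-a, 1:] * (f' * g) = [:-a, 1:] * h" using fg f' by (simp only: mult.assoc)
      then have "f' * g = h" by (subst (asm) mult_left_cancel) simp_all
      then obtain c i j where c: "c \<noteq> 0" "f' = Polynomial.smult c ([:0,1:] ^ i * [:-1,1:] ^ j)"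
        using Suc.hyps(1)[OF k] h by blast
      show ?thesis
      proof (cases "a = 0")
        case True
        then have "f = Polynomial.smult c ([:0,1:] ^ Suc i * [:-1,1:] ^ j)" by (simp only: f' c power_Suc mult_smult_right mult.assoc minus_zero)
        then show ?thesis using c(1) by blast
      next
        case False
        then have a: "a = 1" using a01 by simp
        have "f = Polynomial.smult c ([:0,1:] ^ i * [:-1,1:] ^ Suc j)"
          by (simp only: f' c a power_Suc mult_smult_right mult.left_commute)
        then show ?thesis using c(1) by blast
      qed
    next
      case 2
      then obtain g' where g': "g = [:-a, 1:] * g'" by (elim dvdE)
      have "[:-a, 1:] * (f * g') = [:-a, 1:] * h" using fg g' by (simp only: mult.left_commute)
      then have "f * g' = h" by (subst (asm) mult_left_cancel) simp_all
      then show ?thesis using Suc.hyps(1)[OF k] h by blast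
    qed
  qed
  show ?case
  proof (cases m)
    case 0
    then obtain n' where "n = Suc n'" using Suc.hyps(2) by (cases n) auto
    then show ?thesis using split[of 1 "[:0,1:] ^ 0 * [:-1,1:] ^ n'" 0 n'] 0 Suc by simp
  next
    case (Suc m')
    then show ?thesis using split[of 0 "[:0,1:] ^ m' * [:-1,1:] ^ n" m' n] Suc.prems Suc.hyps(2)
      by (simp only: power_Suc mult.assoc minus_zero) simp
  qed
qed

lemma const_fract_mult: "const_fract c * const_fract d = const_fract (c * d)"
  unfolding const_fract_def to_fract_mult[symmetric] by simp

lemma const_fract_one: "const_fract 1 = 1"
  unfolding const_fract_def by (metis one_pCons to_fract_1)

lemma const_fract_inverse: "c \<noteq> 0 \<Longrightarrow> const_fract c * const_fract (inverse c) = 1"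
  by (simp add: const_fract_mult const_fract_one)

lemma tu_add: "tu i j * tu i' j' = tu (i + i') (j + j')"
  by (simp add: tu_def power_int_add)

lemma tu_zero: "tu 0 0 = 1" by (simp add: tu_def)

lemma tu_nonzero: "tu i j \<noteq> 0" by (simp add: tu_def)

definition cc :: "'a \<Rightarrow> place \<Rightarrow> 'a" where "cc x = (\<lambda>_. x)"

definition eps3 :: "place \<Rightarrow> place \<Rightarrow> 'k::field poly fract" where
  "eps3 v w = (if w = v then 1 else 0)"

definition Bv3 :: "place \<Rightarrow> int \<Rightarrow> (place \<Rightarrow> 'k::field poly fract) set" where
  "Bv3 v n = {x. (\<forall>w. w \<noteq> v \<longrightarrow> x w = 0) \<and> pv v powi n * x v \<in> Ov v}"

definition c03 :: "(place \<Rightarrow> 'k::field poly fract) set" where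
  "c03 = {cc (const_fract c) | c. c \<noteq> 0}"

lemma cc_simps: "cc (x * y) = cc x * cc y" "cc 1 = 1" "cc x v = x"
  by (simp_all add: cc_def fun_eq_iff)

lemma places_rational: "places (eps3 :: place \<Rightarrow> place \<Rightarrow> 'k::field poly fract) Bv3 (\<lambda>i j. cc (tu i j)) c03"
proof
  fix v w :: place and m n i j i' j' :: int and x y c d :: "place \<Rightarrow> 'k poly fract"
  show "0 \<in> Bv3 v n" by (simp add: Bv3_def Ov_zero)
  show "x + y \<in> Bv3 v n" if "x \<in> Bv3 v n" "y \<in> Bv3 v n"
    using that by (simp add: Bv3_def distrib_left Ov_add)
  show "- x \<in> Bv3 v n" if "x \<in> Bv3 v n"
    using that Ov_minus[of "pv v powi n * x v" v] by (simp add: Bv3_def)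
  show "x * y \<in> Bv3 v (m + n)" if "x \<in> Bv3 v m" "y \<in> Bv3 v n"
  proof -
    have "(pv v powi m * x v) * (pv v powi n * y v) \<in> Ov v"
      by (rule Ov_mult) (use that in \<open>auto simp: Bv3_def\<close>)
    then show ?thesis using that by (simp add: Bv3_def power_int_add ac_simps)
  qed
  show "Bv3 v m \<subseteq> (Bv3 v n :: (place \<Rightarrow> 'k poly fract) set)" if "m \<le> n"
  proof
    fix z :: "place \<Rightarrow> 'k poly fract" assume z: "z \<in> Bv3 v m"
    have "pv v powi (n - m) * (pv v powi m * z v) \<in> Ov v"
      by (rule Ov_mult[OF Ov_powi_nonneg[OF pv_Ov]]) (use z that in \<open>auto simp: Bv3_def\<close>)
    moreover have "pv v powi (n - m) * (pv v powi m * z v) = pv v powi n * z v"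
      by (simp flip: mult.assoc power_int_add)
    ultimately show "z \<in> Bv3 v n" using z by (simp add: Bv3_def)
  qed
  show "eps3 v * x = x" if "x \<in> Bv3 v n"
    using that by (auto simp: Bv3_def eps3_def fun_eq_iff)
  show "\<exists>n. eps3 v * x \<in> Bv3 v n"
  proof -
    obtain k :: nat where "pv v ^ k * x v \<in> Ov v" using pv_exhaust by blast
    then show ?thesis by (intro exI[of _ "int k"]) (simp add: Bv3_def eps3_def)
  qed
  show "(eps3 v :: place \<Rightarrow> 'k poly fract) \<in> Bv3 v 0" by (simp add: Bv3_def eps3_def Ov_one)
  show "(eps3 v :: place \<Rightarrow> 'k poly fract) * eps3 w = 0" if "v \<noteq> w"
    using that by (simp add: eps3_def fun_eq_iff)
  show "(eps3 P0 :: place \<Rightarrow> 'k poly fract) + eps3 P1 + eps3 PI = 1"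
  proof
    fix w show "((eps3 P0 :: place \<Rightarrow> 'k poly fract) + eps3 P1 + eps3 PI) w = 1 w"
      by (cases w) (simp_all add: eps3_def)
  qed
  show "cc (tu i j :: 'k poly fract) * cc (tu i' j') = cc (tu (i + i') (j + j'))"
    by (simp add: tu_add flip: cc_simps(1))
  show "cc (tu 0 0 :: 'k poly fract) = 1" by (simp add: tu_zero cc_simps)
  show "cc (tu i j) * x \<in> Bv3 v (n - pval v i j)" if x: "x \<in> Bv3 v n"
  proof -
    obtain e :: "'k poly fract" where e: "tu i j = pv v powi pval v i j * e" "e \<in> Ov v" using tu_pv by blast
    have "pv v powi (n - pval v i j) * (tu i j * x v) = (pv v powi (n - pval v i j) * pv v powi pval v i j) * (e * x v)"
      by (simp only: e ac_simps)
    also have "pv v powi (n - pval v i j) * pv v powi pval v i j = (pv v powi n :: 'k poly fract)"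
      by (simp flip: power_int_add)
    also have "pv v powi n * (e * x v) = e * (pv v powi n * x v)" by (rule mult.left_commute)
    also have "\<dots> \<in> Ov v" by (rule Ov_mult[OF e(2)]) (use x in \<open>auto simp: Bv3_def\<close>)
    finally show ?thesis using x by (simp add: Bv3_def cc_simps)
  qed
  show "1 \<in> (c03 :: (place \<Rightarrow> 'k poly fract) set)"
    unfolding c03_def by (intro CollectI exI[of _ 1]) (simp add: const_fract_one cc_simps)
  show "c * d \<in> c03" if cd: "c \<in> c03" "d \<in> c03"
  proof -
    obtain a b where "c = cc (const_fract a)" "a \<noteq> 0" "d = cc (const_fract b)" "b \<noteq> 0"
      using cd unfolding c03_def by blast
    then have "c * d = cc (const_fract (a * b))" "a * b \<noteq> 0"
      by (simp_all add: const_fract_mult flip: cc_simps(1))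
    then show ?thesis unfolding c03_def by blast
  qed
  show "\<exists>d\<in>c03. c * d = 1" if c: "c \<in> c03"
  proof -
    obtain a where a: "c = cc (const_fract a)" "a \<noteq> 0" using c unfolding c03_def by blast
    then have "c * cc (const_fract (inverse a)) = 1"
      by (simp add: const_fract_inverse cc_simps(2) flip: cc_simps(1))
    moreover have "cc (const_fract (inverse a)) \<in> c03" using a(2) unfolding c03_def by auto
    ultimately show ?thesis by blast
  qed
  show "eps3 v * c \<in> Bv3 v 0" if "c \<in> c03"
    using that by (auto simp: c03_def Bv3_def eps3_def cc_simps Ov_const)
  show "- pval v i j \<le> n" if c: "c \<in> c03" and m: "eps3 v * (c * cc (tu i j)) \<in> Bv3 v n"
  proof -
    obtain a where a: "c = cc (const_fract a)" "a \<noteq> 0" using c unfolding c03_def by blast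
    obtain e :: "'k poly fract" where e: "tu i j = pv v powi pval v i j * e" "inverse e \<in> Ov v" using tu_pv by blast
    have e0: "e \<noteq> 0" using e(1) tu_nonzero[of i j] by auto
    have "pv v powi n * (const_fract a * tu i j) \<in> Ov v"
      using m by (simp add: Bv3_def eps3_def a(1) cc_simps)
    then have "const_fract (inverse a) * inverse e * (pv v powi n * (const_fract a * tu i j)) \<in> Ov v"
      by (rule Ov_mult[OF Ov_mult[OF Ov_const e(2)]])
    also have "const_fract (inverse a) * inverse e * (pv v powi n * (const_fract a * tu i j))
        = (const_fract a * const_fract (inverse a)) * (e * inverse e) * (pv v powi n * pv v powi pval v i j)"
      by (simp only: e(1) ac_simps)
    also have "\<dots> = pv v powi (n + pval v i j)"
      using e0 a(2) by (simp add: const_fract_inverse power_int_add)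
    finally show ?thesis using pv_powi_in by fastforce
  qed
qed

text \<open>The coefficients of the principal part at \<open>v\<close> are removed one by one. The powers of the inverse of the
  uniformizer have no poles at the other two places.\<close>

lemma approx_at:
  fixes x :: "'k::field poly fract"
  assumes "pv v ^ n * x \<in> Ov v"
  shows "\<exists>r\<in>ring_t_inv. x - r \<in> Ov v \<and> (\<forall>w. w \<noteq> v \<longrightarrow> r \<in> Ov w)"
  using assms
proof (induction n arbitrary: x)
  case 0
  then show ?case by (intro bexI[of _ 0]) (simp_all add: R_closed Ov_zero)
next
  case (Suc n)
  obtain c where c: "inverse (pv v) * (pv v ^ Suc n * x - const_fract c) \<in> Ov v"
    using residue[OF Suc.prems] by blast
  define s where "s = const_fract c * inverse (pv v) ^ Suc n"
  have "inverse (pv v) * (pv v ^ Suc n * x - const_fract c) = pv v ^ n * (x - s)"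
    by (simp add: s_def right_diff_distrib power_inverse field_simps)
  then obtain r where r: "r \<in> ring_t_inv" "x - s - r \<in> Ov v" "\<And>w. w \<noteq> v \<Longrightarrow> r \<in> Ov w"
    using Suc.IH[of "x - s"] c by auto
  have ip: "inverse (pv v :: 'k poly fract) \<in> ring_t_inv" "\<And>w. w \<noteq> v \<Longrightarrow> inverse (pv v :: 'k poly fract) \<in> Ov w"
  proof -
    show "inverse (pv v :: 'k poly fract) \<in> ring_t_inv" by (cases v) (simp_all add: R_gens)
    show "inverse (pv v :: 'k poly fract) \<in> Ov w" if "w \<noteq> v" for w
      using that by (cases v; cases w)
        (simp_all add: it_Ov1 it_OvI it1_Ov0 it1_OvI t_Ov0 t_Ov1)
  qed
  have s: "s \<in> ring_t_inv" "\<And>w. w \<noteq> v \<Longrightarrow> s \<in> Ov w"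
    unfolding s_def using ip by (auto intro!: R_closed R_power R_gens Ov_mult Ov_power Ov_const)
  show ?case
    using r s by (intro bexI[of _ "s + r"]) (auto simp: R_closed Ov_add diff_diff_add)
qed

lemma approx: "\<exists>r\<in>ring_t_inv. \<forall>v. (x :: place \<Rightarrow> 'k::field poly fract) v - r \<in> Ov v"
proof -
  have "\<exists>r\<in>ring_t_inv. x v - r \<in> Ov v \<and> (\<forall>w. w \<noteq> v \<longrightarrow> r \<in> Ov w)" for v
    using pv_exhaust[of v "x v"] approx_at by blast
  then obtain r where r: "\<And>v. r v \<in> ring_t_inv" "\<And>v. x v - r v \<in> Ov v" "\<And>v w. w \<noteq> v \<Longrightarrow> r v \<in> Ov w"
    by metis
  have d: "a - b \<in> Ov v" if "a \<in> Ov v" "b \<in> Ov v" for a b :: "'k poly fract" and v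
    using Ov_add[OF that(1) Ov_minus[OF that(2)]] by simp
  have "x v - (r P0 + r P1 + r PI) \<in> Ov v" for v
  proof (cases v)
    case P0
    have "x P0 - r P0 - r P1 - r PI \<in> Ov P0" by (intro d r) auto
    then show ?thesis using P0 by (simp add: algebra_simps)
  next
    case P1
    have "x P1 - r P1 - r P0 - r PI \<in> Ov P1" by (intro d r) auto
    then show ?thesis using P1 by (simp add: algebra_simps)
  next
    case PI
    have "x PI - r PI - r P0 - r P1 \<in> Ov PI" by (intro d r) auto
    then show ?thesis using PI by (simp add: algebra_simps)
  qed
  then show ?thesis using r(1) R_closed(3) by blast
qed

lemma finite_degree_le:
  assumes "finite (UNIV :: 'k::field set)"
  shows "finite {p :: 'k poly. degree p \<le> n}"
proof (rule finite_subset)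
  show "{p :: 'k poly. degree p \<le> n} \<subseteq> Poly ` {xs. set xs \<subseteq> UNIV \<and> length xs \<le> Suc n}"
  proof
    fix p :: "'k poly" assume "p \<in> {p. degree p \<le> n}"
    then have "length (coeffs p) \<le> Suc n" by (cases "p = 0") (simp_all add: length_coeffs)
    then show "p \<in> Poly ` {xs. set xs \<subseteq> UNIV \<and> length xs \<le> Suc n}"
      by (intro image_eqI[where x = "coeffs p"]) simp_all
  qed
  show "finite (Poly ` {xs. set xs \<subseteq> (UNIV :: 'k set) \<and> length xs \<le> Suc n})"
    using finite_lists_length_le[OF assms] by blast
qed

text \<open>If \<open>x\<close> has no pole at \<open>v\<close>, then \<open>f\<close> vanishes there, and one factor can be cancelled.\<close>

lemma cancel_pole:
  fixes x :: "'k::field poly fract"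
  assumes "x * (pv v ^ n * to_fract h) = to_fract f" "x \<in> Ov v" "v \<noteq> PI"
  shows "\<exists>g. x * to_fract h = to_fract g"
  using assms(1)
proof (induction n arbitrary: f)
  case 0 then show ?case by auto
next
  case (Suc n)
  note pv = finite_place(1)[OF assms(3)]
  obtain p q where pq: "poly q (pt v) \<noteq> 0" "to_fract q * x = to_fract p"
    using assms(2) finite_place(2)[OF assms(3)] by (auto simp: Ov_def)
  have "to_fract (q * f) = (to_fract q * x) * (pv v ^ Suc n * to_fract h)"
    by (simp only: to_fract_mult Suc.prems[symmetric] ac_simps)
  also have "\<dots> = to_fract p * (pv v ^ Suc n * to_fract h)" by (simp only: pq(2))
  also have "\<dots> = to_fract (lin v * (p * (lin v ^ n * h)))"
    by (simp only: pv to_fract_mult to_fract_pow power_Suc ac_simps)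
  finally have "q * f = lin v * (p * (lin v ^ n * h))" by (simp only: to_fract_eq_iff)
  then have "lin v dvd q * f" by simp
  then have "lin v dvd f" using pq(1) unfolding lin_dvd by simp
  then obtain g where g: "f = lin v * g" by (elim dvdE)
  have "pv v * (x * (pv v ^ n * to_fract h)) = pv v * to_fract g"
    using Suc.prems unfolding g to_fract_mult pv[symmetric] power_Suc by (simp only: ac_simps)
  then show ?case using Suc.IH[of g] by simp
qed

lemma regular_polynomial:
  fixes x :: "'k::field poly fract"
  assumes "x * (t_fract ^ i * (t_fract - 1) ^ j) = to_fract f" "x \<in> Ov P0" "x \<in> Ov P1"
  shows "\<exists>f. x = to_fract f"
proof -
  have "x * (pv P0 ^ i * to_fract ([:-1, 1:] ^ j)) = to_fract f"
    using assms(1) by (simp only: pv.simps to_fract_pow t_minus_1)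
  then obtain g where "x * to_fract ([:-1, 1:] ^ j) = to_fract g" using cancel_pole assms(2) by blast
  then have "x * (pv P1 ^ j * to_fract 1) = to_fract g" by (simp only: pv.simps to_fract_pow t_minus_1 to_fract_1 mult_1_right)
  then show ?thesis using cancel_pole[of x P1 j 1 g] assms(3) by simp
qed

text \<open>Multiplication by \<open>t\<^sup>n (t - 1)\<^sup>n\<close> clears the poles at 0 and 1, and the pole at infinity bounds the degree
  of the resulting polynomial.\<close>

lemma finite_R_bounded:
  assumes fin: "finite (UNIV :: 'k::field set)"
  shows "finite {x :: 'k poly fract. x \<in> ring_t_inv \<and> (\<forall>v. pv v ^ n * x \<in> Ov v)}"
proof (rule finite_subset)
  define s :: "'k poly fract" where "s = t_fract ^ n * (t_fract - 1) ^ n"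
  have s0: "s \<noteq> 0" by (simp add: s_def)
  show "finite ((\<lambda>f. to_fract f / s) ` {f :: 'k poly. degree f \<le> 3 * n})"
    using finite_degree_le[OF fin] by blast
  show "{x :: 'k poly fract. x \<in> ring_t_inv \<and> (\<forall>v. pv v ^ n * x \<in> Ov v)}
      \<subseteq> (\<lambda>f. to_fract f / s) ` {f. degree f \<le> 3 * n}"
  proof
    fix x :: "'k poly fract" assume "x \<in> {x. x \<in> ring_t_inv \<and> (\<forall>v. pv v ^ n * x \<in> Ov v)}"
    then have x: "x \<in> ring_t_inv" "pv v ^ n * x \<in> Ov v" for v by auto
    define y where "y = x * s"
    have "y \<in> ring_t_inv" unfolding y_def s_def by (intro R_closed R_power R_gens x)
    then obtain f i j where f: "y * (t_fract ^ i * (t_fract - 1) ^ j) = to_fract f" using R_fraction by blast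
    have "(t_fract - 1) ^ n * (t_fract ^ n * x) \<in> Ov P0"
      using Ov_mult[OF Ov_power[OF t1_Ov0] x(2)[of P0], of n] by simp
    then have y0: "y \<in> Ov P0" unfolding y_def s_def by (simp only: ac_simps)
    have "t_fract ^ n * ((t_fract - 1) ^ n * x) \<in> Ov P1"
      using Ov_mult[OF Ov_power[OF t_Ov1] x(2)[of P1], of n] by simp
    then have y1: "y \<in> Ov P1" unfolding y_def s_def by (simp only: ac_simps)
    obtain g where g: "y = to_fract g" using regular_polynomial[OF f y0 y1] by blast
    have "((t_fract - 1) * inverse t_fract) ^ n * (inverse t_fract ^ n * x) \<in> Ov PI"
      using Ov_mult[OF Ov_power[OF t1t_OvI] x(2)[of PI], of n] by simp
    then obtain p q where pq: "q \<noteq> 0" "degree p \<le> degree q"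
      "to_fract q * (((t_fract - 1) * inverse t_fract) ^ n * (inverse t_fract ^ n * x)) = to_fract p"
      by (auto simp: Ov_def)
    have "y = ((t_fract - 1) * inverse t_fract) ^ n * (inverse t_fract ^ n * x) * t_fract ^ (3 * n)"
    proof -
      have "t_fract ^ (3 * n) = t_fract ^ n * t_fract ^ n * (t_fract ^ n :: 'k poly fract)"
      proof -
        have "3 * n = n + n + n" by simp
        then show ?thesis by (simp only: power_add)
      qed
      then have "((t_fract - 1) * inverse t_fract) ^ n * (inverse t_fract ^ n * x) * t_fract ^ (3 * n)
          = y * (inverse t_fract ^ n * t_fract ^ n) * (inverse t_fract ^ n * t_fract ^ n)"
        unfolding y_def s_def by (simp only: power_mult_distrib ac_simps)
      also have "inverse t_fract ^ n * t_fract ^ n = (1 :: 'k poly fract)"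
        by (simp flip: power_mult_distrib)
      finally show ?thesis by simp
    qed
    then have "to_fract q * to_fract g = to_fract p * t_fract ^ (3 * n)"
      unfolding pq(3)[symmetric] g[symmetric] by (simp only: mult.assoc)
    also have "t_fract ^ (3 * n) = to_fract ([:0, 1:] ^ (3 * n) :: 'k poly)"
      by (simp add: to_fract_pow t_fract_def)
    finally have qg: "q * g = p * [:0, 1:] ^ (3 * n)" by (simp only: to_fract_mult[symmetric] to_fract_eq_iff)
    have "degree g \<le> 3 * n"
    proof (cases "g = 0")
      case False
      have "p \<noteq> 0" using qg pq(1) False by auto
      then have "degree q + degree g = degree p + 3 * n"
        using arg_cong[OF qg, of degree] False pq(1) by (simp add: degree_mult_eq degree_power_eq)
      then show ?thesis using pq(2) by simp
    qed simp
    moreover have "x = to_fract g / s" using g s0 by (simp add: y_def field_simps)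
    ultimately show "x \<in> (\<lambda>f. to_fract f / s) ` {f. degree f \<le> 3 * n}" by blast
  qed
qed

lemma R_units:
  fixes a b :: "'k::field poly fract"
  assumes "a \<in> ring_t_inv" "b \<in> ring_t_inv" "b * a = 1"
  shows "\<exists>c i j. c \<noteq> 0 \<and> a = const_fract c * tu i j"
proof -
  obtain f i j where f: "a * (t_fract ^ i * (t_fract - 1) ^ j) = to_fract f" using R_fraction[OF assms(1)] by blast
  obtain g i' j' where g: "b * (t_fract ^ i' * (t_fract - 1) ^ j') = to_fract g" using R_fraction[OF assms(2)] by blast
  have "to_fract (f * g) = (b * a) * (t_fract ^ (i + i') * (t_fract - 1) ^ (j + j'))"
    by (simp only: to_fract_mult f[symmetric] g[symmetric] power_add ac_simps)
  also have "\<dots> = to_fract ([:0, 1:] ^ (i + i') * [:-1, 1:] ^ (j + j'))"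
    by (simp only: assms(3) to_fract_mult to_fract_pow t_minus_1 mult_1) (simp only: t_fract_def)
  finally have "f * g = [:0, 1:] ^ (i + i') * [:-1, 1:] ^ (j + j')" by (simp only: to_fract_eq_iff)
  then obtain c k l where c: "c \<noteq> 0" "f = Polynomial.smult c ([:0, 1:] ^ k * [:-1, 1:] ^ l)"
    using divisor_of_t_powers by blast
  have "f = [:c:] * ([:0, 1:] ^ k * [:-1, 1:] ^ l)" using c by simp
  then have "to_fract f = const_fract c * (t_fract ^ k * (t_fract - 1) ^ l)"
    by (simp only: const_fract_def to_fract_mult to_fract_pow t_minus_1) (simp only: t_fract_def)
  then have "a * tu i j = const_fract c * tu k l" using f by (simp add: tu_def)
  then have "a * (tu i j * tu (- i) (- j)) = const_fract c * (tu k l * tu (- i) (- j))"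
    by (simp only: mult.assoc[symmetric])
  then have "a = const_fract c * tu (int k - int i) (int l - int j)"
    by (simp add: tu_add tu_zero)
  then show ?thesis using c(1) by blast
qed

section \<open>The lattice\<close>

abbreviation (input) Gam :: "'k::field poly fract mat monoid" where "Gam \<equiv> A4 ring_t_inv"

definition Runits :: "'k::field poly fract set" where
  "Runits = {a \<in> ring_t_inv. inverse a \<in> ring_t_inv \<and> a \<noteq> 0}"

lemma Units_R: "a \<in> Units (class_ring\<lparr>carrier := ring_t_inv\<rparr>) \<longleftrightarrow> a \<in> Runits"
proof -
  have "a \<in> Units (class_ring\<lparr>carrier := ring_t_inv\<rparr>) \<longleftrightarrow> a \<in> ring_t_inv \<and> (\<exists>y\<in>ring_t_inv. y * a = 1)"
    by (auto simp: Units_def mult.commute)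
  also have "\<dots> \<longleftrightarrow> a \<in> Runits"
  proof
    assume a: "a \<in> ring_t_inv \<and> (\<exists>y\<in>ring_t_inv. y * a = 1)"
    then obtain y where y: "y \<in> ring_t_inv" "y * a = 1" by blast
    then have "inverse a = y" "a \<noteq> 0" by (auto intro: inverse_unique simp: mult.commute)
    then show "a \<in> Runits" using a y by (simp add: Runits_def)
  next
    assume "a \<in> Runits"
    then show "a \<in> ring_t_inv \<and> (\<exists>y\<in>ring_t_inv. y * a = 1)"
      by (auto simp: Runits_def intro!: bexI[of _ "inverse a"])
  qed
  finally show ?thesis .
qed

lemma A4_mem: "M \<in> carrier Gam \<longleftrightarrow> M \<in> carrier_mat 4 4 \<and>
    (\<forall>i\<in>{0,1,2,3}. \<forall>j\<in>{0,1,2,3}. (j < i \<longrightarrow> M $$ (i,j) = 0) \<and> M $$ (i,j) \<in> ring_t_inv) \<and>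
    M $$ (0,0) = 1 \<and> M $$ (3,3) = 1 \<and> M $$ (1,1) \<in> Runits \<and> M $$ (2,2) \<in> Runits"
  unfolding A4_def upper_triangular_def Units_R
  by (rule iffI) (auto simp: less_4_iff)

definition embed :: "'k::field poly fract mat \<Rightarrow> (place \<Rightarrow> 'k poly fract) ut" where
  "embed M = UT (cc (M $$ (1,1))) (cc (inverse (M $$ (1,1)))) (cc (M $$ (2,2)))
     (cc (inverse (M $$ (2,2)))) (cc (M $$ (0,1))) (cc (M $$ (0,2))) (cc (M $$ (0,3)))
     (cc (M $$ (1,2))) (cc (M $$ (1,3))) (cc (M $$ (2,3)))"

definition mk :: "'a \<Rightarrow> 'a \<Rightarrow> 'a \<Rightarrow> 'a \<Rightarrow> 'a \<Rightarrow> 'a \<Rightarrow> 'a \<Rightarrow> 'a \<Rightarrow> 'a::zero_neq_one mat" where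
  "mk a b x12 x13 x14 x23 x24 x34 = mat 4 4 (\<lambda>(i,j).
     [[1, x12, x13, x14], [0, a, x23, x24], [0, 0, b, x34], [0, 0, 0, 1]] ! i ! j)"

lemma mk_index:
  "mk a b x12 x13 x14 x23 x24 x34 $$ (0,0) = 1" "mk a b x12 x13 x14 x23 x24 x34 $$ (0,1) = x12"
  "mk a b x12 x13 x14 x23 x24 x34 $$ (0,2) = x13" "mk a b x12 x13 x14 x23 x24 x34 $$ (0,3) = x14"
  "mk a b x12 x13 x14 x23 x24 x34 $$ (1,0) = 0" "mk a b x12 x13 x14 x23 x24 x34 $$ (1,1) = a"
  "mk a b x12 x13 x14 x23 x24 x34 $$ (1,2) = x23" "mk a b x12 x13 x14 x23 x24 x34 $$ (1,3) = x24"
  "mk a b x12 x13 x14 x23 x24 x34 $$ (2,0) = 0" "mk a b x12 x13 x14 x23 x24 x34 $$ (2,1) = 0"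
  "mk a b x12 x13 x14 x23 x24 x34 $$ (2,2) = b" "mk a b x12 x13 x14 x23 x24 x34 $$ (2,3) = x34"
  "mk a b x12 x13 x14 x23 x24 x34 $$ (3,0) = 0" "mk a b x12 x13 x14 x23 x24 x34 $$ (3,1) = 0"
  "mk a b x12 x13 x14 x23 x24 x34 $$ (3,2) = 0" "mk a b x12 x13 x14 x23 x24 x34 $$ (3,3) = 1"
  by (simp_all add: mk_def numeral_2_eq_2 numeral_3_eq_3)

lemma mk_carrier:
  assumes "a \<in> Runits" "b \<in> Runits" "x12 \<in> ring_t_inv" "x13 \<in> ring_t_inv" "x14 \<in> ring_t_inv"
    "x23 \<in> ring_t_inv" "x24 \<in> ring_t_inv" "x34 \<in> ring_t_inv"
  shows "mk a b x12 x13 x14 x23 x24 x34 \<in> carrier Gam"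
proof -
  have "mk a b x12 x13 x14 x23 x24 x34 \<in> carrier_mat 4 4" by (simp add: mk_def)
  moreover have "a \<in> ring_t_inv" "b \<in> ring_t_inv" using assms by (auto simp: Runits_def)
  ultimately show ?thesis
    unfolding A4_mem using assms by (simp add: mk_index mk_index[simplified] R_closed)
qed

lemma embed_mk: "embed (mk a b x12 x13 x14 x23 x24 x34) =
    UT (cc a) (cc (inverse a)) (cc b) (cc (inverse b)) (cc x12) (cc x13) (cc x14) (cc x23) (cc x24) (cc x34)"
  by (simp only: embed_def mk_index)

lemma cc_add: "cc (x + y) = cc x + cc y" by (simp add: cc_def fun_eq_iff)

lemma cc_inject [simp]: "cc x = cc y \<longleftrightarrow> x = y"
  by (simp add: cc_def fun_eq_iff)

lemma embed_mult:
  assumes "M \<in> carrier Gam" "N \<in> carrier Gam"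
  shows "embed (M * N) = embed M * embed N"
proof -
  have d: "M \<in> carrier_mat 4 4" "N \<in> carrier_mat 4 4" using assms by (auto simp: A4_mem)
  have e: "M $$ (0,0) = 1" "M $$ (3,3) = 1" "M $$ (1,0) = 0" "M $$ (2,0) = 0" "M $$ (3,0) = 0"
    "M $$ (2,1) = 0" "M $$ (3,1) = 0" "M $$ (3,2) = 0"
    "N $$ (0,0) = 1" "N $$ (3,3) = 1" "N $$ (1,0) = 0" "N $$ (2,0) = 0" "N $$ (3,0) = 0"
    "N $$ (2,1) = 0" "N $$ (3,1) = 0" "N $$ (3,2) = 0"
    using assms unfolding A4_mem by auto
  show ?thesis
    by (rule ut_eqI)
       (simp_all add: embed_def mult_mat_4_index[OF d] e e[simplified] cc_simps(1)[symmetric]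
         cc_add[symmetric] add.assoc)
qed

lemma embed_inj: "inj_on embed (carrier (Gam :: 'k::field poly fract mat monoid))"
proof (rule inj_onI)
  fix M N :: "'k poly fract mat"
  assume M: "M \<in> carrier Gam" and N: "N \<in> carrier Gam" and e: "embed M = embed N"
  have d: "M \<in> carrier_mat 4 4" "N \<in> carrier_mat 4 4" using M N by (auto simp: A4_mem)
  show "M = N"
  proof (rule eq_matI)
    fix i j assume "i < dim_row N" "j < dim_col N"
    then have "i \<in> {0,1,2,3}" "j \<in> {0,1,2,3}" using d by auto
    then show "M $$ (i,j) = N $$ (i,j)"
      using M N e unfolding A4_mem embed_def ut.inject cc_inject by auto
  qed (use d in auto)
qed

interpretation P: places "eps3 :: place \<Rightarrow> place \<Rightarrow> 'k::field poly fract" Bv3 "\<lambda>i j. cc (tu i j)" c03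
  by (rule places_rational)

lemma B_iff: "x \<in> P.B n \<longleftrightarrow> (\<forall>v. pv v ^ n * x v \<in> Ov v)"
  by (simp add: P.B_def Bv3_def eps3_def)

lemma Runits_units: "a \<in> Runits \<longleftrightarrow> (\<exists>c i j. c \<noteq> 0 \<and> a = const_fract c * tu i j)"
proof
  assume "a \<in> Runits"
  then show "\<exists>c i j. c \<noteq> 0 \<and> a = const_fract c * tu i j"
    using R_units[of a "inverse a"] by (simp add: Runits_def)
next
  assume "\<exists>c i j. c \<noteq> 0 \<and> a = const_fract c * tu i j"
  then obtain c i j where a: "c \<noteq> 0" "a = const_fract c * tu i j" by blast
  have "(const_fract c * tu i j) * (const_fract (inverse c) * tu (-i) (-j))
      = (const_fract c * const_fract (inverse c)) * (tu i j * tu (-i) (-j))" by (simp only: ac_simps)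
  also have "\<dots> = 1" using a(1) by (simp add: const_fract_inverse tu_add tu_zero)
  finally have "a * (const_fract (inverse c) * tu (-i) (-j)) = 1" by (simp only: a)
  then have "inverse a = const_fract (inverse c) * tu (-i) (-j)" "a \<noteq> 0"
    by (auto intro: inverse_unique)
  then show "a \<in> Runits"
    by (simp add: Runits_def R_closed R_gens R_tu a(2))
qed

lemma P_units: "x \<in> P.units \<longleftrightarrow> (\<exists>a\<in>Runits. x = cc a)"
proof -
  have "x \<in> P.units \<longleftrightarrow> (\<exists>c i j. c \<noteq> 0 \<and> x = cc (const_fract c * tu i j))"
    unfolding P.units_def by (auto simp: c03_def cc_simps(1))
  then show ?thesis unfolding Bex_def Runits_units by auto
qed

lemma embed_G: "M \<in> carrier Gam \<Longrightarrow> embed M \<in> P.G"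
  by (auto simp: P.G_def embed_def P_units A4_mem Runits_def simp flip: cc_simps)

text \<open>After the diagonal part is split off on the left, the entries are approximated by elements of the
  ring one diagonal after the other; the corrections involve only entries that are already fixed.\<close>

lemma embed_cocompact:
  assumes g: "g \<in> P.G"
  shows "\<exists>M\<in>carrier (Gam :: 'k::field poly fract mat monoid). \<exists>k\<in>P.Sz 0. g = embed M * k"
proof -
  obtain ap :: "(place \<Rightarrow> 'k poly fract) \<Rightarrow> 'k poly fract"
    where ap: "\<And>x. ap x \<in> ring_t_inv" "\<And>x v. x v - ap x \<in> Ov v"
    using approx by metis
  have apB: "x - cc (ap x) \<in> P.B 0" for x by (simp add: B_iff ap cc_simps)
  obtain a b where ab: "dA g = cc a" "a \<in> Runits" "dB g = cc b" "b \<in> Runits"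
    using g by (auto simp: P.G_def P_units)
  have a0: "a \<noteq> 0" "b \<noteq> 0" using ab by (auto simp: Runits_def)
  have "cc a * dA' g = 1" "cc b * dB' g = 1" 
    using g unfolding P.G_def ab(1,3)[symmetric] by auto
  from this[THEN fun_cong] have inv: "a * dA' g v = 1" "b * dB' g v = 1" for v
    by (simp_all add: cc_simps)
  have "dA' g v = inverse a" "dB' g v = inverse b" for v
    using inverse_unique[OF inv(1)[of v]] inverse_unique[OF inv(2)[of v]] by simp_all
  then have ab': "dA' g = cc (inverse a)" "dB' g = cc (inverse b)" by (auto simp: cc_def)
  define c12 where "c12 = ap (m12 g)"
  define c23 where "c23 = ap (cc (inverse a) * m23 g)"
  define c34 where "c34 = ap (cc (inverse b) * m34 g)"
  define k12 where "k12 = m12 g - cc c12"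
  define k23 where "k23 = cc (inverse a) * m23 g - cc c23"
  define k34 where "k34 = cc (inverse b) * m34 g - cc c34"
  define c13 where "c13 = ap (m13 g - cc c12 * k23)"
  define c24 where "c24 = ap (cc (inverse a) * m24 g - cc c23 * k34)"
  define k13 where "k13 = m13 g - cc c12 * k23 - cc c13"
  define k24 where "k24 = cc (inverse a) * m24 g - cc c23 * k34 - cc c24"
  define c14 where "c14 = ap (m14 g - cc c12 * k24 - cc c13 * k34)"
  define k14 where "k14 = m14 g - cc c12 * k24 - cc c13 * k34 - cc c14"
  define k where "k = UT 1 1 1 1 k12 k13 k14 k23 k24 k34"
  define M where "M = mk a b c12 c13 c14 (a * c23) (a * c24) (b * c34)"
  have cR: "c12 \<in> ring_t_inv" "c13 \<in> ring_t_inv" "c14 \<in> ring_t_inv" "c23 \<in> ring_t_inv"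
    "c24 \<in> ring_t_inv" "c34 \<in> ring_t_inv"
    by (simp_all add: c12_def c13_def c14_def c23_def c24_def c34_def ap(1))
  have "a \<in> ring_t_inv" "b \<in> ring_t_inv" using ab by (auto simp: Runits_def)
  then have M: "M \<in> carrier Gam" unfolding M_def using ab cR by (intro mk_carrier R_closed)
  have kB: "k12 \<in> P.B 0" "k13 \<in> P.B 0" "k14 \<in> P.B 0" "k23 \<in> P.B 0" "k24 \<in> P.B 0" "k34 \<in> P.B 0"
    unfolding k12_def c12_def k13_def c13_def k14_def c14_def k23_def c23_def k24_def c24_def k34_def c34_def
    by (rule apB)+
  have "1 \<in> (P.units :: (place \<Rightarrow> 'k poly fract) set)" by (rule P.units_c0[OF P.c0_one])
  then have k: "k \<in> P.Sz 0"
    using kB P.B_one by (simp add: k_def P.Sz_def P.G_def)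
  have i: "cc a * (cc (inverse a) * x) = x" "cc b * (cc (inverse b) * x) = x" for x
    using a0 by (simp_all add: cc_def fun_eq_iff)
  have "g = embed M * k"
  proof (rule ut_eqI)
    have "cc a * k23 + cc (a * c23) = cc a * (k23 + cc c23)" by (simp add: cc_simps(1) distrib_left)
    also have "\<dots> = m23 g" by (simp add: k23_def i)
    finally show "m23 g = m23 (embed M * k)" by (simp add: M_def embed_mk k_def)
    have "cc b * k34 + cc (b * c34) = cc b * (k34 + cc c34)" by (simp add: cc_simps(1) distrib_left)
    also have "\<dots> = m34 g" by (simp add: k34_def i)
    finally show "m34 g = m34 (embed M * k)" by (simp add: M_def embed_mk k_def)
    have "cc a * k24 + cc (a * c23) * k34 + cc (a * c24) = cc a * (k24 + cc c23 * k34 + cc c24)"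
      by (simp add: cc_simps(1) distrib_left mult.assoc)
    also have "\<dots> = m24 g" by (simp add: k24_def i)
    finally show "m24 g = m24 (embed M * k)" by (simp add: M_def embed_mk k_def)
  qed (simp_all add: M_def embed_mk k_def ab ab' k12_def k13_def k14_def)
  then show ?thesis using M k by blast
qed

lemma finite_embed:
  assumes "finite (UNIV :: 'k::field set)"
  shows "finite {M \<in> carrier (Gam :: 'k poly fract mat monoid). embed M \<in> P.Sz n}"
proof -
  define A where "A = {x :: 'k poly fract. x \<in> ring_t_inv \<and> (\<forall>v. pv v ^ n * x \<in> Ov v)}"
  have A: "finite A" unfolding A_def by (rule finite_R_bounded[OF assms])
  define S where "S = {M \<in> carrier (Gam :: 'k poly fract mat monoid). embed M \<in> P.Sz n}"
  define entries where "entries M = (M $$ (1,1), M $$ (2,2), M $$ (0,1), M $$ (0,2), M $$ (0,3), M $$ (1,2),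
    M $$ (1,3), M $$ (2,3))" for M :: "'k poly fract mat"
  have inj: "inj_on entries S"
  proof (rule inj_onI)
    fix M N assume "M \<in> S" "N \<in> S" "entries M = entries N"
    then have "embed M = embed N" "M \<in> carrier Gam" "N \<in> carrier Gam"
      by (simp_all add: entries_def embed_def S_def)
    then show "M = N" using embed_inj by (auto dest: inj_onD)
  qed
  have "entries M \<in> A \<times> A \<times> A \<times> A \<times> A \<times> A \<times> A \<times> A" if M: "M \<in> S" for M
  proof -
    have R: "M $$ (i,j) \<in> ring_t_inv" if "i \<in> {0,1,2,3}" "j \<in> {0,1,2,3}" for i j
      using M that unfolding S_def A4_mem by blast
    have "cc x \<in> P.B n \<Longrightarrow> x \<in> ring_t_inv \<Longrightarrow> x \<in> A" for x
      by (simp add: A_def B_iff cc_simps)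
    note mem = this[OF _ R]
    have "embed M \<in> P.Sz n" using M by (simp add: S_def)
    then show ?thesis
      unfolding entries_def P.Sz_def embed_def by (simp add: mem)
  qed
  then have "entries ` S \<subseteq> A \<times> A \<times> A \<times> A \<times> A \<times> A \<times> A \<times> A" by blast
  moreover have "finite (A \<times> A \<times> A \<times> A \<times> A \<times> A \<times> A \<times> A)" using A by simp
  ultimately have "finite (entries ` S)" by (rule finite_subset)
  then show ?thesis unfolding S_def[symmetric] using inj by (rule finite_imageD)
qed

text \<open>On the lattice the representative is the element itself, as \<open>word_at\<close> requires.\<close>

definition coset_rep :: "(place \<Rightarrow> 'k::field poly fract) ut \<Rightarrow> 'k poly fract mat" where
  "coset_rep g = (if g \<in> embed ` carrier Gam then inv_into (carrier Gam) embed g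
     else SOME M. M \<in> carrier Gam \<and> (\<exists>k\<in>P.Sz 0. g = embed M * k))"

lemma coset_rep_embed: "M \<in> carrier Gam \<Longrightarrow> coset_rep (embed M) = M"
  by (simp add: coset_rep_def inv_into_f_f[OF embed_inj])

lemma coset_rep:
  assumes "g \<in> P.G"
  shows "coset_rep g \<in> carrier Gam \<and> (\<exists>k\<in>P.Sz 0. g = embed (coset_rep g) * k)"
proof (cases "g \<in> embed ` carrier Gam")
  case True
  then obtain M where "M \<in> carrier Gam" "g = embed M" by blast
  then show ?thesis by (auto simp: coset_rep_embed intro!: bexI[of _ 1] P.Sz_one)
next
  case False
  have "\<exists>M. M \<in> carrier Gam \<and> (\<exists>k\<in>P.Sz 0. g = embed M * k)" using embed_cocompact[OF assms] by blast
  from someI_ex[OF this] show ?thesis using False by (simp add: coset_rep_def)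
qed

lemma lattice_A4:
  assumes "finite (UNIV :: 'k::field set)"
  shows "lattice_in eps3 Bv3 (\<lambda>i j. cc (tu i j)) c03 (Gam :: 'k poly fract mat monoid) embed coset_rep"
proof (intro lattice_in.intro lattice_in_axioms.intro places_rational group_A4 subring_ring_t_inv)
  show "embed (x \<otimes>\<^bsub>Gam\<^esub> y) = embed x * embed y" if "x \<in> carrier Gam" "y \<in> carrier Gam"
    for x y :: "'k poly fract mat" using embed_mult[OF that] by (simp add: A4_def)
  show "finite {M \<in> carrier (Gam :: 'k poly fract mat monoid). embed M \<in> P.Sz n}" for n
    by (rule finite_embed[OF assms])
qed (use coset_rep coset_rep_embed embed_G in auto)

theorem corollary1p7:
  fixes p :: nat
  assumes "prime p" and "card (UNIV :: 'k::field set) = p"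
  shows "finitely_presented (A4 (ring_t_inv :: 'k poly fract set)) \<and>
         quadratic_Dehn_function (A4 (ring_t_inv :: 'k poly fract set))"
proof -
  have "finite (UNIV :: 'k set)"
    using assms prime_gt_0_nat[of p] by (metis card.infinite less_irrefl)
  then interpret lattice_in eps3 Bv3 "\<lambda>i j. cc (tu i j)" c03 "A4 (ring_t_inv :: 'k poly fract set)" embed coset_rep
    by (rule lattice_A4)
  show ?thesis using lattice_finitely_presented lattice_quadratic by blast
qed

end
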